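(* Let $w\in S_n$ and let $\lambda$ be a partition. The Edelman–Greene coefficient $j^w_\lambda$ equals the number of $w$-EG pipedreams $P$ with $\lambda(P)=\lambda$.
   Context: Squares are indexed by matrix coordinates $(i,j)$ (row $i$ increasing downward, column $j$ increasing rightward). Tiles: empty; NW elbow (pipe joining north and west edges); SE elbow (joining south and east edges); horizontal; vertical; crossing (no double-elbow tile). For $w\in S_n$, a $w$-square bumpless pipedream is a tiling of $\{(i,j)\mid1\le i,j\le n\}$ with pipes labeled $1,\dots,n$, pipe $j$ entering from the south in column $j$ and exiting east in row $w^{-1}(j)$, any two pipes crossing at most once. It is a $w$-EG pipedream if its empty tiles form a partition shape $\lambda$ in the northwest corner, i.e. the empty tiles are exactly $\{(i,j)\mid 1\le j\le\lambda_i\}$ for a partition $\lambda=\lambda(P)$. The Stanley symmetric function of $w$ is $F_w=\sum_{a_1\cdots a_\ell\in R(w)}\sum x_{b_1}\cdots x_{b_\ell}$, inner sum over integers $b_1\le\cdots\le b_\ell\le0$ with $b_i<b_{i+1}$ whenever $a_i<a_{i+1}$, $R(w)$ the reduced words of $w$; $j^w_\lambda$ is defined by $F_w=\sum_\lambda j^w_\lambda s_\lambda$ (Schur functions in $x_i$, $i\le0$). *)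

theory Defs
  imports "HOL-Combinatorics.Permutations" "HOL-Library.Multiset" "HOL-Library.FuncSet"
begin

section \<open>Partitions\<close>

text \<open>Partitions are weakly decreasing lists of positive parts: \<open>\<lambda>\<^sub>i\<close> is \<open>la ! (i - 1)\<close> for
  \<open>1 \<le> i \<le> length la\<close>, and \<open>0\<close> for larger \<open>i\<close>.\<close>

definition is_partition :: "nat list \<Rightarrow> bool" where
  "is_partition la \<longleftrightarrow> sorted_wrt (\<ge>) la \<and> 0 \<notin> set la"

definition diagram :: "nat list \<Rightarrow> (nat \<times> nat) set" where
  "diagram la = {(i, j). 1 \<le> i \<and> i \<le> length la \<and> 1 \<le> j \<and> j \<le> la ! (i - 1)}"

section \<open>Square bumpless pipedreams\<close>

datatype side = North | South | East | West

datatype tile = Empty | NW_elbow | SE_elbow | Horizontal | Vertical | Crossing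

text \<open>Pipes are traversed from their south end to their east end, so each segment of pipe in a
  tile enters through the south or west edge and leaves through the north or east edge.\<close>

fun segments :: "tile \<Rightarrow> (side \<times> side) set" where
  "segments Empty = {}"
| "segments NW_elbow = {(West, North)}"
| "segments SE_elbow = {(South, East)}"
| "segments Horizontal = {(West, East)}"
| "segments Vertical = {(South, North)}"
| "segments Crossing = {(South, North), (West, East)}"

definition meets :: "tile \<Rightarrow> side \<Rightarrow> bool" where
  "meets t s \<longleftrightarrow> s \<in> fst ` segments t \<union> snd ` segments t"

type_synonym tiling = "nat \<times> nat \<Rightarrow> tile"

text \<open>Coordinates are matrix coordinates. The boundary conditions say that exactly one pipe
  enters at each column from the south, one leaves at each row to the east, and there are no
  other pipe ends. Tilings are extensional functions, so that they can be counted.\<close>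

definition pipe_tiling :: "nat \<Rightarrow> tiling \<Rightarrow> bool" where
  "pipe_tiling n P \<longleftrightarrow>
     P \<in> ({1..n} \<times> {1..n}) \<rightarrow>\<^sub>E UNIV \<and>
     (\<forall>i\<in>{1..n}. \<forall>j\<in>{1..<n}. meets (P (i, j)) East \<longleftrightarrow> meets (P (i, j + 1)) West) \<and>
     (\<forall>i\<in>{1..<n}. \<forall>j\<in>{1..n}. meets (P (i, j)) South \<longleftrightarrow> meets (P (i + 1, j)) North) \<and>
     (\<forall>j\<in>{1..n}. meets (P (n, j)) South \<and> \<not> meets (P (1, j)) North) \<and>
     (\<forall>i\<in>{1..n}. meets (P (i, n)) East \<and> \<not> meets (P (i, 1)) West)"

text \<open>\<open>pipe_enters n P p c s\<close>: the pipe labeled \<open>p\<close>, which starts at the south edge of column \<open>p\<close>,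
  enters square \<open>c\<close> through its edge \<open>s\<close>.\<close>

inductive pipe_enters :: "nat \<Rightarrow> tiling \<Rightarrow> nat \<Rightarrow> nat \<times> nat \<Rightarrow> side \<Rightarrow> bool"
  for n :: nat and P :: tiling and p :: nat where
  start: "p \<in> {1..n} \<Longrightarrow> pipe_enters n P p (n, p) South"
| north: "pipe_enters n P p (i, j) s \<Longrightarrow> (s, North) \<in> segments (P (i, j)) \<Longrightarrow> 1 < i \<Longrightarrow>
    pipe_enters n P p (i - 1, j) South"
| east: "pipe_enters n P p (i, j) s \<Longrightarrow> (s, East) \<in> segments (P (i, j)) \<Longrightarrow> j < n \<Longrightarrow>
    pipe_enters n P p (i, j + 1) West"

definition pipe_exits_at_row :: "nat \<Rightarrow> tiling \<Rightarrow> nat \<Rightarrow> nat \<Rightarrow> bool" where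
  "pipe_exits_at_row n P p i \<longleftrightarrow>
     (\<exists>s. pipe_enters n P p (i, n) s \<and> (s, East) \<in> segments (P (i, n)))"

definition pipes_cross_at :: "nat \<Rightarrow> tiling \<Rightarrow> nat \<Rightarrow> nat \<Rightarrow> nat \<times> nat \<Rightarrow> bool" where
  "pipes_cross_at n P p q c \<longleftrightarrow> P c = Crossing \<and>
     (pipe_enters n P p c South \<and> pipe_enters n P q c West \<or>
      pipe_enters n P q c South \<and> pipe_enters n P p c West)"

text \<open>The labeling of the pipes is determined by the tiles, so it is not recorded separately.\<close>

definition square_bumpless_pipedream :: "nat \<Rightarrow> (nat \<Rightarrow> nat) \<Rightarrow> tiling \<Rightarrow> bool" where
  "square_bumpless_pipedream n w P \<longleftrightarrow>
     pipe_tiling n P \<and>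
     (\<forall>p\<in>{1..n}. pipe_exits_at_row n P p (inv w p)) \<and>
     (\<forall>p\<in>{1..n}. \<forall>q\<in>{1..n}. p \<noteq> q \<longrightarrow>
        (\<forall>c d. pipes_cross_at n P p q c \<and> pipes_cross_at n P p q d \<longrightarrow> c = d))"

definition empty_squares :: "nat \<Rightarrow> tiling \<Rightarrow> (nat \<times> nat) set" where
  "empty_squares n P = {c \<in> {1..n} \<times> {1..n}. P c = Empty}"

definition EG_pipedream :: "nat \<Rightarrow> (nat \<Rightarrow> nat) \<Rightarrow> tiling \<Rightarrow> bool" where
  "EG_pipedream n w P \<longleftrightarrow> square_bumpless_pipedream n w P \<and>
     (\<exists>la. is_partition la \<and> empty_squares n P = diagram la)"

definition EG_shape :: "nat \<Rightarrow> tiling \<Rightarrow> nat list" where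
  "EG_shape n P = (THE la. is_partition la \<and> empty_squares n P = diagram la)"

section \<open>Schur functions and Stanley symmetric functions\<close>

text \<open>A formal power series with integer coefficients in the variables \<open>x\<^sub>i\<close> (\<open>i\<close> an integer) is
  given by its coefficient function; the monomial \<open>x\<^sub>b x\<^sub>c \<dots>\<close> is the multiset \<open>{#b, c, \<dots>#}\<close> of
  its indices. Only variables with index at most \<open>0\<close> occur in the series below.\<close>

type_synonym series = "int multiset \<Rightarrow> int"

definition semistandard_tableaux :: "nat list \<Rightarrow> (nat \<times> nat \<Rightarrow> int) set" where
  "semistandard_tableaux la = {T \<in> diagram la \<rightarrow>\<^sub>E {..0}.
     (\<forall>i j k. (i, j) \<in> diagram la \<and> (i, k) \<in> diagram la \<and> j < k \<longrightarrow> T (i, j) \<le> T (i, k)) \<and>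
     (\<forall>i j k. (i, k) \<in> diagram la \<and> (j, k) \<in> diagram la \<and> i < j \<longrightarrow> T (i, k) < T (j, k))}"

definition schur :: "nat list \<Rightarrow> series" where
  "schur la m =
     int (card {T \<in> semistandard_tableaux la. image_mset T (mset_set (diagram la)) = m})"

text \<open>The product \<open>s\<^sub>a s\<^sub>b \<dots>\<close> of the simple transpositions \<open>s\<^sub>a = (a a+1)\<close> of a word, as a
  composition of functions (the rightmost factor acts first).\<close>

definition word_perm :: "nat list \<Rightarrow> nat \<Rightarrow> nat" where
  "word_perm as = foldr (\<lambda>a v. transpose a (a + 1) \<circ> v) as id"

definition reduced_words :: "nat \<Rightarrow> (nat \<Rightarrow> nat) \<Rightarrow> nat list set" where
  "reduced_words n w = {as. set as \<subseteq> {1..<n} \<and> word_perm as = w \<and>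
     (\<forall>bs. set bs \<subseteq> {1..<n} \<and> word_perm bs = w \<longrightarrow> length as \<le> length bs)}"

definition compatible :: "nat list \<Rightarrow> int list \<Rightarrow> bool" where
  "compatible as bs \<longleftrightarrow> length bs = length as \<and> sorted bs \<and> set bs \<subseteq> {..0} \<and>
     (\<forall>i. i + 1 < length as \<longrightarrow> as ! i < as ! (i + 1) \<longrightarrow> bs ! i < bs ! (i + 1))"

definition stanley :: "nat \<Rightarrow> (nat \<Rightarrow> nat) \<Rightarrow> series" where
  "stanley n w m =
     int (card {(as, bs). as \<in> reduced_words n w \<and> compatible as bs \<and> mset bs = m})"

text \<open>The coefficients of the (finite) expansion of a symmetric function in Schur functions,
  extended by \<open>0\<close> to lists that are not partitions.\<close>

definition schur_expansion :: "series \<Rightarrow> (nat list \<Rightarrow> int) \<Rightarrow> bool" where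
  "schur_expansion F c \<longleftrightarrow>
     finite {la. c la \<noteq> 0} \<and> (\<forall>la. c la \<noteq> 0 \<longrightarrow> is_partition la) \<and>
     F = (\<lambda>m. \<Sum>la | c la \<noteq> 0. c la * schur la m)"

definition EG_coeff :: "nat \<Rightarrow> (nat \<Rightarrow> nat) \<Rightarrow> nat list \<Rightarrow> int" where
  "EG_coeff n w = (THE c. schur_expansion (stanley n w) c)"

end

theory Submission
  imports Defs "HOL-Library.List_Lexorder"
begin

text \<open>A permutation \<open>w\<close> is read as the map from rows to the labels of the pipes that leave in these
  rows. Peeling the last letters off the reduced words of \<open>w\<close>, one variable at a time, gives its
  Stanley coefficients as a product of operators \<open>1 + x \<partial>\<^sub>a\<close>. The signed sum over the Bruhat covers of \<open>w\<close>
  that move a fixed label commutes with each such product up to boundary terms, and it increases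
  lengths, so it annihilates the Stanley coefficients: this is the Lascoux-Schuetzenberger transition formula.

  An EG pipedream is analysed from its last column to its first. Column \<open>j\<close> contains the pipe \<open>j\<close>, which
  turns east in its row \<open>x\<close>. If some row \<open>c < x\<close> below another pipe is left by no pipe, then for
  the largest such \<open>c\<close> the tile \<open>(c, j)\<close> is a NW elbow; replacing it and the SE elbow \<open>(x, j)\<close> by tiles
  without elbows is a bijection that matches the terms of a transition formula. If there is no such
  row, the column is determined, its height is the number of rows above all pipes, and it can be
  removed; on the other side, a chain of one-term transitions moves a column of this
  height into a Grassmannian part of the permutation. When no columns are left, the permutation is
  Grassmannian, and its Stanley coefficients satisfy the recursion of the Kostka numbers by removal of horizontal strips.\<close>

section \<open>The transition formula for Stanley coefficients\<close>

text \<open>The expansion is compared coefficient by coefficient: \<open>peel_all lo hi es\<close>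
  belongs to one monomial with exponents \<open>es\<close>, so all identities are about integers
  attached to permutations. Transitions follow a fixed label and not a fixed row: column
  \<open>j\<close> of a tiling is governed by its own pipe, while the labels above \<open>j\<close>,
  left over from columns already treated, only have to stay increasing. A treated column must still
  be remembered, since the shape is known only when no column is left. The rows and labels
  \<open>- n, \<dots>, 0\<close> serve as this memory, and storing a column there must not change
  any coefficient; hence the chain of transitions with a single term. Crossing at most once is a
  global condition. It is traded for an inequality between the two labels at each crossing, so that
  tiles can be replaced in one column without looking at the others. Finally,
  \<open>EG_coeff\<close> is a definite description, so the uniqueness of Schur expansions has to be
  shown too; it comes from the unitriangularity of the Kostka numbers in the lexicographic
  order.\<close>

abbreviation sw :: "int \<Rightarrow> int \<Rightarrow> int" where
  "sw a \<equiv> transpose a (a + 1)"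

text \<open>A Bruhat cover: multiplying \<open>w\<close> by the transposition of \<open>x\<close>
  and \<open>y\<close> raises the number of inversions by exactly one.\<close>

definition covers :: "(int \<Rightarrow> int) \<Rightarrow> int \<Rightarrow> int \<Rightarrow> bool" where
  "covers w x y \<longleftrightarrow> x < y \<and> w x < w y \<and> (\<forall>z. x < z \<and> z < y \<longrightarrow> \<not> (w x < w z \<and> w z < w y))"

definition cover_sign :: "(int \<Rightarrow> int) \<Rightarrow> int \<Rightarrow> int \<Rightarrow> int" where
  "cover_sign w x y = of_bool (covers w x y) - of_bool (covers w y x)"

text \<open>Fixing the label \<open>r\<close> rather than its row fits right multiplication by
  \<open>sw a\<close>, which moves rows and keeps labels. Moves of \<open>r\<close> to a larger row
  count positively, moves to a smaller row negatively.\<close>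

definition cover_op :: "int set \<Rightarrow> int \<Rightarrow> ((int \<Rightarrow> int) \<Rightarrow> int) \<Rightarrow> (int \<Rightarrow> int) \<Rightarrow> int" where
  "cover_op I r \<phi> w = (\<Sum>y\<in>I. cover_sign w (inv w r) y * \<phi> (w \<circ> transpose (inv w r) y))"

text \<open>Removal of a last letter \<open>a\<close> from reduced words; the value is
  \<open>0\<close> where no reduced word ends in \<open>a\<close>.\<close>

definition descent_op :: "int \<Rightarrow> ((int \<Rightarrow> int) \<Rightarrow> int) \<Rightarrow> (int \<Rightarrow> int) \<Rightarrow> int" where
  "descent_op a \<phi> w = (if w a > w (a + 1) then \<phi> (w \<circ> sw a) else 0)"

definition none_between :: "(int \<Rightarrow> int) \<Rightarrow> int \<Rightarrow> int \<Rightarrow> int \<Rightarrow> int \<Rightarrow> bool" where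
  "none_between v p q l h \<longleftrightarrow> (\<forall>z. p < z \<and> z < q \<longrightarrow> \<not> (l < v z \<and> v z < h))"

lemma covers_iff: "covers v x y \<longleftrightarrow> x < y \<and> v x < v y \<and> none_between v x y (v x) (v y)"
  by (simp add: covers_def none_between_def)

lemma none_between_split_left:
  assumes "p + 1 < q"
  shows "none_between v p q l h \<longleftrightarrow> \<not> (l < v (p + 1) \<and> v (p + 1) < h) \<and> none_between v (p + 1) q l h"
proof -
  have *: "(p < z \<and> z < q) \<longleftrightarrow> (z = p + 1 \<or> (p + 1 < z \<and> z < q))" for z using assms by auto
  show ?thesis by (simp only: none_between_def *) auto
qed

lemma none_between_split_right:
  assumes "p < q"
  shows "none_between v p (q + 1) l h \<longleftrightarrow> \<not> (l < v q \<and> v q < h) \<and> none_between v p q l h"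
proof -
  have *: "(p < z \<and> z < q + 1) \<longleftrightarrow> (z = q \<or> (p < z \<and> z < q))" for z using assms by auto
  show ?thesis by (simp only: none_between_def *) auto
qed

lemma none_between_swap:
  assumes "p \<noteq> a" "q \<noteq> a + 1"
  shows "none_between (v \<circ> sw a) p q l h \<longleftrightarrow> none_between v p q l h"
proof -
  have *: "p < sw a z \<and> sw a z < q \<longleftrightarrow> p < z \<and> z < q" for z
    using assms by (auto simp: transpose_def)
  show ?thesis unfolding none_between_def comp_apply using * by (metis transpose_involutory)
qed

text \<open>Passing from \<open>w\<close> to \<open>w \<circ> sw a\<close> changes the set of rows
  strictly between the two end points by at most one row, and only if \<open>a\<close> or
  \<open>a + 1\<close> is an end point. Whether the label of that row obstructs the cover is exactly
  the difference between the two descent conditions. The excluded pair is the one whose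
  transposition is \<open>sw a\<close> itself.\<close>

lemma covers_swap:
  assumes "inj w" "x < y" "(x, y) \<noteq> (a, a + 1)"
  shows "covers w x y \<and> (w \<circ> transpose x y) (a + 1) < (w \<circ> transpose x y) a \<longleftrightarrow>
    w (a + 1) < w a \<and> covers (w \<circ> sw a) (sw a x) (sw a y)"
proof -
  have ne: "w u \<noteq> w v" if "u \<noteq> v" for u v using assms(1) that by (auto simp: inj_def)
  consider (1) "x \<noteq> a" "x \<noteq> a + 1" "y \<noteq> a" "y \<noteq> a + 1"
    | (2) "x = a + 1" | (3) "x = a" "y > a + 1" | (4) "y = a" | (5) "y = a + 1" "x < a"
    using assms by force
  then show ?thesis
  proof cases
    case 1
    then have "none_between (w \<circ> sw a) x y l h \<longleftrightarrow> none_between w x y l h" for l h by (intro none_between_swap) auto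
    with 1 show ?thesis by (auto simp: covers_iff)
  next
    case 2
    then have "y > a + 1" using assms by simp
    moreover from this have "none_between (w \<circ> sw a) a y l h \<longleftrightarrow> \<not> (l < w a \<and> w a < h) \<and> none_between w (a + 1) y l h" for l h
      by (subst none_between_split_left, simp, subst none_between_swap) auto
    ultimately show ?thesis using 2 ne[of a y] ne[of a "a + 1"]
      by (auto simp: covers_iff)
  next
    case 3
    then have "none_between (w \<circ> sw a) (a + 1) y l h \<longleftrightarrow> none_between w (a + 1) y l h" for l h by (intro none_between_swap) auto
    moreover have "none_between w a y l h \<longleftrightarrow> \<not> (l < w (a + 1) \<and> w (a + 1) < h) \<and> none_between w (a + 1) y l h" for l h
      using 3 by (intro none_between_split_left) simp
    ultimately show ?thesis using 3 ne[of "a + 1" y] ne[of a "a + 1"]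
      by (auto simp: covers_iff)
  next
    case 4
    then have "x < a" using assms by simp
    moreover from this have "none_between (w \<circ> sw a) x (a + 1) l h \<longleftrightarrow> \<not> (l < w (a + 1) \<and> w (a + 1) < h) \<and> none_between w x a l h" for l h
      by (subst none_between_split_right, simp, subst none_between_swap) auto
    ultimately show ?thesis using 4 ne[of x "a + 1"] ne[of a "a + 1"]
      by (auto simp: covers_iff)
  next
    case 5
    then have "none_between (w \<circ> sw a) x a l h \<longleftrightarrow> none_between w x a l h" for l h by (intro none_between_swap) auto
    moreover have "none_between w x (a + 1) l h \<longleftrightarrow> \<not> (l < w a \<and> w a < h) \<and> none_between w x a l h" for l h
      using 5 by (intro none_between_split_right) simp
    ultimately show ?thesis using 5 ne[of x a] ne[of a "a + 1"]
      by (auto simp: covers_iff)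
  qed
qed

lemma cover_sign_swap:
  assumes "inj w" "{x, y} \<noteq> {a, a + 1}"
  shows "cover_sign w x y * of_bool ((w \<circ> transpose x y) (a + 1) < (w \<circ> transpose x y) a) =
    of_bool (w (a + 1) < w a) * cover_sign (w \<circ> sw a) (sw a x) (sw a y)"
proof -
  have *: "cover_sign w x y * of_bool ((w \<circ> transpose x y) (a + 1) < (w \<circ> transpose x y) a) =
    of_bool (w (a + 1) < w a) * cover_sign (w \<circ> sw a) (sw a x) (sw a y)"
    if "x < y" "{x, y} \<noteq> {a, a + 1}" for x y
  proof -
    have "\<not> covers w y x" using that by (auto simp: covers_def)
    moreover have "\<not> covers (w \<circ> sw a) (sw a y) (sw a x)"
      using that by (auto simp: covers_def transpose_def split: if_splits)
    ultimately show ?thesis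
      using covers_swap[OF assms(1) that(1), of a] that(2) by (auto simp: cover_sign_def)
  qed
  have sym: "cover_sign v p q = - cover_sign v q p" for v p q by (auto simp: cover_sign_def)
  consider "x < y" | "y < x" | "x = y" by linarith
  then show ?thesis
  proof cases
    case 1 then show ?thesis using * assms by blast
  next
    case 2
    have "{y, x} \<noteq> {a, a + 1}" using assms(2) by (simp add: insert_commute)
    from *[OF 2 this] show ?thesis
      by (simp add: sym[of w x y] sym[of "w \<circ> sw a" "sw a x" "sw a y"] transpose_commute[of x y] del: comp_apply)
  next
    case 3 then show ?thesis by (auto simp: cover_sign_def)
  qed
qed

lemma transpose_comp_swap:
  "transpose x y \<circ> sw a = sw a \<circ> transpose (sw a x) (sw a y)"
proof -
  have "bij (sw a)" by simp
  then show ?thesis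
    by (simp add: fun_eq_iff transpose_def)
qed

text \<open>Substituting \<open>sw a y\<close> for \<open>y\<close> matches the two sums term by
  term. The only unmatched summand is the one whose transposition is \<open>sw a\<close>; it arises
  when \<open>r\<close> is in row \<open>a\<close> or \<open>a + 1\<close> and gives the correction,
  with opposite signs in the two cases.\<close>

lemma cover_op_descent:
  assumes w: "bij w" and I: "finite I" "a \<in> I" "a + 1 \<in> I"
  shows "cover_op I r (descent_op a \<psi>) w = descent_op a (cover_op I r \<psi>) w +
    (of_bool (w a = r) - of_bool (w (a + 1) = r)) * \<psi> w"
proof -
  define x where "x = inv w r"
  have wx: "w x = r" unfolding x_def using w by (simp add: bij_is_surj surj_f_inv_f)
  have wxi: "w z = r \<longleftrightarrow> z = x" for z using wx w by (metis bij_is_inj injD)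
  have inj: "inj w" using w bij_is_inj by blast
  have inv': "inv (w \<circ> sw a) r = sw a x"
    using w by (simp add: o_inv_distrib x_def bij_is_inj)
  have ss: "w \<circ> sw a \<circ> transpose (sw a x) (sw a y) = w \<circ> transpose x y \<circ> sw a" for y
    by (simp add: comp_assoc transpose_comp_swap)
  have injs: "inj_on (sw a) I" by (rule inj_on_inverseI[of _ "sw a"]) simp
  have sI: "sw a ` I = I" using I by (auto simp: transpose_def image_iff)
  have D2: "cover_op I r \<psi> (w \<circ> sw a) =
    (\<Sum>y\<in>I. cover_sign (w \<circ> sw a) (sw a x) (sw a y) * \<psi> (w \<circ> transpose x y \<circ> sw a))"
  proof -
    have "cover_op I r \<psi> (w \<circ> sw a) = (\<Sum>y\<in>sw a ` I. cover_sign (w \<circ> sw a) (sw a x) y * \<psi> (w \<circ> sw a \<circ> transpose (sw a x) y))"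
      unfolding cover_op_def inv' sI ..
    also have "\<dots> = (\<Sum>y\<in>I. cover_sign (w \<circ> sw a) (sw a x) (sw a y) * \<psi> (w \<circ> sw a \<circ> transpose (sw a x) (sw a y)))"
      by (simp only: sum.reindex[OF injs] o_def)
    finally show ?thesis unfolding ss .
  qed
  define f where "f y = (cover_sign w x y * of_bool ((w \<circ> transpose x y) (a + 1) < (w \<circ> transpose x y) a) -
    of_bool (w (a + 1) < w a) * cover_sign (w \<circ> sw a) (sw a x) (sw a y)) * \<psi> (w \<circ> transpose x y \<circ> sw a)" for y
  have "cover_op I r (descent_op a \<psi>) w - descent_op a (cover_op I r \<psi>) w = sum f I"
    unfolding descent_op_def D2 unfolding cover_op_def x_def[symmetric] f_def
    by (auto simp: left_diff_distrib sum_subtractf intro!: sum.cong)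
  also have "\<dots> = (of_bool (x = a) - of_bool (x = a + 1)) * \<psi> w"
  proof (cases "x = a \<or> x = a + 1")
    case False
    then have "{x, y} \<noteq> {a, a + 1}" for y by (auto simp: doubleton_eq_iff)
    then have "f y = 0" for y unfolding f_def by (subst cover_sign_swap[OF inj]) simp_all
    then show ?thesis using False by simp
  next
    case True
    \<comment> \<open>The partner row of \<open>x\<close>: the transposition of \<open>x\<close> and
      \<open>y0\<close> is \<open>sw a\<close>.\<close>
    define y0 where "y0 = sw a x"
    have y0: "y0 \<in> I" using True I by (auto simp: y0_def)
    have "f y = 0" if "y \<noteq> y0" for y
    proof -
      have "{x, y} \<noteq> {a, a + 1}" using that True by (auto simp: y0_def transpose_def doubleton_eq_iff)
      then show ?thesis unfolding f_def by (subst cover_sign_swap[OF inj]) simp_all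
    qed
    then have "sum f I = f y0"
      using I y0 by (subst sum.remove[of _ y0]) auto
    also have "\<dots> = (of_bool (x = a) - of_bool (x = a + 1)) * \<psi> w"
    proof -
      have t: "transpose x y0 = sw a" using True by (auto simp: y0_def transpose_commute)
      have "w a \<noteq> w (a + 1)" using injD[OF inj, of a "a + 1"] by auto
      then have "cover_sign w x y0 * of_bool ((w \<circ> sw a) (a + 1) < (w \<circ> sw a) a) -
        of_bool (w (a + 1) < w a) * cover_sign (w \<circ> sw a) (sw a x) (sw a y0) = of_bool (x = a) - of_bool (x = a + 1)"
        using True by (auto simp: y0_def cover_sign_def covers_def)
      then show ?thesis unfolding f_def t by (simp add: comp_assoc)
    qed
    finally show ?thesis .
  qed
  finally show ?thesis by (simp add: wxi eq_commute[of x])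
qed

section \<open>Stanley coefficients as coefficients of operator products\<close>

fun peel :: "int list \<Rightarrow> int \<Rightarrow> ((int \<Rightarrow> int) \<Rightarrow> int) \<Rightarrow> (int \<Rightarrow> int) \<Rightarrow> int" where
  "peel [] e \<phi> w = (if e = 0 then \<phi> w else 0)"
| "peel (a # as) e \<phi> w = peel as e \<phi> w + descent_op a (peel as (e - 1) \<phi>) w"

text \<open>One factor \<open>peel [lo..hi] e\<close> per variable, the coefficient of
  \<open>x^e\<close> in a product of operators \<open>1 + x * descent_op a\<close>. Its letters
  increase because equal subscripts force the letters of a reduced word to decrease, and words are
  read from their end. So \<open>es\<close> starts with the exponent of the largest variable.
  Exponents are integers, with coefficient \<open>0\<close> for negative ones, so that
  \<open>e - 1\<close> needs no case split.\<close>

fun peel_all :: "int \<Rightarrow> int \<Rightarrow> int list \<Rightarrow> (int \<Rightarrow> int) \<Rightarrow> int" where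
  "peel_all lo hi [] w = (if w = id then 1 else 0)"
| "peel_all lo hi (e # es) w = peel [lo..hi] e (peel_all lo hi es) w"

lemma peel_all_Cons: "peel_all lo hi (e # es) = peel [lo..hi] e (peel_all lo hi es)"
  by (simp add: fun_eq_iff)

lemma peel_neg: "e < 0 \<Longrightarrow> peel as e \<phi> w = 0"
  by (induction as arbitrary: e w) (auto simp: descent_op_def)

lemma cover_op_add: "cover_op I r (\<lambda>v. f v + g v) w = cover_op I r f w + cover_op I r g w"
  by (simp add: cover_op_def distrib_left sum.distrib)

text \<open>The corrections of \<open>cover_op_descent\<close> telescope: the term for row
  \<open>a + 1\<close> produced by the first factor cancels the left boundary term of the remaining
  product. Only the rows \<open>a\<close> and \<open>hi + 1\<close> at the two ends
  contribute.\<close>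

lemma cover_op_peel:
  assumes "finite I" "{a..hi + 1} \<subseteq> I" "bij w" "a \<le> hi + 1"
  shows "cover_op I r (peel [a..hi] e \<phi>) w = of_bool (w a = r) * peel [a..hi] (e - 1) \<phi> w +
    peel [a..hi] e (cover_op I r \<phi>) w - peel [a..hi] (e - 1) (\<lambda>v. of_bool (v (hi + 1) = r) * \<phi> v) w"
  using assms(2-4)
proof (induction "nat (hi + 1 - a)" arbitrary: a e w)
  case 0
  then have "a = hi + 1" by simp
  then show ?case by (simp add: cover_op_def)
next
  case (Suc k)
  then have a: "a \<le> hi" by simp
  then have l: "[a..hi] = a # [a+1..hi]" by (simp add: upto_rec1)
  have IH: "cover_op I r (peel [a+1..hi] e \<phi>) w = of_bool (w (a+1) = r) * peel [a+1..hi] (e - 1) \<phi> w +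
    peel [a+1..hi] e (cover_op I r \<phi>) w - peel [a+1..hi] (e - 1) (\<lambda>v. of_bool (v (hi + 1) = r) * \<phi> v) w"
    if "bij w" for e w
  proof (rule Suc.hyps(1))
    show "k = nat (hi + 1 - (a + 1))" "{a+1..hi + 1} \<subseteq> I" using Suc.hyps(2) Suc.prems(1) by auto
  qed (use that a in auto)
  have "cover_op I r (peel [a..hi] e \<phi>) w =
    cover_op I r (peel [a+1..hi] e \<phi>) w + cover_op I r (descent_op a (peel [a+1..hi] (e - 1) \<phi>)) w"
    unfolding l peel.simps by (rule cover_op_add)
  also have "cover_op I r (descent_op a (peel [a+1..hi] (e - 1) \<phi>)) w =
    descent_op a (cover_op I r (peel [a+1..hi] (e - 1) \<phi>)) w +
    (of_bool (w a = r) - of_bool (w (a + 1) = r)) * peel [a+1..hi] (e - 1) \<phi> w"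
    using Suc.prems a by (intro cover_op_descent assms(1)) auto
  also have "descent_op a (cover_op I r (peel [a+1..hi] (e - 1) \<phi>)) w =
     of_bool (w a = r) * descent_op a (peel [a+1..hi] (e - 1 - 1) \<phi>) w
     + descent_op a (peel [a+1..hi] (e - 1) (cover_op I r \<phi>)) w
     - descent_op a (peel [a+1..hi] (e - 1 - 1) (\<lambda>v. of_bool (v (hi + 1) = r) * \<phi> v)) w"
    using IH[of "w \<circ> sw a" "e - 1"] Suc.prems by (auto simp: descent_op_def bij_comp)
  also
  note D = calculation
  have R: "peel [a..hi] e \<phi> w = peel [a+1..hi] e \<phi> w + descent_op a (peel [a+1..hi] (e - 1) \<phi>) w" for e \<phi>
    by (simp add: l)
  show ?case
    unfolding D R IH[OF Suc.prems(2)] by (simp add: algebra_simps)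
qed

text \<open>A row outside the support is fixed and the labels of the support stay inside it, so such
  a row cannot take part in a descent.\<close>

lemma permutes_swap:
  assumes "w permutes {lo+1..hi}" "w a > w (a + 1)"
  shows "lo < a" "a < hi" "w \<circ> sw a permutes {lo+1..hi}"
proof -
  have fx: "w z = z" if "z \<le> lo \<or> z > hi" for z
    using assms(1) that by (auto simp: permutes_def)
  have rg: "w z \<in> {lo+1..hi} \<longleftrightarrow> z \<in> {lo+1..hi}" for z
    using permutes_in_image[OF assms(1)] by blast
  show 1: "lo < a"
  proof (rule ccontr)
    assume "\<not> lo < a"
    then have "w a = a" using fx by simp
    then show False using fx[of "a+1"] rg[of "a+1"] assms(2) \<open>\<not> lo < a\<close> by force
  qed
  show 2: "a < hi"
  proof (rule ccontr)
    assume "\<not> a < hi"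
    then have "w (a+1) = a+1" using fx by simp
    then show False using fx[of a] rg[of a] assms(2) \<open>\<not> a < hi\<close> by force
  qed
  show "w \<circ> sw a permutes {lo+1..hi}"
    by (rule permutes_compose[OF permutes_swap_id assms(1)]) (use 1 2 in auto)
qed

lemma peel_cong:
  assumes "w permutes {lo+1..hi}" "\<And>v. v permutes {lo+1..hi} \<Longrightarrow> \<phi> v = \<psi> v"
  shows "peel as e \<phi> w = peel as e \<psi> w"
  using assms(1)
proof (induction as arbitrary: e w)
  case Nil then show ?case using assms(2) by simp
next
  case (Cons a as)
  show ?case
  proof (cases "w (a + 1) < w a")
    case True
    then show ?thesis
      by (simp only: peel.simps descent_op_def Cons.IH[OF Cons.prems] Cons.IH[OF permutes_swap(3)[OF Cons.prems True]])
  next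
    case False
    then show ?thesis by (simp add: descent_op_def Cons.IH[OF Cons.prems])
  qed
qed

lemma peel_zero: "peel as e (\<lambda>v. 0) w = 0"
  by (induction as arbitrary: e w) (auto simp: descent_op_def)

text \<open>The rows \<open>lo\<close> and \<open>hi + 1\<close> next to the support carry their own
  labels, which differ from \<open>r\<close>, so both boundary terms of \<open>cover_op_peel\<close>
  vanish for every variable. When no variable is left, a nonzero summand would make
  \<open>id\<close> a cover of \<open>w\<close>, which is impossible.\<close>

theorem transition_zero:
  assumes "w permutes {lo+1..hi}" "r \<in> {lo+1..hi}"
  shows "cover_op {lo..hi+1} r (peel_all lo hi es) w = 0"
  using assms(1)
proof (induction es arbitrary: w)
  case Nil
  have "cover_sign w x y * (if w \<circ> transpose x y = id then 1 else 0) = 0" for x y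
  proof (cases "w \<circ> transpose x y = id")
    case True
    then have "w = transpose x y" by (metis comp_assoc comp_id id_comp transpose_comp_involutory)
    then show ?thesis by (auto simp: cover_sign_def covers_def)
  qed simp
  then show ?case unfolding cover_op_def peel_all.simps by (intro sum.neutral ballI)
next
  case (Cons e es)
  have lohi: "lo \<le> hi + 1" using assms(2) by auto
  have fx: "w lo = lo" "w (hi+1) = hi + 1" using Cons.prems by (auto simp: permutes_def)
  have "cover_op {lo..hi+1} r (peel_all lo hi (e # es)) w =
    of_bool (w lo = r) * peel [lo..hi] (e - 1) (peel_all lo hi es) w +
    peel [lo..hi] e (cover_op {lo..hi+1} r (peel_all lo hi es)) w -
    peel [lo..hi] (e - 1) (\<lambda>v. of_bool (v (hi + 1) = r) * peel_all lo hi es v) w"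
    using cover_op_peel[of "{lo..hi+1}" lo hi w r e "peel_all lo hi es"] permutes_bij[OF Cons.prems] lohi
    by (simp add: peel_all_Cons)
  also have "of_bool (w lo = r) = (0 :: int)" using fx assms by auto
  also have "peel [lo..hi] e (cover_op {lo..hi+1} r (peel_all lo hi es)) w = peel [lo..hi] e (\<lambda>v. 0) w"
    by (rule peel_cong[OF Cons.prems]) (rule Cons.IH)
  also have "peel [lo..hi] (e - 1) (\<lambda>v. of_bool (v (hi + 1) = r) * peel_all lo hi es v) w = peel [lo..hi] (e - 1) (\<lambda>v. 0) w"
  proof (rule peel_cong[OF Cons.prems])
    fix v assume "v permutes {lo+1..hi}"
    then have "v (hi + 1) = hi + 1" by (auto simp: permutes_def)
    then show "of_bool (v (hi + 1) = r) * peel_all lo hi es v = 0" using assms by auto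
  qed
  finally show ?case by (simp add: peel_zero)
qed

section \<open>Grassmannian states\<close>

text \<open>\<open>\<mu>\<close> lists column heights, so a horizontal strip takes at most one box,
  the lowest one, from each column.\<close>

definition strips :: "(nat \<Rightarrow> nat) \<Rightarrow> (nat \<Rightarrow> nat) set" where
  "strips \<mu> = {\<nu>. antimono \<nu> \<and> (\<forall>i. \<nu> i = \<mu> i \<or> \<nu> i + 1 = \<mu> i)}"

text \<open>The Kostka number of the shape with column heights \<open>\<mu>\<close>, computed by
  removing the boxes of the largest entry first.\<close>

fun kostka :: "(nat \<Rightarrow> nat) \<Rightarrow> int list \<Rightarrow> int" where
  "kostka \<mu> [] = (if \<mu> = (\<lambda>_. 0) then 1 else 0)"
| "kostka \<mu> (e # es) = (\<Sum>\<nu> | \<nu> \<in> strips \<mu> \<and> int (card {i. \<nu> i \<noteq> \<mu> i}) = e. kostka \<nu> es)"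

text \<open>Row \<open>x\<close> carries the label \<open>w x\<close>. The labels \<open>0, -1, \<dots>, -n\<close> encode the columns \<open>\<mu>\<close>
  in Grassmannian fashion, and the labels above \<open>j\<close> play the role of empty rows.\<close>

definition state :: "nat \<Rightarrow> nat \<Rightarrow> (nat \<Rightarrow> nat) \<Rightarrow> (int \<Rightarrow> int) \<Rightarrow> bool" where
  "state n j \<mu> w \<longleftrightarrow> w permutes {- int n..int n} \<and> j \<le> n \<and> antimono \<mu> \<and> (\<forall>i. n - j \<le> i \<longrightarrow> \<mu> i = 0) \<and>
    (\<forall>i\<le>n. w (int (\<mu> i) - int i) = - int i) \<and>
    (\<forall>x y. x < y \<and> int j < w x \<and> int j < w y \<longrightarrow> w x < w y) \<and>
    (\<forall>x. 1 \<le> w x \<and> w x \<le> int j \<longrightarrow> int (\<mu> 0) < x)"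

abbreviation peel_sym :: "nat \<Rightarrow> int list \<Rightarrow> (int \<Rightarrow> int) \<Rightarrow> int" where
  "peel_sym n \<equiv> peel_all (- int n - 1) (int n)"

text \<open>The letter that removes the lowest box of column \<open>i\<close> is one less than the
  row \<open>\<mu> i - i\<close> of the label \<open>- i\<close>. The bound thus selects the strips
  whose boxes are within reach of the letters \<ge> \<open>a\<close>.\<close>

definition strips_above :: "int \<Rightarrow> (nat \<Rightarrow> nat) \<Rightarrow> (nat \<Rightarrow> nat) set" where
  "strips_above a \<mu> = {\<nu>. antimono \<nu> \<and> (\<forall>i. \<nu> i = \<mu> i \<or> \<nu> i + 1 = \<mu> i \<and> a < int (\<mu> i) - int i)}"

lemma finite_strips:
  assumes "\<forall>i\<ge>N. \<mu> i = 0"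
  shows "finite (strips \<mu>)"
proof (rule finite_subset)
  show "strips \<mu> \<subseteq> (\<lambda>A i. if i \<in> A then \<mu> i - 1 else \<mu> i) ` Pow {..<N}"
  proof
    fix \<nu> assume \<nu>: "\<nu> \<in> strips \<mu>"
    show "\<nu> \<in> (\<lambda>A i. if i \<in> A then \<mu> i - 1 else \<mu> i) ` Pow {..<N}"
    proof (rule image_eqI)
      show "\<nu> = (\<lambda>i. if i \<in> {i. \<nu> i \<noteq> \<mu> i} then \<mu> i - 1 else \<mu> i)"
      proof
        fix i
        have "\<nu> i = \<mu> i \<or> \<nu> i + 1 = \<mu> i" using \<nu> unfolding strips_def by blast
        then show "\<nu> i = (if i \<in> {i. \<nu> i \<noteq> \<mu> i} then \<mu> i - 1 else \<mu> i)" by auto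
      qed
      show "{i. \<nu> i \<noteq> \<mu> i} \<in> Pow {..<N}"
      proof -
        have "i < N" if "\<nu> i \<noteq> \<mu> i" for i
        proof (rule ccontr)
          assume "\<not> i < N"
          then have "\<mu> i = 0" using assms by simp
          then show False using \<nu> that unfolding strips_def by (metis (mono_tags, lifting) add_is_0 mem_Collect_eq one_neq_zero)
        qed
        then show ?thesis by auto
      qed
    qed
  qed
qed simp

lemma strips_above_subset: "strips_above a \<mu> \<subseteq> strips \<mu>"
  by (auto simp: strips_above_def strips_def)

lemma antimono_shift_less:
  assumes "antimono (\<mu> :: nat \<Rightarrow> nat)" "i < l"
  shows "int (\<mu> l) - int l < int (\<mu> i) - int i"
  using antimonoD[OF assms(1), of i l] assms(2) by simp

text \<open>Strong induction on the row: if \<open>w x\<close> exceeded a positive \<open>x\<close>,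
  the label \<open>x\<close> would sit in a later row, against the monotonicity of the positive
  labels.\<close>

lemma increasing_permutes_id:
  assumes w: "w permutes {- int n..int n}"
    and neg: "\<And>x. - int n \<le> x \<Longrightarrow> x \<le> 0 \<Longrightarrow> w x = x"
    and inc: "\<And>x y. x < y \<Longrightarrow> 0 < w x \<Longrightarrow> 0 < w y \<Longrightarrow> w x < w y"
  shows "w = id"
proof -
  have out: "w x = x" if "x < - int n \<or> x > int n" for x using w that by (auto simp: permutes_def)
  have "w x = x" if "x \<ge> - int n" for x
    using that
  proof (induction "nat (x + int n)" arbitrary: x rule: less_induct)
    case less
    have IH: "w z = z" if "z < x" for z
      using less.hyps[of z] out[of z] that less.prems by fastforce
    show ?case
    proof (cases "x \<le> 0")
      case True then show ?thesis using neg less.prems by simp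
    next
      case False
      have "\<not> w x < x" using IH[of "w x"] permutes_inj[OF w] by (metis injD less_irrefl)
      moreover have "\<not> w x > x"
      proof
        assume gt: "w x > x"
        obtain y where y: "w y = x" using permutes_surj[OF w] by (metis surjD)
        have "y > x" using IH[of y] y gt by (metis less_irrefl linorder_neqE)
        then show False using inc[of x y] y gt False by auto
      qed
      ultimately show ?thesis by simp
    qed
  qed
  then have "w x = x" for x using out[of x] by (cases "x < - int n") auto
  then show ?thesis by (auto simp: fun_eq_iff)
qed

text \<open>The nonpositive labels increase downwards, and so do the positive ones, so a descent is
  a positive label directly above a label \<open>- i\<close>. Exchanging the two moves
  \<open>- i\<close> up by one row, which removes the lowest box of column \<open>i\<close>.\<close>

lemma state0_descent:
  assumes st: "state n 0 \<mu> w" and d: "w (a + 1) < w a"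
  obtains i where "i < n" "a + 1 = int (\<mu> i) - int i" "w (a + 1) = - int i" "0 < w a"
    "\<mu> (i + 1) < \<mu> i" "state n 0 (\<mu>(i := \<mu> i - 1)) (w \<circ> sw a)"
proof -
  have w: "w permutes {- int n..int n}" and am: "antimono \<mu>" and z: "\<And>i. n \<le> i \<Longrightarrow> \<mu> i = 0"
    and pad: "\<And>i. i \<le> n \<Longrightarrow> w (int (\<mu> i) - int i) = - int i"
    and inc: "\<And>x y. x < y \<Longrightarrow> 0 < w x \<Longrightarrow> 0 < w y \<Longrightarrow> w x < w y"
    using st by (auto simp: state_def)
  have inj: "w x = w y \<Longrightarrow> x = y" for x y using permutes_inj[OF w] by (auto simp: inj_def)
  have w': "w permutes {(- int n - 1) + 1..int n}" using w by simp
  note ps = permutes_swap[OF w' d]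
  have "w (a + 1) \<le> 0" using inc[of a "a+1"] d by force
  moreover have "w (a + 1) \<ge> - int n" using permutes_in_image[OF w, of "a+1"] ps by auto
  ultimately obtain i where i: "i \<le> n" "w (a + 1) = - int i"
    by (metis minus_le_iff neg_0_le_iff_le nonneg_int_cases of_nat_le_iff minus_minus)
  have ai: "a + 1 = int (\<mu> i) - int i" using inj[of "a+1" "int (\<mu> i) - int i"] pad[OF i(1)] i(2) by simp
  have wa: "0 < w a"
  proof (rule ccontr)
    assume "\<not> 0 < w a"
    moreover have "w a \<ge> - int n" using permutes_in_image[OF w, of a] ps by auto
    ultimately obtain l where l: "l \<le> n" "w a = - int l"
      by (metis minus_le_iff neg_0_le_iff_le nonneg_int_cases of_nat_le_iff minus_minus not_less)
    then have "a = int (\<mu> l) - int l" using inj[of a "int (\<mu> l) - int l"] pad by simp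
    moreover have "l < i" using l i d by simp
    ultimately show False using antimono_shift_less[OF am, of l i] ai by simp
  qed
  have lt: "i < n" using i z[of i] ai ps by (cases "i = n") auto
  have mu: "\<mu> (i + 1) < \<mu> i"
  proof -
    have "\<mu> (i + 1) \<noteq> \<mu> i"
    proof
      assume "\<mu> (i + 1) = \<mu> i"
      then have "int (\<mu> (i + 1)) - int (i + 1) = a" using ai by simp
      then have "w a = - int (i + 1)" using pad[of "i+1"] lt by (metis Suc_eq_plus1 Suc_leI)
      then show False using wa by simp
    qed
    moreover have "\<mu> (i + 1) \<le> \<mu> i" using antimonoD[OF am, of i "i+1"] by simp
    ultimately show ?thesis by simp
  qed
  have "state n 0 (\<mu>(i := \<mu> i - 1)) (w \<circ> sw a)"
    unfolding state_def
  proof (intro conjI allI impI)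
    show "w \<circ> sw a permutes {- int n..int n}" using ps by simp
    show "antimono (\<mu>(i := \<mu> i - 1))"
    proof (rule antimonoI)
      fix p q :: nat assume "p \<le> q"
      then consider "p = q" | "p < q" "q = i" | "p = i" "i + 1 \<le> q" | "p < q" "p \<noteq> i" "q \<noteq> i" by linarith
      then show "(\<mu>(i := \<mu> i - 1)) q \<le> (\<mu>(i := \<mu> i - 1)) p"
      proof cases
        case 2 then show ?thesis using antimonoD[OF am, of p q] by auto
      next
        case 3 then show ?thesis using antimonoD[OF am, of "i+1" q] mu by auto
      next
        case 4 then show ?thesis using antimonoD[OF am, of p q] by auto
      qed auto
    qed
  next
    fix l assume "n - 0 \<le> l" then show "(\<mu>(i := \<mu> i - 1)) l = 0" using z lt by auto
  next
    fix l assume l: "l \<le> n"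
    show "(w \<circ> sw a) (int ((\<mu>(i := \<mu> i - 1)) l) - int l) = - int l"
    proof (cases "l = i")
      case True
      then have "int ((\<mu>(i := \<mu> i - 1)) l) - int l = a" using ai mu by auto
      then show ?thesis using i True by simp
    next
      case False
      then have "int (\<mu> l) - int l \<noteq> a + 1" using pad[OF l] i by auto
      moreover have "int (\<mu> l) - int l \<noteq> a" using pad[OF l] wa by auto
      ultimately show ?thesis using False pad[OF l] by simp
    qed
  next
    fix x y assume xy: "x < y \<and> int 0 < (w \<circ> sw a) x \<and> int 0 < (w \<circ> sw a) y"
    have na: "x \<noteq> a" "y \<noteq> a" using xy i by auto
    have "sw a x < sw a y" using na xy by (auto simp: transpose_def)
    then show "(w \<circ> sw a) x < (w \<circ> sw a) y" using inc xy by simp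
  next
    fix x assume "1 \<le> (w \<circ> sw a) x \<and> (w \<circ> sw a) x \<le> int 0"
    then show "int ((\<mu>(i := \<mu> i - 1)) 0) < x" by simp
  qed simp
  then show ?thesis using that lt ai i(2) wa mu by blast
qed

text \<open>The letters come in increasing order, so a label that has moved up is not touched again,
  and every column loses at most one box. A column as high as its right neighbour can lose a box
  only after that neighbour has, which is the condition that \<open>\<nu>\<close> is
  antimonotone.\<close>

lemma state0_peel:
  assumes "state n 0 \<mu> w" "a \<le> int n + 1"
    and IH: "\<And>\<nu> v. state n 0 \<nu> v \<Longrightarrow> \<phi> v = k \<nu>"
  shows "peel [a..int n] e \<phi> w =
    (\<Sum>\<nu> | \<nu> \<in> strips_above a \<mu> \<and> int (card {i. \<nu> i \<noteq> \<mu> i}) = e. k \<nu>)"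
  using assms(1,2)
proof (induction "nat (int n + 1 - a)" arbitrary: a e \<mu> w)
  case 0
  then have a: "a = int n + 1" by simp
  have "strips_above a \<mu> = {\<mu>}"
  proof -
    have w: "w permutes {- int n..int n}" and pad: "\<And>i. i \<le> n \<Longrightarrow> w (int (\<mu> i) - int i) = - int i"
       and am: "antimono \<mu>" and z: "\<And>i. n \<le> i \<Longrightarrow> \<mu> i = 0"
      using 0(2) by (auto simp: state_def)
    have le: "int (\<mu> i) - int i \<le> int n" for i
      using permutes_in_image[OF w, of "int (\<mu> i) - int i"] pad[of i] z[of i] by (cases "i \<le> n") auto
    then have "\<not> a < int (\<mu> i) - int i" for i using a le[of i] by linarith
    then show ?thesis using am by (auto simp: strips_above_def)
  qed
  then have "{\<nu>. \<nu> \<in> strips_above a \<mu> \<and> int (card {i. \<nu> i \<noteq> \<mu> i}) = e} = (if e = 0 then {\<mu>} else {})"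
    by auto
  then show ?case using IH[OF 0(2)] a by simp
next
  case (Suc d)
  have w: "w permutes {- int n..int n}" and pad: "\<And>i. i \<le> n \<Longrightarrow> w (int (\<mu> i) - int i) = - int i"
     and am: "antimono \<mu>" and z: "\<And>i. n \<le> i \<Longrightarrow> \<mu> i = 0"
    using Suc.prems by (auto simp: state_def)
  have inj: "w x = w y \<Longrightarrow> x = y" for x y using permutes_inj[OF w] by (auto simp: inj_def)
  have a: "a \<le> int n" using Suc.hyps(2) by simp
  then have l: "[a..int n] = a # [a+1..int n]" by (simp add: upto_rec1)
  have IHs: "peel [a+1..int n] e \<phi> w =
    (\<Sum>\<nu> | \<nu> \<in> strips_above (a+1) \<mu> \<and> int (card {i. \<nu> i \<noteq> \<mu> i}) = e. k \<nu>)"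
    if "state n 0 \<mu> w" for \<mu> w e
    using Suc.hyps(1)[of "a+1" \<mu> w e] Suc.hyps(2) a that by simp
  have fin: "finite (strips_above a \<mu>)"
    using finite_subset[OF strips_above_subset finite_strips] z by blast
  show ?case
  proof (cases "w (a + 1) < w a")
    case True
    obtain i where i: "i < n" "a + 1 = int (\<mu> i) - int i" "w (a + 1) = - int i" "0 < w a"
        "\<mu> (i + 1) < \<mu> i" and st': "state n 0 (\<mu>(i := \<mu> i - 1)) (w \<circ> sw a)"
      using state0_descent[OF Suc.prems(1) True] by metis
    let ?\<mu> = "\<mu>(i := \<mu> i - 1)"
    have ne: "int (\<mu> l) - int l \<noteq> a + 1" if "l \<noteq> i" for l
      using antimono_shift_less[OF am, of l i] antimono_shift_less[OF am, of i l] i(2) that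
      by (cases "l < i") auto
    \<comment> \<open>Only column \<open>i\<close> has its lowest box at \<open>a + 1\<close>, so
      raising the bound by one just forbids the removal of this box.\<close>
    have eq1: "strips_above (a+1) \<mu> = {\<nu> \<in> strips_above a \<mu>. \<nu> i = \<mu> i}"
    proof -
      have "a + 1 < int (\<mu> l) - int l \<longleftrightarrow> a < int (\<mu> l) - int l \<and> l \<noteq> i" for l
        using ne[of l] i(2) by (cases "l = i") auto
      then show ?thesis using i(5) by (fastforce simp: strips_above_def)
    qed
    \<comment> \<open>After the removal column \<open>i\<close> ends at \<open>a\<close>, out of
      reach of the later letters, so it loses no second box.\<close>
    have eq2: "strips_above (a+1) ?\<mu> = {\<nu> \<in> strips_above a \<mu>. \<nu> i \<noteq> \<mu> i}"
    proof (intro set_eqI iffI)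
      fix \<nu> assume "\<nu> \<in> strips_above (a+1) ?\<mu>"
      then have am': "antimono \<nu>" and c: "\<And>l. \<nu> l = ?\<mu> l \<or> \<nu> l + 1 = ?\<mu> l \<and> a + 1 < int (?\<mu> l) - int l"
        by (auto simp: strips_above_def)
      have ci: "\<nu> i = \<mu> i - 1" using c[of i] i(2) by auto
      have "\<nu> l = \<mu> l \<or> \<nu> l + 1 = \<mu> l \<and> a < int (\<mu> l) - int l" for l
        using c[of l] ci i by (cases "l = i") auto
      then show "\<nu> \<in> {\<nu> \<in> strips_above a \<mu>. \<nu> i \<noteq> \<mu> i}" using am' ci i(5) by (auto simp: strips_above_def)
    next
      fix \<nu> assume "\<nu> \<in> {\<nu> \<in> strips_above a \<mu>. \<nu> i \<noteq> \<mu> i}"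
      then have am': "antimono \<nu>" and c: "\<And>l. \<nu> l = \<mu> l \<or> \<nu> l + 1 = \<mu> l \<and> a < int (\<mu> l) - int l" and ci: "\<nu> i \<noteq> \<mu> i"
        by (auto simp: strips_above_def)
      have "\<nu> l = ?\<mu> l \<or> \<nu> l + 1 = ?\<mu> l \<and> a + 1 < int (?\<mu> l) - int l" for l
        using c[of l] ci ne[of l] by (cases "l = i") auto
      then show "\<nu> \<in> strips_above (a+1) ?\<mu>" using am' by (auto simp: strips_above_def)
    qed
    have card': "int (card {l. \<nu> l \<noteq> ?\<mu> l}) = e - 1 \<longleftrightarrow> int (card {l. \<nu> l \<noteq> \<mu> l}) = e"
      if "\<nu> \<in> strips_above a \<mu>" "\<nu> i \<noteq> \<mu> i" for \<nu>
    proof -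
      have c: "\<And>l. \<nu> l = \<mu> l \<or> \<nu> l + 1 = \<mu> l" using that by (auto simp: strips_above_def)
      have "{l. \<nu> l \<noteq> \<mu> l} = insert i {l. \<nu> l \<noteq> ?\<mu> l}"
        using c[of i] that(2) by auto
      moreover have "i \<notin> {l. \<nu> l \<noteq> ?\<mu> l}" using c[of i] that(2) by auto
      moreover have "finite {l. \<nu> l \<noteq> ?\<mu> l}"
      proof (rule finite_subset)
        show "{l. \<nu> l \<noteq> ?\<mu> l} \<subseteq> {..<n}"
        proof
          fix l assume "l \<in> {l. \<nu> l \<noteq> ?\<mu> l}"
          then show "l \<in> {..<n}" using c[of l] z[of l] i(1) by (cases "l = i"; cases "n \<le> l") auto
        qed
      qed simp
      ultimately have "card {l. \<nu> l \<noteq> \<mu> l} = Suc (card {l. \<nu> l \<noteq> ?\<mu> l})"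
        by (metis card_insert_disjoint)
      then show ?thesis by linarith
    qed
    have "peel [a..int n] e \<phi> w =
       (\<Sum>\<nu> | \<nu> \<in> strips_above (a+1) \<mu> \<and> int (card {i. \<nu> i \<noteq> \<mu> i}) = e. k \<nu>) +
       (\<Sum>\<nu> | \<nu> \<in> strips_above (a+1) ?\<mu> \<and> int (card {l. \<nu> l \<noteq> ?\<mu> l}) = e - 1. k \<nu>)"
      unfolding l peel.simps using IHs[OF Suc.prems(1), of e] IHs[OF st', of "e - 1"] True
      by (simp add: descent_op_def)
    also have "{\<nu>. \<nu> \<in> strips_above (a+1) ?\<mu> \<and> int (card {l. \<nu> l \<noteq> ?\<mu> l}) = e - 1} =
      {\<nu>. \<nu> \<in> strips_above a \<mu> \<and> \<nu> i \<noteq> \<mu> i \<and> int (card {l. \<nu> l \<noteq> \<mu> l}) = e}"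
      unfolding eq2 using card' by (intro Collect_cong) blast
    also have "{\<nu>. \<nu> \<in> strips_above (a+1) \<mu> \<and> int (card {i. \<nu> i \<noteq> \<mu> i}) = e} =
      {\<nu>. \<nu> \<in> strips_above a \<mu> \<and> \<nu> i = \<mu> i \<and> int (card {l. \<nu> l \<noteq> \<mu> l}) = e}"
      unfolding eq1 by auto
    also have "sum k {\<nu>. \<nu> \<in> strips_above a \<mu> \<and> \<nu> i = \<mu> i \<and> int (card {l. \<nu> l \<noteq> \<mu> l}) = e} +
      sum k {\<nu>. \<nu> \<in> strips_above a \<mu> \<and> \<nu> i \<noteq> \<mu> i \<and> int (card {l. \<nu> l \<noteq> \<mu> l}) = e} =
      (\<Sum>\<nu> | \<nu> \<in> strips_above a \<mu> \<and> int (card {i. \<nu> i \<noteq> \<mu> i}) = e. k \<nu>)"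
      using fin by (subst sum.union_disjoint[symmetric]) (auto intro!: sum.cong)
    finally show ?thesis .
  next
    case False
    have "strips_above a \<mu> \<subseteq> strips_above (a+1) \<mu>"
    proof
      fix \<nu> assume "\<nu> \<in> strips_above a \<mu>"
      then have am': "antimono \<nu>" and c: "\<And>l. \<nu> l = \<mu> l \<or> \<nu> l + 1 = \<mu> l \<and> a < int (\<mu> l) - int l"
        by (auto simp: strips_above_def)
      have "\<nu> i = \<mu> i \<or> \<nu> i + 1 = \<mu> i \<and> a + 1 < int (\<mu> i) - int i" for i
      proof (rule ccontr)
        \<comment> \<open>Without a descent, row \<open>a\<close> carries a smaller nonpositive
          label, and columns \<open>i\<close> and \<open>i + 1\<close> have equal height. Shortening
          column \<open>i\<close> would require shortening column \<open>i + 1\<close>, whose lowest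
          box is out of range.\<close>
        assume "\<not> ?thesis"
        with c[of i] have i: "\<nu> i + 1 = \<mu> i" "int (\<mu> i) - int i = a + 1" by auto
        then have lt: "i < n" using z[of i] by (cases "n \<le> i") auto
        have wi: "w (a + 1) = - int i" using pad[of i] i lt by simp
        have "w a \<noteq> w (a+1)" using inj[of a "a+1"] by auto
        then have wa: "w a < - int i" using False wi by simp
        have "a \<ge> - int n" using i lt by simp
        then have "w a \<ge> - int n" using permutes_in_image[OF w, of a] a by auto
        then obtain l where l: "l \<le> n" "w a = - int l"
          using wa by (metis minus_le_iff minus_minus neg_0_le_iff_le nonneg_int_cases of_nat_0_le_iff of_nat_le_iff order.trans order_less_imp_le)
        then have al: "a = int (\<mu> l) - int l" using inj[of a "int (\<mu> l) - int l"] pad by simp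
        have "i < l" using l wa by simp
        then have "a \<le> int (\<mu> (i+1)) - int (i+1)"
          using antimono_shift_less[OF am, of "i+1" l] al by (cases "l = i + 1") auto
        moreover have "\<mu> (i+1) \<le> \<mu> i" "\<nu> (i+1) \<le> \<nu> i"
          using antimonoD[OF am, of i "i+1"] antimonoD[OF am', of i "i+1"] by auto
        ultimately show False using c[of "i+1"] i by auto
      qed
      then show "\<nu> \<in> strips_above (a+1) \<mu>" using am' by (auto simp: strips_above_def)
    qed
    moreover have "strips_above (a+1) \<mu> \<subseteq> strips_above a \<mu>" by (fastforce simp: strips_above_def)
    ultimately have "strips_above (a+1) \<mu> = strips_above a \<mu>" by blast
    then show ?thesis unfolding l peel.simps using IHs[OF Suc.prems(1), of e] False by (simp add: descent_op_def)
  qed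
qed

theorem peel_sym_grassmannian:
  assumes "state n 0 \<mu> w"
  shows "peel_sym n es w = kostka \<mu> es"
  using assms
proof (induction es arbitrary: \<mu> w)
  case Nil
  have w: "w permutes {- int n..int n}" and pad: "\<And>i. i \<le> n \<Longrightarrow> w (int (\<mu> i) - int i) = - int i"
     and z: "\<And>i. n \<le> i \<Longrightarrow> \<mu> i = 0"
     and inc: "\<And>x y. x < y \<Longrightarrow> 0 < w x \<Longrightarrow> 0 < w y \<Longrightarrow> w x < w y"
    using Nil by (auto simp: state_def)
  have "w = id \<longleftrightarrow> \<mu> = (\<lambda>_. 0)"
  proof
    assume "w = id"
    then have "\<mu> i = 0" for i using pad[of i] z[of i] by (cases "i \<le> n") auto
    then show "\<mu> = (\<lambda>_. 0)" by auto
  next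
    assume \<mu>: "\<mu> = (\<lambda>_. 0)"
    show "w = id"
    proof (rule increasing_permutes_id[OF w])
      fix x :: int assume "- int n \<le> x" "x \<le> 0"
      then show "w x = x" using pad[of "nat (- x)"] \<mu> by auto
    qed (use inc in auto)
  qed
  then show ?case by simp
next
  case (Cons e es)
  \<comment> \<open>The first letter \<open>- n - 1\<close> is so small that every box is within
    reach.\<close>
  have "strips_above (- int n - 1) \<mu> = strips \<mu>"
  proof -
    have z: "\<And>i. n \<le> i \<Longrightarrow> \<mu> i = 0" using Cons.prems by (auto simp: state_def)
    have "- int n - 1 < int (\<mu> i) - int i" if "x + 1 = \<mu> i" for i x
      using that z[of i] by (cases "n \<le> i") auto
    then show ?thesis by (fastforce simp: strips_above_def strips_def)
  qed
  then show ?case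
    using state0_peel[OF Cons.prems, of "- int n - 1" "peel_sym n es" "\<lambda>\<nu>. kostka \<nu> es" e] Cons.IH
    by simp
qed

section \<open>Transitions of states\<close>

text \<open>The move of the transition formula: the label of row \<open>x\<close> goes to
  \<open>y\<close>, that of \<open>y\<close> to \<open>c\<close>, and that of \<open>c\<close> to
  \<open>x\<close>.\<close>

definition cyc :: "(int \<Rightarrow> int) \<Rightarrow> int \<Rightarrow> int \<Rightarrow> int \<Rightarrow> int \<Rightarrow> int" where
  "cyc w c x y = w \<circ> transpose c x \<circ> transpose c y"

lemma cyc_apply:
  assumes "c \<noteq> x" "y \<noteq> c" "y \<noteq> x"
  shows "cyc w c x y z = (if z = c then w y else if z = y then w x else if z = x then w c else w z)"
  using assms by (auto simp: cyc_def transpose_def)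

text \<open>\<open>transition_zero\<close> is applied to \<open>v = w \<circ> transpose c x\<close>,
  where label \<open>j\<close> sits in row \<open>c\<close>. Since the labels above \<open>j\<close>
  increase, the only cover that moves \<open>j\<close> down leads back to \<open>w\<close>. The
  covers that move \<open>j\<close> up carry the opposite sign and are the summands on the
  right.\<close>

lemma transition_step:
  fixes w :: "int \<Rightarrow> int"
  assumes w: "w permutes {lo+1..hi}" and wx: "w x = j" and j: "j \<in> {lo+1..hi}"
    and inc: "\<And>p q. p < q \<Longrightarrow> j < w p \<Longrightarrow> j < w q \<Longrightarrow> w p < w q"
    and c: "c < x" "j < w c" "lo < c"
    and nh: "\<And>z. c < z \<Longrightarrow> z < x \<Longrightarrow> w z \<le> j"
    and nolo: "\<exists>z. lo < z \<and> z < c \<and> lo < w z \<and> w z < j"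
  shows "peel_all lo hi es w = (\<Sum>y | lo < y \<and> y < c \<and> w y < j \<and>
    (\<forall>z. y < z \<and> z < c \<longrightarrow> \<not> (w y < w z \<and> w z < j)). peel_all lo hi es (cyc w c x y))"
proof -
  define C where "C y \<longleftrightarrow> w y < j \<and> (\<forall>z. y < z \<and> z < c \<longrightarrow> \<not> (w y < w z \<and> w z < j))" for y
  define v where "v = w \<circ> transpose c x"
  have x: "x \<in> {lo+1..hi}" using permutes_in_image[OF w, of x] wx j by simp
  then have cr: "c \<in> {lo+1..hi}" using c by auto
  have v: "v permutes {lo+1..hi}"
    unfolding v_def by (rule permutes_compose[OF permutes_swap_id w]) (use x cr in auto)
  have vc: "v c = j" "v x = w c" and vz: "z \<noteq> c \<Longrightarrow> z \<noteq> x \<Longrightarrow> v z = w z" for z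
    using c wx by (auto simp: v_def)
  have inv: "inv v j = c" using vc permutes_inj[OF v] by (metis inv_f_f)
  \<comment> \<open>A row beyond \<open>x\<close> with a label above \<open>j\<close> is blocked by
    row \<open>x\<close>, which now holds the smaller label \<open>w c\<close>.\<close>
  have e1: "cover_sign v c y = 0" if y: "c < y" "y \<noteq> x" for y
  proof -
    have "\<not> covers v c y"
    proof
      assume cv: "covers v c y"
      then have jy: "j < w y" using vc vz[of y] y by (auto simp: covers_def)
      have "y > x" using nh[of y] y jy by force
      moreover have "\<not> (v c < v x \<and> v x < v y)" using cv c \<open>y > x\<close> by (auto simp: covers_def)
      ultimately show False using vc vz[of y] y c inc[of c y] jy by auto
    qed
    moreover have "\<not> covers v y c" using y by (auto simp: covers_def)
    ultimately show ?thesis by (simp add: cover_sign_def)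
  qed
  have e2: "cover_sign v c x = 1"
  proof -
    have "\<not> (v c < v z \<and> v z < v x)" if "c < z" "z < x" for z using nh[OF that] that vc vz[of z] by auto
    then have "covers v c x" using c vc by (auto simp: covers_def)
    moreover have "\<not> covers v x c" using c by (auto simp: covers_def)
    ultimately show ?thesis by (simp add: cover_sign_def)
  qed
  have e3: "cover_sign v c y = - of_bool (C y)" if y: "y < c" for y
  proof -
    have vz': "v z = w z" if "z < c" for z using vz[of z] that c by auto
    have "covers v y c \<longleftrightarrow> C y"
      unfolding covers_def C_def vc(1) using y vz' by auto
    moreover have "\<not> covers v c y" using y by (auto simp: covers_def)
    ultimately show ?thesis by (simp add: cover_sign_def)
  qed
  have e4: "cover_sign v c c = 0" by (simp add: cover_sign_def)
  let ?f = "\<lambda>y. cover_sign v c y * peel_all lo hi es (v \<circ> transpose c y)"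
  have "0 = (\<Sum>y\<in>{lo..hi+1}. ?f y)"
    using transition_zero[OF v j, of es] by (simp add: cover_op_def inv)
  also have "\<dots> = (\<Sum>y\<in>insert x {y\<in>{lo..<c}. C y}. ?f y)"
  proof (rule sum.mono_neutral_right)
    show "\<forall>y\<in>{lo..hi + 1} - insert x {y \<in> {lo..<c}. C y}. ?f y = 0"
    proof
      fix y assume y: "y \<in> {lo..hi + 1} - insert x {y \<in> {lo..<c}. C y}"
      then consider "y = c" | "c < y" "y \<noteq> x" | "y < c" "\<not> C y" by force
      then show "?f y = 0" by cases (use e1 e3 e4 in auto)
    qed
  qed (use x cr in auto)
  also have "\<dots> = peel_all lo hi es w - (\<Sum>y\<in>{y\<in>{lo..<c}. C y}. peel_all lo hi es (cyc w c x y))"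
  proof -
    have "v \<circ> transpose c x = w" unfolding v_def by (simp add: comp_assoc)
    moreover have "(\<Sum>y\<in>{y\<in>{lo..<c}. C y}. ?f y) = (\<Sum>y\<in>{y\<in>{lo..<c}. C y}. - peel_all lo hi es (cyc w c x y))"
      by (intro sum.cong) (auto simp: e3 cyc_def v_def[symmetric])
    moreover have "finite {y\<in>{lo..<c}. C y}" by (rule finite_subset[of _ "{lo..<c}"]) auto
    then have "(\<Sum>y\<in>insert x {y\<in>{lo..<c}. C y}. ?f y) = ?f x + (\<Sum>y\<in>{y\<in>{lo..<c}. C y}. ?f y)"
      by (rule sum.insert) (use c in auto)
    ultimately show ?thesis using e2 by (simp only: sum_negf)
  qed
  \<comment> \<open>Row \<open>lo\<close> lies outside the support; \<open>nolo\<close> supplies a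
    later row that blocks its cover.\<close>
  also have "{y\<in>{lo..<c}. C y} = {y. lo < y \<and> y < c \<and> C y}"
  proof -
    have "w lo = lo" using w by (auto simp: permutes_def)
    then have "\<not> C lo" using nolo by (auto simp: C_def)
    then show ?thesis by (auto simp: less_le)
  qed
  finally show ?thesis by (simp add: C_def)
qed

lemma cyc_permutes:
  assumes "w permutes S" "c \<in> S" "x \<in> S" "y \<in> S"
  shows "cyc w c x y permutes S"
  unfolding cyc_def using assms by (intro permutes_compose[OF permutes_swap_id] permutes_compose[OF permutes_swap_id assms(1)])

text \<open>Among the labels above \<open>j\<close> only \<open>w c\<close> moves, from
  \<open>c\<close> to \<open>x\<close>, and no such label lies between these two rows.\<close>

lemma cyc_increasing:
  assumes inc: "\<And>p q. p < q \<Longrightarrow> j < w p \<Longrightarrow> j < w q \<Longrightarrow> w p < (w q :: int)"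
    and wx: "w x = j" and c: "c < x" "j < w c" and y: "y < c" "w y < j"
    and nh: "\<And>z. c < z \<Longrightarrow> z < x \<Longrightarrow> w z \<le> j"
    and pq: "p < q" "j < cyc w c x y p" "j < cyc w c x y q"
  shows "cyc w c x y p < cyc w c x y q"
proof -
  have ca: "cyc w c x y z = (if z = c then w y else if z = y then w x else if z = x then w c else w z)" for z
    by (rule cyc_apply) (use c y in auto)
  have ne: "p \<noteq> c" "q \<noteq> c" "p \<noteq> y" "q \<noteq> y" using pq wx y by (auto simp: ca split: if_splits)
  consider "p = x" | "q = x" | "p \<noteq> x" "q \<noteq> x" by blast
  then show ?thesis
  proof cases
    case 1
    then show ?thesis using ne pq c inc[of c q] by (auto simp: ca)
  next
    case 2
    then have "j < w p" "p < x" using ne pq by (auto simp: ca split: if_splits)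
    then have "p < c" using nh[of p] ne by force
    then show ?thesis using 2 ne pq c inc[of p c] \<open>j < w p\<close> by (auto simp: ca)
  next
    case 3
    then show ?thesis using ne pq inc[of p q] by (auto simp: ca)
  qed
qed

text \<open>The three rows involved carry positive labels, so the labels \<open>- i\<close> stay
  put. The labels up to \<open>j\<close> that move land in the rows \<open>y\<close> and
  \<open>c\<close>, which are both beyond \<open>\<mu> 0\<close>.\<close>

lemma state_cyc:
  assumes st: "state n j \<mu> w" and wx: "w x = int j" and c: "c < x" "int j < w c"
    and y: "y < c" "1 \<le> w y" "w y < int j" and c0: "int (\<mu> 0) < c"
    and nh: "\<And>z. c < z \<Longrightarrow> z < x \<Longrightarrow> w z \<le> int j"
  shows "state n j \<mu> (cyc w c x y)"
proof -
  have w: "w permutes {- int n..int n}" and jn: "j \<le> n" 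
    and pad: "\<And>i. i \<le> n \<Longrightarrow> w (int (\<mu> i) - int i) = - int i"
    and inc: "\<And>x y. x < y \<Longrightarrow> int j < w x \<Longrightarrow> int j < w y \<Longrightarrow> w x < w y"
    and up: "\<And>x. 1 \<le> w x \<Longrightarrow> w x \<le> int j \<Longrightarrow> int (\<mu> 0) < x"
    using st by (auto simp: state_def)
  have ca: "cyc w c x y z = (if z = c then w y else if z = y then w x else if z = x then w c else w z)" for z
    by (rule cyc_apply) (use c y in auto)
  have in_range: "z \<in> {- int n..int n} \<longleftrightarrow> w z \<in> {- int n..int n}" for z
    using permutes_in_image[OF w] by blast
  have x: "x \<in> {- int n..int n}" using in_range[of x] wx jn by simp
  have yr: "y \<in> {- int n..int n}" using in_range[of y] y jn by auto
  have cr: "c \<in> {- int n..int n}" using x yr y c by auto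
  have "int j \<ge> 1" using y by linarith
  show ?thesis
    unfolding state_def
  proof (intro conjI allI impI)
    show "cyc w c x y permutes {- int n..int n}" by (rule cyc_permutes[OF w cr x yr])
    fix p q assume "p < q \<and> int j < cyc w c x y p \<and> int j < cyc w c x y q"
    then show "cyc w c x y p < cyc w c x y q"
      using cyc_increasing[where w = w and c = c and x = x and y = y and j = "int j", OF inc wx c y(1,3) nh] by blast
  next
    fix i assume i: "i \<le> n"
    have "w (int (\<mu> i) - int i) \<le> 0" using pad[OF i] by simp
    then have "int (\<mu> i) - int i \<noteq> c" "int (\<mu> i) - int i \<noteq> x" "int (\<mu> i) - int i \<noteq> y"
      using wx c y \<open>int j \<ge> 1\<close> by auto
    then show "cyc w c x y (int (\<mu> i) - int i) = - int i" using pad[OF i] by (simp add: ca)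
  next
    fix z assume z: "1 \<le> cyc w c x y z \<and> cyc w c x y z \<le> int j"
    show "int (\<mu> 0) < z" using z up[of y] up[of z] y c c0 wx by (auto simp: ca split: if_splits)
  qed (use st in \<open>auto simp: state_def\<close>)
qed

text \<open>A column without empty rows between its topmost pipe and its own pipe is moved into \<open>\<mu>\<close>:
  column \<open>i\<close> of \<open>\<mu>\<close> becomes column \<open>i + 1\<close> by one transition with a single term, for \<open>i = 0, 1, \<dots>\<close>.\<close>

lemma absorb_column:
  assumes st: "state n j \<mu> w" and j: "1 \<le> j" and wx: "w x = int j"
    and h: "int h < x" "\<mu> 0 \<le> h" and up: "\<And>z. 1 \<le> w z \<Longrightarrow> w z \<le> int j \<Longrightarrow> int h < z"
    and nh: "\<And>z. int h < z \<Longrightarrow> z < x \<Longrightarrow> w z \<le> int j"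
  obtains w' where "state n (j - 1) (case_nat h \<mu>) w'"
    "\<And>es. peel_sym n es w' = peel_sym n es w"
    "\<And>z. 1 \<le> w z \<Longrightarrow> w z < int j \<Longrightarrow> w' z = w z"
proof -
  define \<mu>' where "\<mu>' = case_nat h \<mu>"
  have \<mu>'_0: "\<mu>' 0 = h" and \<mu>'_Suc: "\<mu>' (Suc i) = \<mu> i" for i by (auto simp: \<mu>'_def)
  have w: "w permutes {- int n..int n}" and jn: "j \<le> n" and am: "antimono \<mu>" 
    and z: "\<And>i. n - j \<le> i \<Longrightarrow> \<mu> i = 0"
    and pad: "\<And>i. i \<le> n \<Longrightarrow> w (int (\<mu> i) - int i) = - int i"
    and inc: "\<And>x y. x < y \<Longrightarrow> int j < w x \<Longrightarrow> int j < w y \<Longrightarrow> w x < w y"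
    using st by (auto simp: state_def)
  have am': "antimono \<mu>'"
  proof (rule antimonoI)
    fix p q :: nat assume "p \<le> q"
    then show "\<mu>' q \<le> \<mu>' p"
      using antimonoD[OF am, of "p - 1" "q - 1"] antimonoD[OF am, of 0 "q - 1"] h(2)
      by (cases p; cases q) (auto simp: \<mu>'_def)
  qed
  have ge: "\<mu> i \<le> \<mu>' i" for i
    using antimonoD[OF am, of "i - 1" i] h(2) by (cases i) (auto simp: \<mu>'_def)
  \<comment> \<open>The situation after \<open>i\<close> rounds: the labels \<open>- l\<close> with
    \<open>l < i\<close> are in the rows of the new columns, and label \<open>j\<close> is in a row
    \<open>x'\<close> with no empty row between \<open>\<mu>' i - i\<close> and \<open>x'\<close>,
    as the next transition requires.\<close>
  have "\<exists>w' x'. w' permutes {- int n..int n} \<and> 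
      (\<forall>l\<le>n. w' (int (if l < i then \<mu>' l else \<mu> l) - int l) = - int l) \<and>
      (\<forall>p q. p < q \<longrightarrow> int j < w' p \<longrightarrow> int j < w' q \<longrightarrow> w' p < w' q) \<and>
      (\<forall>z. 1 \<le> w z \<longrightarrow> w z < int j \<longrightarrow> w' z = w z) \<and>
      w' x' = int j \<and> int (\<mu>' i) - int i < x' \<and> (\<forall>z. int (\<mu>' i) - int i < z \<longrightarrow> z < x' \<longrightarrow> w' z \<le> int j) \<and>
      (\<forall>es. peel_sym n es w' = peel_sym n es w)" if "i \<le> n + 1" for i
    using that
  proof (induction i)
    case 0
    show ?case
      by (rule exI[of _ w], rule exI[of _ x]) (use w pad inc wx h nh in \<open>auto simp: \<mu>'_0\<close>)
  next
    case (Suc i)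
    then obtain w' x' where w': "w' permutes {- int n..int n}"
      and pad': "\<And>l. l \<le> n \<Longrightarrow> w' (int (if l < i then \<mu>' l else \<mu> l) - int l) = - int l"
      and inc': "\<And>p q. p < q \<Longrightarrow> int j < w' p \<Longrightarrow> int j < w' q \<Longrightarrow> w' p < w' q"
      and same: "\<And>z. 1 \<le> w z \<Longrightarrow> w z < int j \<Longrightarrow> w' z = w z"
      and wx': "w' x' = int j" and hx: "int (\<mu>' i) - int i < x'"
      and nh': "\<And>z. int (\<mu>' i) - int i < z \<Longrightarrow> z < x' \<Longrightarrow> w' z \<le> int j"
      and F: "\<And>es. peel_sym n es w' = peel_sym n es w" by auto
    have inj': "p = q" if "w' p = w' q" for p q using permutes_inj[OF w'] that by (auto simp: inj_def)
    have i: "i \<le> n" using Suc.prems by simp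
    \<comment> \<open>\<open>c\<close> is the target row of the label \<open>- i\<close> and
      \<open>y\<close> its present row. A transition puts \<open>j\<close> into row
      \<open>y\<close>, directly below the next target \<open>y - 1\<close>.\<close>
    define c where "c = int (\<mu>' i) - int i"
    define y where "y = int (\<mu> i) - int i"
    have c_y: "int (\<mu>' (Suc i)) - int (Suc i) = y - 1" by (simp add: \<mu>'_Suc y_def)
    have wy: "w' y = - int i" using pad'[OF i] by (simp add: y_def)
    have yx: "y < x'" using hx ge[of i] by (simp add: y_def)
    show ?case
    proof (cases "\<mu> i = \<mu>' i")
      case True
      then have cy: "c = y" by (simp add: c_def y_def)
      show ?thesis
      proof (rule exI[of _ w'], rule exI[of _ x'], intro conjI allI impI)
        fix l assume "l \<le> n"
        then show "w' (int (if l < Suc i then \<mu>' l else \<mu> l) - int l) = - int l"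
          using pad'[of l] True by (cases "l = i") (auto simp: less_Suc_eq)
      next
        fix z assume "int (\<mu>' (Suc i)) - int (Suc i) < z" "z < x'"
        then show "w' z \<le> int j" using nh'[of z] cy wy unfolding c_y c_def[symmetric]
          by (cases "z = y") auto
      next
        show "int (\<mu>' (Suc i)) - int (Suc i) < x'" unfolding c_y using yx by simp
      qed (use w' inc' same wx' F in auto)
    next
      case False
      then have yc: "y < c" using ge[of i] by (simp add: c_def y_def)
      have cx: "c < x'" using hx by (simp add: c_def)
      have crange: "c \<in> {- int n..int n}" 
      proof -
        have "x' \<in> {- int n..int n}" "y \<in> {- int n..int n}"
          using permutes_in_image[OF w', of x'] permutes_in_image[OF w', of y] wx' jn wy i by auto
        then show ?thesis using yc cx by auto
      qed
      have above: "c < z" if "1 \<le> w' z" "w' z < int j" for z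
      proof -
        obtain z' where z': "w z' = w' z" using permutes_surj[OF w] by (metis surjD)
        then have "w' z' = w z'" using same[of z'] that by simp
        then have "z' = z" using inj' z' by simp
        then have "int h < z" using up[of z] z' that by simp
        moreover have "int (\<mu>' i) \<le> int h" using antimonoD[OF am', of 0 i] \<mu>'_0 by simp
        ultimately show ?thesis by (simp add: c_def)
      qed
      have negl: "c < z \<or> z \<le> y" if neg: "w' z \<le> 0" "- int n \<le> w' z" for z
      proof -
        define l where "l = nat (- w' z)"
        have l: "w' z = - int l" "l \<le> n" using neg by (auto simp: l_def)
        then have zz: "z = int (if l < i then \<mu>' l else \<mu> l) - int l" using pad'[of l] inj' by simp
        show ?thesis
        proof (cases "l < i")
          case True
          then show ?thesis using antimono_shift_less[OF am', of l i] zz by (simp add: c_def)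
        next
          case False
          then show ?thesis using antimono_shift_less[OF am, of i l] zz
            by (cases "l = i") (auto simp: y_def)
        qed
      qed
      \<comment> \<open>Row \<open>c\<close> is an empty row: \<open>j\<close> is in row
        \<open>x'\<close>, the labels from \<open>1\<close> to \<open>j - 1\<close> are beyond
        \<open>c\<close>, and every other label \<le> \<open>0\<close> is beyond \<open>c\<close> or
        not beyond \<open>y\<close>.\<close>
      have wc: "int j < w' c"
      proof (rule ccontr)
        assume "\<not> int j < w' c"
        then consider "w' c = int j" | "1 \<le> w' c" "w' c < int j" | "w' c \<le> 0" by linarith
        then show False
        proof cases
          case 1 then show ?thesis using inj'[of c x'] wx' cx by simp
        next
          case 2 then show ?thesis using above[of c] by simp
        next
          case 3
          moreover have "- int n \<le> w' c" using permutes_in_image[OF w', of c] crange by auto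
          ultimately show ?thesis using negl[of c] yc by simp
        qed
      qed
      \<comment> \<open>The sum has a single term: the positive labels below \<open>j\<close> and
        the labels \<open>- l\<close> with \<open>l < i\<close> are beyond \<open>c\<close>, and a
        label \<open>- l\<close> with \<open>l > i\<close> is smaller than \<open>- i\<close> and
        lies before \<open>y\<close>, so that \<open>y\<close> blocks it.\<close>
      have only: "{y'. - int n - 1 < y' \<and> y' < c \<and> w' y' < int j \<and>
        (\<forall>z. y' < z \<and> z < c \<longrightarrow> \<not> (w' y' < w' z \<and> w' z < int j))} = {y}"
      proof (intro set_eqI iffI)
        fix y' assume "y' \<in> {y'. - int n - 1 < y' \<and> y' < c \<and> w' y' < int j \<and>
          (\<forall>z. y' < z \<and> z < c \<longrightarrow> \<not> (w' y' < w' z \<and> w' z < int j))}"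
        then have y': "- int n \<le> y'" "y' < c" "w' y' < int j"
           "\<And>z. y' < z \<Longrightarrow> z < c \<Longrightarrow> \<not> (w' y' < w' z \<and> w' z < int j)" by auto
        have "w' y' \<le> 0" using above[of y'] y' by force
        moreover have rr: "- int n \<le> w' y'" using permutes_in_image[OF w', of y'] y' crange by auto
        ultimately have le: "y' \<le> y" using negl[of y'] y' by simp
        show "y' \<in> {y}"
        proof (rule ccontr)
          assume "y' \<notin> {y}"
          then have lt: "y' < y" using le by simp
          define l where "l = nat (- w' y')"
          have l: "w' y' = - int l" "l \<le> n" using rr \<open>w' y' \<le> 0\<close> by (auto simp: l_def)
          then have zz: "y' = int (if l < i then \<mu>' l else \<mu> l) - int l" using pad'[of l] inj' by simp
          have "i < l"
          proof (rule ccontr)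
            assume "\<not> i < l"
            then consider "l = i" | "l < i" by linarith
            then show False
            proof cases
              case 1 then show ?thesis using zz lt by (simp add: y_def)
            next
              case 2 then show ?thesis using antimono_shift_less[OF am', of l i] zz y'(2) by (simp add: c_def)
            qed
          qed
          then show False using y'(4)[of y] lt yc wy l(1) j by auto
        qed
      next
        fix y' assume "y' \<in> {y}"
        then have [simp]: "y' = y" by simp
        have "\<not> (w' y < w' z \<and> w' z < int j)" if "y < z" "z < c" for z
          using above[of z] negl[of z] that wy i by force
        moreover have "- int n \<le> y" using permutes_in_image[OF w', of y] wy i by auto
        ultimately show "y' \<in> {y'. - int n - 1 < y' \<and> y' < c \<and> w' y' < int j \<and>
          (\<forall>z. y' < z \<and> z < c \<longrightarrow> \<not> (w' y' < w' z \<and> w' z < int j))}"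
          using yc wy j by auto
      qed
      have Fstep: "peel_sym n es w' = peel_sym n es (cyc w' c x' y)" for es
      proof -
        have "peel_sym n es w' = (\<Sum>y' | - int n - 1 < y' \<and> y' < c \<and> w' y' < int j \<and>
          (\<forall>z. y' < z \<and> z < c \<longrightarrow> \<not> (w' y' < w' z \<and> w' z < int j)). peel_sym n es (cyc w' c x' y'))"
        proof (rule transition_step)
          show "w' permutes {- int n - 1 + 1..int n}" using w' by simp
          show "\<exists>z>- int n - 1. z < c \<and> - int n - 1 < w' z \<and> w' z < int j"
          proof (intro exI[of _ y] conjI)
            show "- int n - 1 < y" using permutes_in_image[OF w', of y] wy i by auto
          qed (use yc wy i j in auto)
        qed (use wx' jn j inc' cx wc crange nh' in \<open>auto simp: c_def\<close>)
        then show ?thesis unfolding only by simp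
      qed
      have ca: "cyc w' c x' y z = (if z = c then w' y else if z = y then w' x' else if z = x' then w' c else w' z)" for z
        by (rule cyc_apply) (use cx yc in auto)
      show ?thesis
      proof (rule exI[of _ "cyc w' c x' y"], rule exI[of _ y], intro conjI allI impI)
        show "cyc w' c x' y permutes {- int n..int n}"
          using permutes_in_image[OF w', of x'] permutes_in_image[OF w', of y] wx' jn wy i crange
          by (intro cyc_permutes w') auto
      next
        fix l assume l: "l \<le> n"
        show "cyc w' c x' y (int (if l < Suc i then \<mu>' l else \<mu> l) - int l) = - int l"
        proof (cases "l = i")
          case True
          then show ?thesis using wy by (simp add: ca c_def[symmetric])
        next
          case False
          have e: "(if l < Suc i then \<mu>' l else \<mu> l) = (if l < i then \<mu>' l else \<mu> l)" using False by auto
          let ?z = "int (if l < i then \<mu>' l else \<mu> l) - int l"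
          have "w' ?z = - int l" using pad'[OF l] .
          then have "?z \<noteq> c" "?z \<noteq> x'" "?z \<noteq> y" using wc wx' wy j False by auto
          then show ?thesis unfolding e using pad'[OF l] by (simp add: ca)
        qed
      next
        fix p q assume "p < q" "int j < cyc w' c x' y p" "int j < cyc w' c x' y q"
        then show "cyc w' c x' y p < cyc w' c x' y q"
          using cyc_increasing[where w = w' and c = c and x = x' and y = y and j = "int j" and p = p and q = q]
            inc' wx' cx wc yc wy j nh' unfolding c_def by force
      next
        fix z assume z: "1 \<le> w z" "w z < int j"
        then have "w' z = w z" by (rule same)
        then have "z \<noteq> c" "z \<noteq> y" "z \<noteq> x'" using z wc wy wx' j by auto
        then show "cyc w' c x' y z = w z" using \<open>w' z = w z\<close> by (simp add: ca)
      next
        show "cyc w' c x' y y = int j" using yc wx' by (simp add: ca)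
        show "int (\<mu>' (Suc i)) - int (Suc i) < y" unfolding c_y by simp
      next
        fix z assume "int (\<mu>' (Suc i)) - int (Suc i) < z" "z < y"
        then show "cyc w' c x' y z \<le> int j" unfolding c_y by simp
      next
        fix es show "peel_sym n es (cyc w' c x' y) = peel_sym n es w" using F Fstep by simp
      qed
    qed
  qed
  from this[of "n + 1"] obtain w' x' where w': "w' permutes {- int n..int n}"
      and pad': "\<And>l. l \<le> n \<Longrightarrow> w' (int (\<mu>' l) - int l) = - int l"
      and inc': "\<And>p q. p < q \<Longrightarrow> int j < w' p \<Longrightarrow> int j < w' q \<Longrightarrow> w' p < w' q"
      and same: "\<And>z. 1 \<le> w z \<Longrightarrow> w z < int j \<Longrightarrow> w' z = w z"
      and wx': "w' x' = int j" and hx: "int (\<mu>' (n+1)) - int (n+1) < x'"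
      and nh': "\<And>z. int (\<mu>' (n+1)) - int (n+1) < z \<Longrightarrow> z < x' \<Longrightarrow> w' z \<le> int j"
      and F: "\<And>es. peel_sym n es w' = peel_sym n es w" 
    by (auto simp: less_Suc_eq_le)
  have inj': "p = q" if "w' p = w' q" for p q using permutes_inj[OF w'] that by (auto simp: inj_def)
  \<comment> \<open>The bound has left the support, so after \<open>n + 1\<close> rounds no empty
    row precedes that of \<open>j\<close>, and \<open>j\<close> can join the increasing sequence of
    empty labels.\<close>
  have last: "int (\<mu>' (n+1)) - int (n+1) = - int n - 1" using z[of n] by (simp add: \<mu>'_def)
  have hole: "x' < q" if "int j < w' q" for q
  proof -
    have "- int n \<le> q"
    proof (rule ccontr)
      assume "\<not> - int n \<le> q"
      then have "w' q = q" using w' by (auto simp: permutes_def)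
      then show False using that \<open>\<not> - int n \<le> q\<close> by simp
    qed
    then have "\<not> q < x'" using nh'[of q] that unfolding last by auto
    moreover have "q \<noteq> x'" using that wx' by auto
    ultimately show ?thesis by simp
  qed
  have "state n (j - 1) \<mu>' w'"
    unfolding state_def
  proof (intro conjI allI impI)
    fix i assume "n - (j - 1) \<le> i"
    then show "\<mu>' i = 0" using z[of "i - 1"] j jn by (cases i) (auto simp: \<mu>'_def)
  next
    fix p q assume pq: "p < q \<and> int (j - 1) < w' p \<and> int (j - 1) < w' q"
    show "w' p < w' q"
    proof (cases "w' p = int j \<or> w' q = int j")
      case False
      then show ?thesis using pq inc'[of p q] by auto
    next
      case True
      have "w' q \<noteq> int j"
      proof
        assume "w' q = int j"
        then have "q = x'" using inj' wx' by simp
        moreover have "w' p \<noteq> int j" using pq inj'[of p q] \<open>w' q = int j\<close> by auto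
        then have "int j < w' p" using pq j by auto
        ultimately show False using hole[of p] pq by simp
      qed
      then show ?thesis using True pq j by auto
    qed
  next
    fix z assume z: "1 \<le> w' z \<and> w' z \<le> int (j - 1)"
    obtain z' where z': "w z' = w' z" using permutes_surj[OF w] by (metis surjD)
    then have "w' z' = w z'" using same[of z'] z j by simp
    then have "z' = z" using inj' z' by simp
    then show "int (\<mu>' 0) < z" using up[of z] z' z j \<mu>'_0 by simp
  qed (use w' am' pad' jn in auto)
  then show ?thesis using that F same unfolding \<mu>'_def by blast
qed

section \<open>Labelled pipedreams\<close>

text \<open>The labels are those of the west, south, east and north edge, in this order, with
  \<open>0\<close> for no pipe. West and south determine east and north, so labels can be computed
  from left to right and, within a column, from bottom to top.\<close>

fun tile_ok :: "tile \<Rightarrow> nat \<Rightarrow> nat \<Rightarrow> nat \<Rightarrow> nat \<Rightarrow> bool" where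
  "tile_ok Empty w s e k \<longleftrightarrow> w = 0 \<and> s = 0 \<and> e = 0 \<and> k = 0"
| "tile_ok NW_elbow w s e k \<longleftrightarrow> w \<noteq> 0 \<and> s = 0 \<and> e = 0 \<and> k = w"
| "tile_ok SE_elbow w s e k \<longleftrightarrow> w = 0 \<and> s \<noteq> 0 \<and> e = s \<and> k = 0"
| "tile_ok Horizontal w s e k \<longleftrightarrow> w \<noteq> 0 \<and> s = 0 \<and> e = w \<and> k = 0"
| "tile_ok Vertical w s e k \<longleftrightarrow> w = 0 \<and> s \<noteq> 0 \<and> e = 0 \<and> k = s"
| "tile_ok Crossing w s e k \<longleftrightarrow> w \<noteq> 0 \<and> s \<noteq> 0 \<and> e = w \<and> k = s"

text \<open>\<open>H j i\<close> is the label on the east edge of square \<open>(i, j)\<close> and \<open>V j i\<close> the label on its south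
  edge; the label \<open>0\<close> means that no pipe crosses the edge.\<close>

definition labelled :: "nat \<Rightarrow> nat \<Rightarrow> tiling \<Rightarrow> (nat \<Rightarrow> nat \<Rightarrow> nat) \<Rightarrow> (nat \<Rightarrow> nat \<Rightarrow> nat) \<Rightarrow> bool" where
  "labelled n m P H V \<longleftrightarrow> (\<forall>i. H 0 i = 0) \<and> (\<forall>j\<in>{1..m}. V j n = j \<and> V j 0 = 0 \<and>
    (\<forall>i\<in>{1..n}. tile_ok (P (i, j)) (H (j - 1) i) (V j i) (H j i) (V j (i - 1))))"

text \<open>The local form of crossing at most once: the vertical pipe is always the one with the
  larger label.\<close>

definition good_crossings :: "nat \<Rightarrow> nat \<Rightarrow> tiling \<Rightarrow> (nat \<Rightarrow> nat \<Rightarrow> nat) \<Rightarrow> (nat \<Rightarrow> nat \<Rightarrow> nat) \<Rightarrow> bool" where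
  "good_crossings n m P H V \<longleftrightarrow>
    (\<forall>j\<in>{1..m}. \<forall>i\<in>{1..n}. P (i, j) = Crossing \<longrightarrow> H (j - 1) i < V j i)"

text \<open>The vertical half of the partition condition. For labelled tilings the horizontal half
  follows, by \<open>empty_left\<close>.\<close>

definition top_empty :: "nat \<Rightarrow> nat \<Rightarrow> tiling \<Rightarrow> bool" where
  "top_empty n m P \<longleftrightarrow>
    (\<forall>j\<in>{1..m}. \<forall>i\<in>{1..n}. P (i, j) = Empty \<longrightarrow> (\<forall>i'\<in>{1..i}. P (i', j) = Empty))"

text \<open>Any labels \<open>R\<close> are allowed on the right border, with \<open>0\<close> for a
  row that no pipe leaves. Thus a tiling without its last columns is again an object of the same
  kind.\<close>

definition eg_tilings :: "nat \<Rightarrow> nat \<Rightarrow> (nat \<Rightarrow> nat) \<Rightarrow> tiling set" where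
  "eg_tilings n m R = {P \<in> ({1..n} \<times> {1..m}) \<rightarrow>\<^sub>E UNIV. \<exists>H V. labelled n m P H V \<and>
    good_crossings n m P H V \<and> top_empty n m P \<and> (\<forall>i\<in>{1..n}. H m i = R i)}"

definition height :: "nat \<Rightarrow> nat \<Rightarrow> tiling \<Rightarrow> nat \<Rightarrow> nat" where
  "height n m P j = (if j \<in> {1..m} then card {i \<in> {1..n}. P (i, j) = Empty} else 0)"

lemma labelledD:
  assumes "labelled n m P H V" "j \<in> {1..m}"
  shows "V j n = j" "V j 0 = 0"
    "i \<in> {1..n} \<Longrightarrow> tile_ok (P (i, j)) (H (j - 1) i) (V j i) (H j i) (V j (i - 1))"
  using assms by (auto simp: labelled_def)

text \<open>A pipe going north cannot leave through the top border, where the label is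
  \<open>0\<close>, so it has to turn east in an SE elbow.\<close>

lemma labelled_run:
  assumes "labelled n m P H V" "j \<in> {1..m}" "i0 \<le> n" "V j i0 = k" "k \<noteq> 0"
  obtains p where "1 \<le> p" "p \<le> i0" "P (p, j) = SE_elbow" "H j p = k"
    "\<And>i. p \<le> i \<Longrightarrow> i \<le> i0 \<Longrightarrow> V j i = k"
    "\<And>i. p < i \<Longrightarrow> i \<le> i0 \<Longrightarrow> P (i, j) = Vertical \<or> P (i, j) = Crossing"
proof -
  have "\<exists>p\<ge>1. p \<le> i0 \<and> P (p, j) = SE_elbow \<and> H j p = k \<and>
    (\<forall>i. p \<le> i \<longrightarrow> i \<le> i0 \<longrightarrow> V j i = k) \<and>
    (\<forall>i. p < i \<longrightarrow> i \<le> i0 \<longrightarrow> P (i, j) = Vertical \<or> P (i, j) = Crossing)"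
    using assms(3,4)
  proof (induction i0)
    case 0
    then show ?case using labelledD(2)[OF assms(1,2)] assms(5) by simp
  next
    case (Suc i)
    have t: "tile_ok (P (Suc i, j)) (H (j - 1) (Suc i)) k (H j (Suc i)) (V j i)"
      using labelledD(3)[OF assms(1,2), of "Suc i"] Suc.prems by simp
    show ?case
    proof (cases "P (Suc i, j) = SE_elbow")
      case True
      then show ?thesis using t Suc.prems by (intro exI[of _ "Suc i"]) auto
    next
      case False
      then have tt: "P (Suc i, j) = Vertical \<or> P (Suc i, j) = Crossing" and v: "V j i = k"
        using t assms(5) by (cases "P (Suc i, j)"; simp)+
      from Suc.IH[OF _ v] Suc.prems(1) obtain p where "p \<ge> 1" "p \<le> i" "P (p, j) = SE_elbow" "H j p = k"
        "\<forall>i'. p \<le> i' \<longrightarrow> i' \<le> i \<longrightarrow> V j i' = k"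
        "\<forall>i'. p < i' \<longrightarrow> i' \<le> i \<longrightarrow> P (i', j) = Vertical \<or> P (i', j) = Crossing" by auto
      then show ?thesis using tt Suc.prems by (intro exI[of _ p]) (auto simp: le_Suc_eq)
    qed
  qed
  then show ?thesis using that by blast
qed

text \<open>Followed southwards, a vertical strand ends at the south border, where it is the pipe of
  this column, or in an NW elbow, where it came from the column to the left.\<close>

lemma labelled_origin:
  assumes "labelled n m P H V" "j \<in> {1..m}" "i0 \<le> n" "V j i0 = k" "k \<noteq> 0"
  obtains q where "i0 \<le> q" "q \<le> n" "\<And>i. i0 \<le> i \<Longrightarrow> i \<le> q \<Longrightarrow> V j i = k"
    "q = n \<and> k = j \<or> q < n \<and> P (Suc q, j) = NW_elbow \<and> H (j - 1) (Suc q) = k"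
proof -
  have "\<exists>q\<ge>i0. q \<le> n \<and> (\<forall>i. i0 \<le> i \<longrightarrow> i \<le> q \<longrightarrow> V j i = k) \<and>
    (q = n \<and> k = j \<or> q < n \<and> P (Suc q, j) = NW_elbow \<and> H (j - 1) (Suc q) = k)"
    using assms(3,4)
  proof (induction "n - i0" arbitrary: i0)
    case 0
    then show ?case using labelledD(1)[OF assms(1,2)] by (intro exI[of _ i0]) auto
  next
    case (Suc d)
    then have lt: "i0 < n" by simp
    have t: "tile_ok (P (Suc i0, j)) (H (j - 1) (Suc i0)) (V j (Suc i0)) (H j (Suc i0)) k"
      using labelledD(3)[OF assms(1,2), of "Suc i0"] Suc.prems lt by simp
    show ?case
    proof (cases "P (Suc i0, j) = NW_elbow")
      case True
      then show ?thesis using t Suc.prems lt by (intro exI[of _ i0]) auto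
    next
      case False
      then have v: "V j (Suc i0) = k" using t assms(5) by (cases "P (Suc i0, j)") auto
      have "d = n - Suc i0" "Suc i0 \<le> n" using Suc.hyps(2) lt by auto
      from Suc.hyps(1)[OF this v] obtain q where "q \<ge> Suc i0" "q \<le> n"
        "\<forall>i. Suc i0 \<le> i \<longrightarrow> i \<le> q \<longrightarrow> V j i = k"
        "q = n \<and> k = j \<or> q < n \<and> P (Suc q, j) = NW_elbow \<and> H (j - 1) (Suc q) = k" by auto
      then show ?thesis using Suc.prems
        by (intro exI[of _ q]) (metis Suc_leD Suc_leI le_neq_implies_less)
    qed
  qed
  then show ?thesis using that by blast
qed

text \<open>Pipes move only north and east, so pipe \<open>k\<close> never meets a column before
  column \<open>k\<close>.\<close>

lemma labelled_bound:
  assumes L: "labelled n m P H V"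
  shows "j \<le> m \<Longrightarrow> i \<in> {1..n} \<Longrightarrow> H j i \<le> j"
proof (induction j arbitrary: i)
  case 0
  then show ?case using L by (simp add: labelled_def)
next
  case (Suc j)
  have j: "Suc j \<in> {1..m}" using Suc.prems by simp
  have IH: "H j i' \<le> j" if "i' \<in> {1..n}" for i' using Suc.IH[of i'] Suc.prems that by simp
  have t: "tile_ok (P (i, Suc j)) (H j i) (V (Suc j) i) (H (Suc j) i) (V (Suc j) (i - 1))"
    using labelledD(3)[OF L j Suc.prems(2)] by simp
  have V: "V (Suc j) i \<le> Suc j"
  proof (cases "V (Suc j) i = 0")
    case False
    have "i \<le> n" using Suc.prems by simp
    from labelled_origin[OF L j this refl False] obtain q where
      "q = n \<and> V (Suc j) i = Suc j \<or> q < n \<and> P (Suc q, Suc j) = NW_elbow \<and> H (Suc j - 1) (Suc q) = V (Suc j) i"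
      by metis
    then show ?thesis using IH[of "Suc q"] by auto
  qed simp
  show ?case using t V IH[OF Suc.prems(2)] by (cases "P (i, Suc j)") auto
qed

lemma labelled_V_bound:
  assumes L: "labelled n m P H V" and j: "j \<in> {1..m}" and i: "i \<le> n"
  shows "V j i \<le> j"
proof (cases "V j i = 0")
  case False
  from labelled_origin[OF L j i refl False] obtain q where
    "q = n \<and> V j i = j \<or> q < n \<and> P (Suc q, j) = NW_elbow \<and> H (j - 1) (Suc q) = V j i"
    by metis
  moreover have "j - 1 \<le> m" using j by auto
  ultimately show ?thesis using labelled_bound[OF L, of "j - 1" "Suc q"] by fastforce
qed simp

text \<open>Equal labels on the right border of a column are traced back to equal labels on its left
  border, or to the start of the pipe of this column, whose label is new. A common origin forces
  equal rows, since a strand turns east only once.\<close>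

lemma labelled_inj:
  assumes L: "labelled n m P H V"
  shows "j \<le> m \<Longrightarrow> i \<in> {1..n} \<Longrightarrow> i' \<in> {1..n} \<Longrightarrow> H j i = H j i' \<Longrightarrow> H j i \<noteq> 0 \<Longrightarrow> i = i'"
proof (induction j arbitrary: i i')
  case 0
  then show ?case using L by (simp add: labelled_def)
next
  case (Suc j)
  have j: "Suc j \<in> {1..m}" using Suc.prems by simp
  define k where "k = H (Suc j) i"
  have k: "k \<noteq> 0" using Suc.prems by (simp add: k_def)
  have IH: "p = q" if "p \<in> {1..n}" "q \<in> {1..n}" "H j p = k" "H j q = k" for p q
    using Suc.IH[of p q] Suc.prems(1) that k by simp
  have cases: "(H j p = k \<and> P (p, Suc j) \<noteq> NW_elbow) \<or> (P (p, Suc j) = SE_elbow \<and> V (Suc j) p = k \<and> V (Suc j) (p - 1) = 0)"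
    if "p \<in> {1..n}" "H (Suc j) p = k" for p
    using labelledD(3)[OF L j that(1)] that k by (cases "P (p, Suc j)") auto
  have orig: "\<exists>q. p \<le> q \<and> (\<forall>i. p \<le> i \<longrightarrow> i \<le> q \<longrightarrow> V (Suc j) i = k) \<and> 
     (q = n \<and> k = Suc j \<or> q < n \<and> P (Suc q, Suc j) = NW_elbow \<and> H j (Suc q) = k)"
    if p: "p \<in> {1..n}" "V (Suc j) p = k" for p
  proof -
    have "p \<le> n" using p by simp
    from labelled_origin[OF L j this p(2) k] show ?thesis by (metis diff_Suc_1)
  qed
  have bd: "H j p \<noteq> Suc j" if "p \<in> {1..n}" for p
    using labelled_bound[OF L, of j p] Suc.prems(1) that by auto
  have no: False if as: "p \<in> {1..n}" "p' \<in> {1..n}" "H j p = k" "P (p, Suc j) \<noteq> NW_elbow" "V (Suc j) p' = k" for p p'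
  proof -
    obtain q where "q = n \<and> k = Suc j \<or> q < n \<and> P (Suc q, Suc j) = NW_elbow \<and> H j (Suc q) = k"
      using orig[OF as(2,5)] by blast
    then show False using bd[OF as(1)] IH[OF as(1), of "Suc q"] as by auto
  qed
  \<comment> \<open>Both rows would end strands with the same origin, hence the same strand; but it
    is interrupted just above the lower row \<open>p'\<close>.\<close>
  have two: False if as: "p \<in> {1..n}" "p' \<in> {1..n}" "p < p'" "V (Suc j) p = k" "V (Suc j) p' = k" "V (Suc j) (p' - 1) = 0" for p p'
  proof -
    obtain q where q: "p \<le> q" "\<And>i. p \<le> i \<Longrightarrow> i \<le> q \<Longrightarrow> V (Suc j) i = k"
      "q = n \<and> k = Suc j \<or> q < n \<and> P (Suc q, Suc j) = NW_elbow \<and> H j (Suc q) = k"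
      using orig[OF as(1,4)] by blast
    obtain q' where q': "p' \<le> q'" 
      "q' = n \<and> k = Suc j \<or> q' < n \<and> P (Suc q', Suc j) = NW_elbow \<and> H j (Suc q') = k"
      using orig[OF as(2,5)] by blast
    have "q = n \<and> k = Suc j \<or> Suc q \<in> {1..n} \<and> H j (Suc q) = k" using q(3) by auto
    moreover have "q' = n \<and> k = Suc j \<or> Suc q' \<in> {1..n} \<and> H j (Suc q') = k" using q'(2) by auto
    ultimately have "q = q'" using bd[of "Suc q"] bd[of "Suc q'"] IH[of "Suc q" "Suc q'"] by (metis nat.inject)
    then have "V (Suc j) (p' - 1) = k" using q q' as by (intro q(2)) auto
    then show False using as k by simp
  qed
  show ?case
    using cases[OF Suc.prems(2)] cases[OF Suc.prems(3)] Suc.prems(4) IH[OF Suc.prems(2,3)]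
      no[OF Suc.prems(2,3)] no[OF Suc.prems(3,2)] two[OF Suc.prems(2,3)] two[OF Suc.prems(3,2)]
    by (metis k_def linorder_neqE_nat)
qed

lemma tile_ok_det:
  "tile_ok t w s e k \<Longrightarrow> tile_ok t w s e' k' \<Longrightarrow> e = e' \<and> k = k'"
  by (cases t) auto

lemma labelled_unique:
  assumes L: "labelled n m P H V" and L': "labelled n m P H' V'"
  shows "j \<le> m \<Longrightarrow> (\<forall>i\<in>{1..n}. H j i = H' j i) \<and> (j \<noteq> 0 \<longrightarrow> (\<forall>i\<le>n. V j i = V' j i))"
proof (induction j)
  case 0
  then show ?case using L L' by (simp add: labelled_def)
next
  case (Suc j)
  have j: "Suc j \<in> {1..m}" using Suc.prems by simp
  have IH: "\<And>i. i \<in> {1..n} \<Longrightarrow> H j i = H' j i" using Suc by simp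
  have V: "V (Suc j) i = V' (Suc j) i" if "i \<le> n" for i
    using that
  proof (induction "n - i" arbitrary: i)
    case 0
    then show ?case using labelledD(1)[OF L j] labelledD(1)[OF L' j] by simp
  next
    case (Suc d)
    then have i: "Suc i \<in> {1..n}" "d = n - Suc i" "Suc i \<le> n" by auto
    show ?case
      using labelledD(3)[OF L j i(1)] labelledD(3)[OF L' j i(1)] Suc.hyps(1)[OF i(2,3)] IH[OF i(1)]
      by (auto dest: tile_ok_det)
  qed
  have "H (Suc j) i = H' (Suc j) i" if "i \<in> {1..n}" for i
    using labelledD(3)[OF L j that] labelledD(3)[OF L' j that] V[of i] IH[OF that] that
    by (auto dest: tile_ok_det)
  then show ?case using V by blast
qed

lemma finite_eg_tilings: "finite (eg_tilings n m R)"
proof -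
  have U: "(UNIV :: tile set) = {Empty, NW_elbow, SE_elbow, Horizontal, Vertical, Crossing}"
    using tile.exhaust by auto
  have "finite (UNIV :: tile set)" unfolding U by simp
  then have "finite (({1..n} \<times> {1..m}) \<rightarrow>\<^sub>E (UNIV :: tile set))" by (intro finite_PiE) auto
  then show ?thesis by (rule rev_finite_subset) (auto simp: eg_tilings_def)
qed

section \<open>Modifying the last column\<close>

lemma eg_tilingsI:
  assumes "P \<in> ({1..n} \<times> {1..m}) \<rightarrow>\<^sub>E UNIV" "labelled n m P H V" "good_crossings n m P H V"
    "top_empty n m P" "\<And>i. i \<in> {1..n} \<Longrightarrow> H m i = R i"
  shows "P \<in> eg_tilings n m R"
  using assms unfolding eg_tilings_def by blast

lemma labelled_mono: "labelled n m P H V \<Longrightarrow> m' \<le> m \<Longrightarrow> labelled n m' P H V"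
  by (auto simp: labelled_def)

lemma labelled_update:
  assumes L: "labelled n (m - 1) P H V" and m: "1 \<le> m"
    and P': "\<And>i j. j \<noteq> m \<Longrightarrow> P' (i, j) = P (i, j)"
    and col: "V' n = m" "V' 0 = 0"
      "\<And>i. i \<in> {1..n} \<Longrightarrow> tile_ok (P' (i, m)) (H (m - 1) i) (V' i) (H' i) (V' (i - 1))"
  shows "labelled n m P' (H(m := H')) (V(m := V'))"
  unfolding labelled_def
proof (intro conjI ballI allI)
  show "(H(m := H')) 0 i = 0" for i using L m by (simp add: labelled_def)
  fix j assume j: "j \<in> {1..m}"
  have LD: "V j n = j" "V j 0 = 0"
    "i \<in> {1..n} \<Longrightarrow> tile_ok (P (i, j)) (H (j - 1) i) (V j i) (H j i) (V j (i - 1))" if "j \<noteq> m" for i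
    using labelledD[OF L, of j] that j by auto
  show "(V(m := V')) j n = j" "(V(m := V')) j 0 = 0" using LD col by (cases "j = m"; simp)+
  fix i assume i: "i \<in> {1..n}"
  have "j - 1 \<noteq> m" using j by auto
  then show "tile_ok (P' (i, j)) ((H(m := H')) (j - 1) i) ((V(m := V')) j i) ((H(m := H')) j i) ((V(m := V')) j (i - 1))"
    using LD(3)[of i] i col(3)[OF i] P'[of j i] by (cases "j = m") auto
qed

text \<open>Pipe \<open>m\<close> goes straight on at \<open>(x, m)\<close> up to row
  \<open>c\<close>, where it meets the pipe that turned north there. The latter now goes east, and
  \<open>m\<close> takes over its way up.\<close>

definition cross_column :: "nat \<Rightarrow> nat \<Rightarrow> nat \<Rightarrow> tiling \<Rightarrow> tiling" where
  "cross_column m c x P = (\<lambda>(i, j). if j = m \<and> c \<le> i \<and> i \<le> x then (if i = x then Vertical else Crossing)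
    else P (i, j))"

definition uncross_column :: "nat \<Rightarrow> nat \<Rightarrow> nat \<Rightarrow> tiling \<Rightarrow> tiling" where
  "uncross_column m c x P = (\<lambda>(i, j). if j = m \<and> c \<le> i \<and> i \<le> x then
    (if i = c then NW_elbow else if i = x then SE_elbow else Horizontal) else P (i, j))"

text \<open>The right border after \<open>cross_column\<close>. It is the counterpart of
  \<open>cyc\<close>, which puts a label above \<open>j\<close> into row \<open>x\<close>, read as
  \<open>0\<close> here.\<close>

definition rot :: "nat \<Rightarrow> nat \<Rightarrow> nat \<Rightarrow> nat \<Rightarrow> (nat \<Rightarrow> nat) \<Rightarrow> nat \<Rightarrow> nat" where
  "rot m c x y R = R(c := R y, y := m, x := 0)"

text \<open>The rows to which \<open>transition_step\<close> can move the label of the last column.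
  Empty rows between \<open>y\<close> and \<open>c\<close> never obstruct: their label is too large
  in the permutation and \<open>0\<close> here.\<close>

definition movable :: "(nat \<Rightarrow> nat) \<Rightarrow> nat \<Rightarrow> nat set" where
  "movable R c = {y \<in> {1..<c}. R y \<noteq> 0 \<and> (\<forall>z. y < z \<and> z < c \<longrightarrow> R z < R y)}"

locale droop =
  fixes n m c x :: nat and R :: "nat \<Rightarrow> nat"
  assumes m: "1 \<le> m" and x: "x \<in> {1..n}" "R x = m" and c: "1 \<le> c" "c < x" "R c = 0"
    and filled: "\<And>z. c < z \<Longrightarrow> z < x \<Longrightarrow> R z \<noteq> 0" and above: "\<exists>z\<in>{1..<c}. R z \<noteq> 0"
    and inj: "\<And>i i'. i \<in> {1..n} \<Longrightarrow> i' \<in> {1..n} \<Longrightarrow> R i = R i' \<Longrightarrow> R i \<noteq> 0 \<Longrightarrow> i = i'"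
begin

text \<open>The rows between \<open>c\<close> and \<open>x\<close> are left by pipes that come from
  the west, so no pipe reaches \<open>(c, m)\<close> from the south. As no pipe leaves row
  \<open>c\<close> and the square is not empty, it is an NW elbow. The pipe that it sends north
  leaves in the row \<open>y\<close>.\<close>

lemma cross_in:
  assumes P: "P \<in> eg_tilings n m R"
  shows "\<exists>y\<in>movable R c. cross_column m c x P \<in> eg_tilings n m (rot m c x y R)"
    and "uncross_column m c x (cross_column m c x P) = P"
proof -
  from P obtain H V where ext: "P \<in> ({1..n} \<times> {1..m}) \<rightarrow>\<^sub>E UNIV" and L: "labelled n m P H V"
    and good: "good_crossings n m P H V" and top: "top_empty n m P"
    and R: "\<And>i. i \<in> {1..n} \<Longrightarrow> H m i = R i"
    unfolding eg_tilings_def by blast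
  have mm: "m \<in> {1..m}" using m by simp
  note LD = labelledD[OF L mm]
  have Hb: "H (m - 1) i < m" if "i \<in> {1..n}" for i
    using labelled_bound[OF L, of "m - 1" i] that m by fastforce
  obtain p where p: "1 \<le> p" "p \<le> n" "P (p, m) = SE_elbow" "H m p = m"
    and Vm: "\<And>i. p \<le> i \<Longrightarrow> i \<le> n \<Longrightarrow> V m i = m"
    and Tm: "\<And>i. p < i \<Longrightarrow> i \<le> n \<Longrightarrow> P (i, m) = Vertical \<or> P (i, m) = Crossing"
    using labelled_run[OF L mm, of n m] LD(1) m by auto
  have px: "p = x" using inj[of p x] p x R m by auto
  have Vx: "V m (x - 1) = 0" using LD(3)[of x] p px by auto
  have mid: "V m (i - 1) = 0 \<and> P (i, m) = Horizontal" if "c < i" "i < x" for i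
    using that
  proof (induction "x - i" arbitrary: i rule: less_induct)
    case less
    have v: "V m i = 0"
    proof (cases "Suc i = x")
      case True then show ?thesis using Vx by auto
    next
      case False
      then show ?thesis using less.hyps[of "Suc i"] less.prems by auto
    qed
    have "i \<in> {1..n}" using less.prems x by auto
    then show ?case using LD(3)[of i] v filled[OF less.prems] R[of i] by (cases "P (i, m)") auto
  qed
  have Vc: "V m c = 0"
    using mid[of "Suc c"] Vx c by (cases "Suc c = x") auto
  have cn: "c \<in> {1..n}" using c x by auto
  have "P (c, m) \<noteq> Empty"
  proof
    \<comment> \<open>Empty squares are top-justified, but some pipe leaves column \<open>m\<close>
      above row \<open>c\<close>.\<close>
    assume e: "P (c, m) = Empty"
    obtain z where z: "z \<in> {1..<c}" "R z \<noteq> 0" using above by blast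
    have "P (z, m) = Empty"
      using top[unfolded top_empty_def, rule_format, OF mm cn e, of z] z by auto
    then show False using LD(3)[of z] z R[of z] cn by auto
  qed
  then have Pc: "P (c, m) = NW_elbow" using LD(3)[OF cn] Vc R[OF cn] c by (cases "P (c, m)") auto
  define k where "k = H (m - 1) c"
  have k: "k \<noteq> 0" "V m (c - 1) = k" using LD(3)[OF cn] Pc by (auto simp: k_def)
  have cn1: "c - 1 \<le> n" using cn by auto
  obtain y where y: "1 \<le> y" "y \<le> c - 1" "P (y, m) = SE_elbow" "H m y = k"
    and Vy: "\<And>i. y \<le> i \<Longrightarrow> i \<le> c - 1 \<Longrightarrow> V m i = k"
    and Ty: "\<And>i. y < i \<Longrightarrow> i \<le> c - 1 \<Longrightarrow> P (i, m) = Vertical \<or> P (i, m) = Crossing"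
    using labelled_run[OF L mm cn1 k(2,1)] by metis
  have yn: "y \<in> {1..n}" "y < c" using y cn by auto
  have Ry: "R y = k" using R[OF yn(1)] y by simp
  \<comment> \<open>At every crossing on the way from \<open>c\<close> up to \<open>y\<close> the
    vertical label is \<open>k\<close>, so the horizontal labels there are smaller.\<close>
  have ym: "y \<in> movable R c"
    unfolding movable_def
  proof (intro CollectI conjI allI impI)
    show "y \<in> {1..<c}" "R y \<noteq> 0" using y yn k Ry by auto
    fix z assume z: "y < z \<and> z < c"
    then have zn: "z \<in> {1..n}" using yn cn by auto
    have "V m z = k" "P (z, m) = Vertical \<or> P (z, m) = Crossing" using Vy[of z] Ty[of z] z by auto
    moreover have "P (z, m) = Crossing \<longrightarrow> H (m - 1) z < V m z" using good zn mm by (auto simp: good_crossings_def)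
    ultimately show "R z < R y" using LD(3)[OF zn] R[OF zn] Ry k by auto
  qed
  define V' where "V' i = (if y \<le> i \<and> i \<le> x then m else V m i)" for i
  define H' where "H' i = rot m c x y R i" for i
  let ?P = "cross_column m c x P"
  have yx: "y < x" using yn c by simp
  have L': "labelled n m ?P (H(m := H')) (V(m := V'))"
  proof (rule labelled_update[OF labelled_mono[OF L diff_le_self] m])
    show "?P (i, j) = P (i, j)" if "j \<noteq> m" for i j using that by (simp add: cross_column_def)
    show "V' n = m" using Vm[of n] px p by (simp add: V'_def)
    show "V' 0 = 0" using LD(2) y by (simp add: V'_def)
    fix i assume i: "i \<in> {1..n}"
    note t = LD(3)[OF i]
    consider "i > x" | "i = x" | "c < i" "i < x" | "i = c" | "y < i" "i < c" | "i = y" | "i < y" by linarith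
    then show "tile_ok (?P (i, m)) (H (m - 1) i) (V' i) (H' i) (V' (i - 1))"
    proof cases
      case 1
      then have "V' i = V m i" "V' (i - 1) = V m (i - 1)" "H' i = R i"
        using Vm[of "i - 1"] px i c yx by (auto simp: V'_def H'_def rot_def)
      then show ?thesis using t R[OF i] 1 by (simp add: cross_column_def)
    next
      case 2
      then show ?thesis using t px p yx c m by (auto simp: cross_column_def V'_def H'_def rot_def)
    next
      case 3
      then show ?thesis using t mid[OF 3] filled[OF 3] R[OF i] yn m
        by (auto simp: cross_column_def V'_def H'_def rot_def)
    next
      case 4
      then show ?thesis using t Pc yn m c k by (auto simp: cross_column_def V'_def H'_def rot_def k_def Ry)
    next
      case 5
      have "V m i = k" "P (i, m) = Vertical \<or> P (i, m) = Crossing" using Vy[of i] Ty[of i] 5 by auto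
      then show ?thesis using t 5 R[OF i] c m by (auto simp: cross_column_def V'_def H'_def rot_def)
    next
      case 6
      then show ?thesis using t y yn yx c m by (auto simp: cross_column_def V'_def H'_def rot_def)
    next
      case 7
      then show ?thesis using t R[OF i] c yn by (auto simp: cross_column_def V'_def H'_def rot_def)
    qed
  qed
  \<comment> \<open>In its own column pipe \<open>m\<close> has the largest label, so it may cross
    every pipe going east.\<close>
  have good': "good_crossings n m ?P (H(m := H')) (V(m := V'))"
    unfolding good_crossings_def
  proof (intro ballI impI)
    fix j i assume ji: "j \<in> {1..m}" "i \<in> {1..n}" and cr: "?P (i, j) = Crossing"
    have jm: "j - 1 \<noteq> m" using ji by auto
    show "(H(m := H')) (j - 1) i < (V(m := V')) j i"
    proof (cases "j = m \<and> y \<le> i \<and> i \<le> x")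
      case True
      then show ?thesis using Hb[OF ji(2)] jm by (simp add: V'_def)
    next
      case False
      then have "P (i, j) = Crossing" using cr yn by (auto simp: cross_column_def split: if_splits)
      then show ?thesis using good ji jm False by (auto simp: good_crossings_def V'_def)
    qed
  qed
  have top': "top_empty n m ?P"
    unfolding top_empty_def
  proof (intro ballI impI)
    fix j i i' assume ji: "j \<in> {1..m}" "i \<in> {1..n}" "?P (i, j) = Empty" "i' \<in> {1..i}"
    have "P (i, j) = Empty" using ji(3) by (auto simp: cross_column_def split: if_splits)
    then have all: "\<And>i'. i' \<in> {1..i} \<Longrightarrow> P (i', j) = Empty" using top ji unfolding top_empty_def by blast
    show "?P (i', j) = Empty"
    proof (cases "j = m \<and> c \<le> i'")
      case True
      then have "P (c, m) = Empty" using all[of c] ji c by auto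
      then show ?thesis using Pc by simp
    next
      case False
      then show ?thesis using all[OF ji(4)] by (auto simp: cross_column_def)
    qed
  qed
  have ext': "?P \<in> ({1..n} \<times> {1..m}) \<rightarrow>\<^sub>E UNIV"
    using ext cn x m by (auto simp: cross_column_def PiE_iff extensional_def)
  have "?P \<in> eg_tilings n m (rot m c x y R)"
    by (rule eg_tilingsI[OF ext' L' good' top']) (simp add: H'_def)
  then show "\<exists>y\<in>movable R c. ?P \<in> eg_tilings n m (rot m c x y R)" using ym by blast
  show "uncross_column m c x ?P = P"
  proof
    fix ij show "uncross_column m c x ?P ij = P ij"
      using Pc mid p px by (cases ij) (auto simp: cross_column_def uncross_column_def)
  qed
qed

text \<open>Here pipe \<open>m\<close> leaves in row \<open>y\<close>, so it runs straight up to
  \<open>y\<close> and crosses the pipe \<open>R y\<close> in row \<open>c\<close>. Resolving this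
  crossing gives the upper part of the run to \<open>R y\<close>, while \<open>m\<close> turns east
  in row \<open>x\<close>.\<close>

lemma uncross_in:
  assumes y: "y \<in> movable R c" and P: "P \<in> eg_tilings n m (rot m c x y R)"
  shows "uncross_column m c x P \<in> eg_tilings n m R"
    and "cross_column m c x (uncross_column m c x P) = P"
proof -
  from P obtain H V where ext: "P \<in> ({1..n} \<times> {1..m}) \<rightarrow>\<^sub>E UNIV" and L: "labelled n m P H V"
    and good: "good_crossings n m P H V" and top: "top_empty n m P"
    and R': "\<And>i. i \<in> {1..n} \<Longrightarrow> H m i = rot m c x y R i"
    unfolding eg_tilings_def by blast
  have yc: "1 \<le> y" "y < c" and k0: "R y \<noteq> 0" and ymax: "\<And>z. y < z \<Longrightarrow> z < c \<Longrightarrow> R z < R y"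
    using y by (auto simp: movable_def)
  define k where "k = R y"
  have k: "k \<noteq> 0" using k0 by (simp add: k_def)
  have mm: "m \<in> {1..m}" using m by simp
  note LD = labelledD[OF L mm]
  have cn: "c \<in> {1..n}" and yn: "y \<in> {1..n}" using c x yc by auto
  have km: "k \<noteq> m" using inj[of x y] x yn yc c k by (auto simp: k_def)
  obtain p where p: "1 \<le> p" "p \<le> n" "P (p, m) = SE_elbow" "H m p = m"
    and Vm: "\<And>i. p \<le> i \<Longrightarrow> i \<le> n \<Longrightarrow> V m i = m"
    and Tm: "\<And>i. p < i \<Longrightarrow> i \<le> n \<Longrightarrow> P (i, m) = Vertical \<or> P (i, m) = Crossing"
    using labelled_run[OF L mm, of n m] LD(1) m by auto
  have py: "p = y"
  proof (rule ccontr)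
    assume "p \<noteq> y"
    moreover have "rot m c x y R p = m" using R'[of p] p by simp
    moreover have "p \<noteq> x" using calculation m by (auto simp: rot_def)
    moreover have "p \<noteq> c" using calculation km yc c by (auto simp: rot_def k_def)
    ultimately have "R p = m" by (simp add: rot_def)
    then show False using inj[of p x] p x \<open>p \<noteq> x\<close> m by auto
  qed
  have row: "V m i = m" "P (i, m) = Vertical \<or> P (i, m) = Crossing" if "y < i" "i \<le> n" for i
    using Vm[of i] Tm[of i] that py by auto
  have tc: "P (c, m) = Crossing" "H (m - 1) c = k"
    using row[of c] LD(3)[OF cn] R'[OF cn] cn yc c k by (auto simp: rot_def k_def)
  have tmid: "P (i, m) = Crossing" "H (m - 1) i = R i" if "c < i" "i < x" for i
    using row[of i] LD(3)[of i] R'[of i] filled[OF that] that x yc by (auto simp: rot_def)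
  have tx: "P (x, m) = Vertical" 
    using row[of x] LD(3)[of x] R'[of x] x yc c by (auto simp: rot_def)
  define V' where "V' i = (if c \<le> i \<and> i < x then 0 else if y \<le> i \<and> i < c then k else V m i)" for i
  let ?P = "uncross_column m c x P"
  have L': "labelled n m ?P (H(m := R)) (V(m := V'))"
  proof (rule labelled_update[OF labelled_mono[OF L diff_le_self] m])
    show "?P (i, j) = P (i, j)" if "j \<noteq> m" for i j using that by (simp add: uncross_column_def)
    show "V' n = m" using LD(1) x c cn by (auto simp: V'_def)
    show "V' 0 = 0" using LD(2) yc by (simp add: V'_def)
    fix i assume i: "i \<in> {1..n}"
    note t = LD(3)[OF i]
    consider "i > x" | "i = x" | "c < i" "i < x" | "i = c" | "y < i" "i < c" | "i = y" | "i < y" by linarith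
    then show "tile_ok (?P (i, m)) (H (m - 1) i) (V' i) (R i) (V' (i - 1))"
    proof cases
      case 1
      then have "V' i = V m i" "V' (i - 1) = V m (i - 1)" "H m i = R i"
        using R'[OF i] c yc by (auto simp: V'_def rot_def)
      then show ?thesis using t 1 by (simp add: uncross_column_def)
    next
      case 2
      then show ?thesis using t tx row[of x] yc c m x by (auto simp: uncross_column_def V'_def)
    next
      case 3
      then show ?thesis using t tmid[OF 3] filled[OF 3] by (auto simp: uncross_column_def V'_def)
    next
      case 4
      then show ?thesis using tc yc c k by (auto simp: uncross_column_def V'_def)
    next
      case 5
      then show ?thesis using t row[of i] R'[OF i] i c k by (auto simp: uncross_column_def V'_def rot_def)
    next
      case 6
      then show ?thesis using t p py c yc k by (auto simp: uncross_column_def V'_def k_def)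
    next
      case 7
      then show ?thesis using t R'[OF i] c yc by (auto simp: uncross_column_def V'_def rot_def)
    qed
  qed
  have good': "good_crossings n m ?P (H(m := R)) (V(m := V'))"
    unfolding good_crossings_def
  proof (intro ballI impI)
    fix j i assume ji: "j \<in> {1..m}" "i \<in> {1..n}" and cr: "?P (i, j) = Crossing"
    have jm: "j - 1 \<noteq> m" using ji by auto
    have P: "P (i, j) = Crossing" "\<not> (j = m \<and> c \<le> i \<and> i \<le> x)"
      using cr by (auto simp: uncross_column_def split: if_splits)
    then have g: "H (j - 1) i < V j i" using good ji by (auto simp: good_crossings_def)
    show "(H(m := R)) (j - 1) i < (V(m := V')) j i"
    proof (cases "j = m \<and> y \<le> i \<and> i < c")
      case True
      then have "i \<noteq> y" using P p py by auto
      \<comment> \<open>The vertical label at these crossings drops from \<open>m\<close> to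
        \<open>k\<close>; membership in \<open>movable\<close> preserves the inequality.\<close>
      then have "H (m - 1) i = R i" "R i < k"
        using LD(3)[OF ji(2)] P R'[OF ji(2)] True ymax[of i] c by (auto simp: rot_def k_def)
      then show ?thesis using True jm by (auto simp: V'_def)
    next
      case False
      then show ?thesis using P g jm by (auto simp: V'_def)
    qed
  qed
  have top': "top_empty n m ?P"
    unfolding top_empty_def
  proof (intro ballI impI)
    fix j i i' assume ji: "j \<in> {1..m}" "i \<in> {1..n}" "?P (i, j) = Empty" "i' \<in> {1..i}"
    have "P (i, j) = Empty" using ji(3) by (auto simp: uncross_column_def split: if_splits)
    then have all: "\<And>i'. i' \<in> {1..i} \<Longrightarrow> P (i', j) = Empty" using top ji unfolding top_empty_def by blast
    show "?P (i', j) = Empty"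
    proof (cases "j = m \<and> c \<le> i'")
      case True
      then have "P (c, m) = Empty" using all[of c] ji c by auto
      then show ?thesis using tc by simp
    next
      case False
      then show ?thesis using all[OF ji(4)] by (auto simp: uncross_column_def)
    qed
  qed
  have ext': "?P \<in> ({1..n} \<times> {1..m}) \<rightarrow>\<^sub>E UNIV"
    using ext cn x m by (auto simp: uncross_column_def PiE_iff extensional_def)
  show "?P \<in> eg_tilings n m R"
    by (rule eg_tilingsI[OF ext' L' good' top']) simp
  have "P (i, m) = Crossing" if "c \<le> i" "i < x" for i
    using tc tmid[of i] that by (cases "i = c") auto
  note cr = this
  show "cross_column m c x ?P = P"
  proof
    fix ij show "cross_column m c x ?P ij = P ij"
      using tx cr by (cases ij) (auto simp: cross_column_def uncross_column_def)
  qed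
qed

text \<open>A tiling determines its labels, and \<open>y\<close> is the row in which pipe
  \<open>m\<close> leaves.\<close>

lemma rot_disjoint:
  assumes y: "y \<in> movable R c" "y' \<in> movable R c"
    and P: "P \<in> eg_tilings n m (rot m c x y R)" "P \<in> eg_tilings n m (rot m c x y' R)"
  shows "y = y'"
proof -
  obtain H V where "labelled n m P H V" "\<And>i. i \<in> {1..n} \<Longrightarrow> H m i = rot m c x y R i"
    using P(1) unfolding eg_tilings_def by blast
  moreover obtain H' V' where "labelled n m P H' V'" "\<And>i. i \<in> {1..n} \<Longrightarrow> H' m i = rot m c x y' R i"
    using P(2) unfolding eg_tilings_def by blast
  ultimately have eq: "rot m c x y R i = rot m c x y' R i" if "i \<in> {1..n}" for i
    using labelled_unique[of n m P H V H' V' m] that by auto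
  have yc: "1 \<le> y" "y < c" "y' < c" using y by (auto simp: movable_def)
  then have yn: "y \<in> {1..n}" using c x by auto
  show ?thesis
  proof (rule ccontr)
    assume "y \<noteq> y'"
    then have "R y = m" using eq[OF yn] yc c by (auto simp: rot_def)
    then show False using inj[of y x] yn x yc c m by auto
  qed
qed

lemma height_cross:
  assumes "P \<in> eg_tilings n m R"
  shows "height n m (cross_column m c x P) = height n m P"
proof -
  have P: "uncross_column m c x (cross_column m c x P) = P" by (rule cross_in(2)[OF assms])
  have "P (i, j) = Empty \<longleftrightarrow> cross_column m c x P (i, j) = Empty" for i j
    by (subst P[symmetric]) (auto simp: uncross_column_def cross_column_def)
  then show ?thesis by (auto simp: height_def fun_eq_iff)
qed

text \<open>The weight may be any function of the heights, because \<open>cross_column\<close>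
  neither creates nor removes empty squares.\<close>

theorem sum_eg_tilings_droop:
  "(\<Sum>P\<in>eg_tilings n m R. f (height n m P) :: int) =
    (\<Sum>y\<in>movable R c. \<Sum>P\<in>eg_tilings n m (rot m c x y R). f (height n m P))"
proof -
  have "(\<Sum>P\<in>eg_tilings n m R. f (height n m P)) =
    (\<Sum>P\<in>(\<Union>y\<in>movable R c. eg_tilings n m (rot m c x y R)). f (height n m P))"
  proof (rule sum.reindex_bij_witness[where i = "uncross_column m c x" and j = "cross_column m c x"])
    fix P assume P: "P \<in> eg_tilings n m R"
    show "uncross_column m c x (cross_column m c x P) = P" by (rule cross_in(2)[OF P])
    show "cross_column m c x P \<in> (\<Union>y\<in>movable R c. eg_tilings n m (rot m c x y R))"
      using cross_in(1)[OF P] by blast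
    show "f (height n m (cross_column m c x P)) = f (height n m P)" using height_cross[OF P] by simp
  qed (use uncross_in in auto)
  also have "\<dots> = (\<Sum>y\<in>movable R c. \<Sum>P\<in>eg_tilings n m (rot m c x y R). f (height n m P))"
  proof (rule sum.UNION_disjoint)
    show "finite (movable R c)" by (rule finite_subset[of _ "{1..<c}"]) (auto simp: movable_def)
  qed (use rot_disjoint finite_eg_tilings in blast)+
  finally show ?thesis .
qed

end

text \<open>The case complementary to \<open>droop\<close>: the rows above \<open>x\<close> that no
  pipe leaves are exactly the top \<open>h\<close> rows.\<close>

locale drop_column =
  fixes n m h x :: nat and R :: "nat \<Rightarrow> nat"
  assumes m: "1 \<le> m" and x: "x \<in> {1..n}" "R x = m" and h: "h < x"
    and empty: "\<And>z. z \<in> {1..h} \<Longrightarrow> R z = 0" and filled: "\<And>z. h < z \<Longrightarrow> z < x \<Longrightarrow> R z \<noteq> 0"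
    and inj: "\<And>i i'. i \<in> {1..n} \<Longrightarrow> i' \<in> {1..n} \<Longrightarrow> R i = R i' \<Longrightarrow> R i \<noteq> 0 \<Longrightarrow> i = i'"
begin

definition column :: "nat \<Rightarrow> tile" where
  "column i = (if i \<le> h then Empty else if i < x then Horizontal else if i = x then SE_elbow
    else if R i = 0 then Vertical else Crossing)"

definition extend :: "tiling \<Rightarrow> tiling" where
  "extend P = (\<lambda>(i, j). if j = m \<and> i \<in> {1..n} then column i else P (i, j))"

text \<open>An NW elbow in the top \<open>h\<close> rows would make its pipe leave further up, where
  no pipe leaves. Hence the tiles above row \<open>x\<close> are empty or horizontal, and below it
  pipe \<open>m\<close> goes straight up.\<close>

lemma drop_in:
  assumes P: "P \<in> eg_tilings n m R"
  shows "restrict P ({1..n} \<times> {1..m - 1}) \<in> eg_tilings n (m - 1) (R(x := 0))"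
    and "extend (restrict P ({1..n} \<times> {1..m - 1})) = P"
proof -
  from P obtain H V where ext: "P \<in> ({1..n} \<times> {1..m}) \<rightarrow>\<^sub>E UNIV" and L: "labelled n m P H V"
    and good: "good_crossings n m P H V" and top: "top_empty n m P"
    and R: "\<And>i. i \<in> {1..n} \<Longrightarrow> H m i = R i"
    unfolding eg_tilings_def by blast
  have mm: "m \<in> {1..m}" using m by simp
  note LD = labelledD[OF L mm]
  obtain p where p: "1 \<le> p" "p \<le> n" "P (p, m) = SE_elbow" "H m p = m"
    and Vm: "\<And>i. p \<le> i \<Longrightarrow> i \<le> n \<Longrightarrow> V m i = m"
    and Tm: "\<And>i. p < i \<Longrightarrow> i \<le> n \<Longrightarrow> P (i, m) = Vertical \<or> P (i, m) = Crossing"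
    using labelled_run[OF L mm, of n m] LD(1) m by auto
  have px: "p = x" using inj[of p x] p x R m by auto
  have tile: "P (i, m) = column i \<and> H (m - 1) i = R i" if i: "i \<in> {1..n}" "i < x" "V m i = 0" for i
  proof (cases "h < i")
    case True
    then show ?thesis using LD(3)[OF i(1)] i filled[OF True i(2)] R[OF i(1)]
      by (cases "P (i, m)") (auto simp: column_def)
  next
    case False
    then have Ri: "R i = 0" using empty i by simp
    have "P (i, m) \<noteq> NW_elbow"
    proof
      assume "P (i, m) = NW_elbow"
      then have k: "V m (i - 1) \<noteq> 0" using LD(3)[OF i(1)] by simp
      have "i - 1 \<le> n" using i by auto
      from labelled_run[OF L mm this refl k] obtain q where
        q: "1 \<le> q" "q \<le> i - 1" "H m q = V m (i - 1)" by metis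
      then have "R q \<noteq> 0" "q \<in> {1..h}" using R[of q] k i False by auto
      then show False using empty by simp
    qed
    then show ?thesis using LD(3)[OF i(1)] i Ri R[OF i(1)] False
      by (cases "P (i, m)") (auto simp: column_def)
  qed
  have V0: "V m i = 0" if "i < x" for i
    using that
  proof (induction "x - i" arbitrary: i rule: less_induct)
    case less
    show ?case
    proof (cases "Suc i = x")
      case True
      then show ?thesis using LD(3)[of x] p px x by auto
    next
      case False
      then have v: "V m (Suc i) = 0" "Suc i < x" "Suc i \<in> {1..n}" using less x by auto
      then have "P (Suc i, m) = column (Suc i)" using tile by blast
      then show ?thesis using LD(3)[OF v(3)] v by (cases "h < Suc i") (auto simp: column_def)
    qed
  qed
  have col: "P (i, m) = column i \<and> H (m - 1) i = (R(x := 0)) i" if i: "i \<in> {1..n}" for i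
  proof -
    consider "i < x" | "i = x" | "x < i" by linarith
    then show ?thesis
    proof cases
      case 1
      then show ?thesis using tile[OF i 1 V0[OF 1]] by simp
    next
      case 2
      then show ?thesis using LD(3)[OF i] p px h by (auto simp: column_def)
    next
      case 3
      then show ?thesis using LD(3)[OF i] Tm[of i] px R[OF i] h i by (auto simp: column_def)
    qed
  qed
  let ?P = "restrict P ({1..n} \<times> {1..m - 1})"
  have sub: "j \<in> {1..m}" if "j \<in> {1..m - 1}" for j using that by auto
  show "?P \<in> eg_tilings n (m - 1) (R(x := 0))"
  proof (rule eg_tilingsI)
    show "labelled n (m - 1) ?P H V"
      using labelled_mono[OF L diff_le_self] by (auto simp: labelled_def)
    show "good_crossings n (m - 1) ?P H V" using good sub by (auto simp: good_crossings_def)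
    show "top_empty n (m - 1) ?P"
      unfolding top_empty_def
    proof (intro ballI impI)
      fix j i i' assume ji: "j \<in> {1..m - 1}" "i \<in> {1..n}" "?P (i, j) = Empty" "i' \<in> {1..i}"
      have "P (i, j) = Empty" using ji by simp
      from top[unfolded top_empty_def, rule_format, OF sub[OF ji(1)] ji(2) this ji(4)]
      show "?P (i', j) = Empty" using ji by auto
    qed
    show "H (m - 1) i = (R(x := 0)) i" if "i \<in> {1..n}" for i using col[OF that] by simp
  qed auto
  show "extend ?P = P"
  proof
    fix ij :: "nat \<times> nat"
    obtain i j where ij: "ij = (i, j)" by (cases ij)
    show "extend ?P ij = P ij"
    proof (cases "(i, j) \<in> {1..n} \<times> {1..m}")
      case True
      then show ?thesis using col[of i] m by (cases "j = m") (auto simp: extend_def ij)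
    next
      case False
      then have "P (i, j) = undefined" using ext by (auto simp: PiE_iff extensional_def)
      then show ?thesis using False m by (auto simp: extend_def ij)
    qed
  qed
qed

lemma extend_in:
  assumes P: "P \<in> eg_tilings n (m - 1) (R(x := 0))"
  shows "extend P \<in> eg_tilings n m R"
    and "restrict (extend P) ({1..n} \<times> {1..m - 1}) = P"
    and "height n m (extend P) = (height n (m - 1) P)(m := h)"
proof -
  from P obtain H V where ext: "P \<in> ({1..n} \<times> {1..m - 1}) \<rightarrow>\<^sub>E UNIV" and L: "labelled n (m - 1) P H V"
    and good: "good_crossings n (m - 1) P H V" and top: "top_empty n (m - 1) P"
    and R: "\<And>i. i \<in> {1..n} \<Longrightarrow> H (m - 1) i = (R(x := 0)) i"
    unfolding eg_tilings_def by blast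
  define V' where "V' i = (if x \<le> i then m else 0)" for i
  have b: "H (m - 1) i < m" if "i \<in> {1..n}" for i
    using labelled_bound[OF L order_refl that] m by auto
  have e: "extend P (i, j) = P (i, j)" if "j \<noteq> m" for i j using that by (auto simp: extend_def)
  show "extend P \<in> eg_tilings n m R"
  proof (rule eg_tilingsI)
    show "extend P \<in> ({1..n} \<times> {1..m}) \<rightarrow>\<^sub>E UNIV"
    proof -
      have "extend P (i, j) = undefined" if "(i, j) \<notin> {1..n} \<times> {1..m}" for i j
      proof -
        have "(i, j) \<notin> {1..n} \<times> {1..m - 1}" "\<not> (j = m \<and> i \<in> {1..n})" using that m by auto
        then show ?thesis using ext unfolding PiE_iff extensional_def extend_def by auto
      qed
      then show ?thesis by (auto simp: PiE_iff extensional_def)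
    qed
    show "labelled n m (extend P) (H(m := R)) (V(m := V'))"
    proof (rule labelled_update[OF L m e])
      show "V' n = m" "V' 0 = 0" using x by (auto simp: V'_def)
      fix i assume i: "i \<in> {1..n}"
      show "tile_ok (extend P (i, m)) (H (m - 1) i) (V' i) (R i) (V' (i - 1))"
        using R[OF i] i x h m empty[of i] filled[of i] by (auto simp: extend_def column_def V'_def)
    qed
    show "good_crossings n m (extend P) (H(m := R)) (V(m := V'))"
      unfolding good_crossings_def
    proof (intro ballI impI)
      fix j i assume ji: "j \<in> {1..m}" "i \<in> {1..n}" "extend P (i, j) = Crossing"
      have jm: "j - 1 \<noteq> m" using ji by auto
      show "(H(m := R)) (j - 1) i < (V(m := V')) j i"
      proof (cases "j = m")
        case True
        then have "x \<le> i" using ji by (auto simp: extend_def column_def split: if_splits)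
        then show ?thesis using True b[OF ji(2)] jm by (simp add: V'_def)
      next
        case False
        then have "j \<in> {1..m - 1}" using ji by auto
        then show ?thesis using False good ji e[OF False] jm by (auto simp: good_crossings_def)
      qed
    qed
    show "top_empty n m (extend P)"
      unfolding top_empty_def
    proof (intro ballI impI)
      fix j i i' assume ji: "j \<in> {1..m}" "i \<in> {1..n}" "extend P (i, j) = Empty" "i' \<in> {1..i}"
      show "extend P (i', j) = Empty"
      proof (cases "j = m")
        case True
        then show ?thesis using ji by (auto simp: extend_def column_def split: if_splits)
      next
        case False
        then have "j \<in> {1..m - 1}" using ji by auto
        from top[unfolded top_empty_def, rule_format, OF this ji(2) _ ji(4)]
        show ?thesis using ji e[OF False] by simp
      qed
    qed
  qed simp
  show "restrict (extend P) ({1..n} \<times> {1..m - 1}) = P"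
  proof
    fix ij show "restrict (extend P) ({1..n} \<times> {1..m - 1}) ij = P ij"
      using ext m by (cases ij) (auto simp: restrict_def PiE_iff extensional_def extend_def)
  qed
  have "{i \<in> {1..n}. extend P (i, m) = Empty} = {1..h}"
    using h x by (auto simp: extend_def column_def split: if_splits)
  then show "height n m (extend P) = (height n (m - 1) P)(m := h)"
    using m e by (auto simp: height_def fun_eq_iff)
qed

theorem sum_eg_tilings_drop:
  "(\<Sum>P\<in>eg_tilings n m R. f (height n m P) :: int) =
    (\<Sum>P\<in>eg_tilings n (m - 1) (R(x := 0)). f ((height n (m - 1) P)(m := h)))"
  by (rule sum.reindex_bij_witness[where i = extend and j = "\<lambda>P. restrict P ({1..n} \<times> {1..m - 1})"])
    (metis drop_in extend_in)+

end

section \<open>Edge labels and traced pipes\<close>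

lemma tile_ok_meets:
  assumes "tile_ok t w s e k"
  shows "meets t West \<longleftrightarrow> w \<noteq> 0" "meets t South \<longleftrightarrow> s \<noteq> 0" "meets t East \<longleftrightarrow> e \<noteq> 0" "meets t North \<longleftrightarrow> k \<noteq> 0"
  using assms by (cases t; simp add: meets_def)+

lemma labelled_pipe_tiling:
  assumes P: "P \<in> ({1..n} \<times> {1..n}) \<rightarrow>\<^sub>E UNIV" and L: "labelled n n P H V"
    and R: "\<And>i. i \<in> {1..n} \<Longrightarrow> H n i \<noteq> 0"
  shows "pipe_tiling n P"
proof -
  have t: "tile_ok (P (i, j)) (H (j - 1) i) (V j i) (H j i) (V j (i - 1))" if "i \<in> {1..n}" "j \<in> {1..n}" for i j
    using labelledD(3)[OF L that(2,1)] .
  note M = tile_ok_meets[OF t]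
  show ?thesis
    unfolding pipe_tiling_def
  proof (intro conjI ballI)
    fix i j assume "i \<in> {1..n}" "j \<in> {1..<n}"
    then show "meets (P (i, j)) East = meets (P (i, j + 1)) West"
      using M(3)[of i j] M(1)[of i "j + 1"] by simp
  next
    fix i j assume "i \<in> {1..<n}" "j \<in> {1..n}"
    then show "meets (P (i, j)) South = meets (P (i + 1, j)) North"
      using M(2)[of i j] M(4)[of "i + 1" j] by simp
  next
    fix j assume j: "j \<in> {1..n}"
    then show "meets (P (n, j)) South" "\<not> meets (P (1, j)) North"
      using M(2)[of n j] M(4)[of 1 j] labelledD[OF L j] by auto
  next
    fix i assume i: "i \<in> {1..n}"
    then show "meets (P (i, n)) East" "\<not> meets (P (i, 1)) West"
      using M(3)[of i n] M(1)[of i 1] R[OF i] L by (auto simp: labelled_def)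
  qed (use P in auto)
qed

text \<open>The tiles dictate the labels upwards from the south border. By \<open>c\<close>, a
  vertical edge is used by both of its tiles or by neither, which keeps the computed labels
  consistent.\<close>

lemma label_column:
  fixes t :: "nat \<Rightarrow> tile"
  assumes n: "1 \<le> n" and s: "s \<noteq> 0"
    and L: "\<And>i. i \<in> {1..n} \<Longrightarrow> meets (t i) West \<longleftrightarrow> L i \<noteq> (0 :: nat)"
    and c: "\<And>i. i \<in> {1..<n} \<Longrightarrow> meets (t i) South \<longleftrightarrow> meets (t (i + 1)) North"
    and b: "meets (t n) South" "\<not> meets (t 1) North"
  obtains V E where "V n = s" "V 0 = 0" "\<And>i. i \<in> {1..n} \<Longrightarrow> tile_ok (t i) (L i) (V i) (E i) (V (i - 1))"
proof -
  define nl where "nl T w v = (if T = Vertical \<or> T = Crossing then v else if T = NW_elbow then w else (0 :: nat))" for T w v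
  define el where "el T w v = (if T = Horizontal \<or> T = Crossing then w else if T = SE_elbow then v else (0 :: nat))" for T w v
  \<comment> \<open>\<open>W k\<close> is the label \<open>k\<close> edges above the south border;
    it becomes \<open>V (n - k)\<close>.\<close>
  define W where "W = rec_nat s (\<lambda>k v. nl (t (n - k)) (L (n - k)) v)"
  have W: "W 0 = s" "W (Suc k) = nl (t (n - k)) (L (n - k)) (W k)" for k by (auto simp: W_def)
  define V where "V i = W (n - i)" for i
  define E where "E i = el (t i) (L i) (V i)" for i
  have Vn: "V n = s" by (simp add: V_def W)
  have Vs: "V (i - 1) = nl (t i) (L i) (V i)" if "i \<in> {1..n}" for i
  proof -
    have "n - (i - 1) = Suc (n - i)" "n - (n - i) = i" using that by auto
    then show ?thesis by (simp add: V_def W)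
  qed
  have ok: "tile_ok T w v (el T w v) (nl T w v)"
    if "meets T West \<longleftrightarrow> w \<noteq> 0" "meets T South \<longleftrightarrow> v \<noteq> 0" for T w v
    using that by (cases T) (auto simp: meets_def el_def nl_def)
  have S: "meets (t i) South \<longleftrightarrow> V i \<noteq> 0" if "i \<in> {1..n}" for i
    using that
  proof (induction "n - i" arbitrary: i)
    case 0
    then show ?case using b s Vn by simp
  next
    case (Suc d)
    then have i: "i \<in> {1..<n}" "Suc i \<in> {1..n}" "d = n - Suc i" by auto
    have "tile_ok (t (Suc i)) (L (Suc i)) (V (Suc i)) (E (Suc i)) (V i)"
      using ok[OF L[OF i(2)] Suc.hyps(1)[OF i(3,2)]] Vs[OF i(2)] by (simp add: E_def)
    from tile_ok_meets(4)[OF this] show ?case using c[OF i(1)] by simp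
  qed
  have T: "tile_ok (t i) (L i) (V i) (E i) (V (i - 1))" if "i \<in> {1..n}" for i
    using ok[OF L[OF that] S[OF that]] Vs[OF that] by (simp add: E_def)
  have "V 0 = 0" using tile_ok_meets(4)[OF T[of 1]] b n by simp
  then show ?thesis using that Vn T by blast
qed

lemma pipe_tiling_labelled:
  assumes P: "pipe_tiling n P"
  obtains H V where "labelled n n P H V"
proof -
  have "\<exists>H V. labelled n m P H V" if "m \<le> n" for m
    using that
  proof (induction m)
    case 0
    show ?case by (rule exI[of _ "\<lambda>_ _. 0"]) (simp add: labelled_def)
  next
    case (Suc m)
    then obtain H V where L: "labelled n m P H V" by auto
    have j: "Suc m \<in> {1..n}" using Suc.prems by simp
    have W: "meets (P (i, Suc m)) West \<longleftrightarrow> H m i \<noteq> 0" if i: "i \<in> {1..n}" for i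
    proof (cases "m = 0")
      case True
      then show ?thesis using P i L unfolding pipe_tiling_def labelled_def by auto
    next
      case False
      then have m: "m \<in> {1..m}" "m \<in> {1..<n}" using Suc.prems by auto
      have "meets (P (i, m)) East \<longleftrightarrow> meets (P (i, m + 1)) West"
        using P i m(2) unfolding pipe_tiling_def by blast
      then show ?thesis using tile_ok_meets(3)[OF labelledD(3)[OF L m(1) i]] by simp
    qed
    obtain V' E where "V' n = Suc m" "V' 0 = 0"
      "\<And>i. i \<in> {1..n} \<Longrightarrow> tile_ok (P (i, Suc m)) (H m i) (V' i) (E i) (V' (i - 1))"
    proof (rule label_column[where t = "\<lambda>i. P (i, Suc m)" and L = "H m" and s = "Suc m" and n = n])
      show "meets (P (i, Suc m)) South = meets (P (i + 1, Suc m)) North" if "i \<in> {1..<n}" for i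
        using P that j unfolding pipe_tiling_def by blast
      show "meets (P (n, Suc m)) South" "\<not> meets (P (1, Suc m)) North"
        using P j unfolding pipe_tiling_def by blast+
    qed (use W Suc.prems in auto)
    then have "labelled n (Suc m) P (H(Suc m := E)) (V(Suc m := V'))"
      using L by (intro labelled_update) auto
    then show ?case by blast
  qed
  then show ?thesis using that by blast
qed

text \<open>Tracing a pipe never changes the label met, because \<open>tile_ok\<close> hands labels
  on along the segments of a tile.\<close>

lemma pipe_enters_labels:
  assumes L: "labelled n n P H V"
  shows "pipe_enters n P p c s \<Longrightarrow> p \<noteq> 0 \<and> fst c \<in> {1..n} \<and> snd c \<in> {1..n} \<and>
    (s = South \<and> V (snd c) (fst c) = p \<or> s = West \<and> H (snd c - 1) (fst c) = p)"
proof (induction rule: pipe_enters.induct)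
  case start
  then show ?case using labelledD(1)[OF L, of p] by auto
next
  case (north i j s)
  then have "i \<in> {1..n}" "j \<in> {1..n}" by auto
  from labelledD(3)[OF L this(2,1)] show ?case using north by (cases "P (i, j)") auto
next
  case (east i j s)
  then have "i \<in> {1..n}" "j \<in> {1..n}" by auto
  from labelledD(3)[OF L this(2,1)] show ?case using east by (cases "P (i, j)") auto
qed

lemma labels_pipe_enters:
  assumes L: "labelled n n P H V"
  shows "j \<in> {1..n} \<Longrightarrow> i \<in> {1..n} \<Longrightarrow> (H (j - 1) i \<noteq> 0 \<longrightarrow> pipe_enters n P (H (j - 1) i) (i, j) West) \<and>
    (V j i \<noteq> 0 \<longrightarrow> pipe_enters n P (V j i) (i, j) South)"
proof (induction j arbitrary: i)
  case 0 then show ?case by simp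
next
  case (Suc j)
  have W: "pipe_enters n P (H j i) (i, Suc j) West" if i: "i \<in> {1..n}" and nz: "H j i \<noteq> 0" for i
  proof -
    have j: "j \<in> {1..n}"
    proof (cases j)
      case 0 then show ?thesis using L nz by (simp add: labelled_def)
    qed (use Suc.prems in auto)
    have t: "tile_ok (P (i, j)) (H (j - 1) i) (V j i) (H j i) (V j (i - 1))"
      by (rule labelledD(3)[OF L j i])
    have "\<exists>s. pipe_enters n P (H j i) (i, j) s \<and> (s, East) \<in> segments (P (i, j))"
      using Suc.IH[OF j i] t nz by (cases "P (i, j)") auto
    then show ?thesis using pipe_enters.east[of n P "H j i" i j] Suc.prems by auto
  qed
  have S: "V (Suc j) i \<noteq> 0 \<longrightarrow> pipe_enters n P (V (Suc j) i) (i, Suc j) South" if "i \<in> {1..n}" for i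
    using that
  proof (induction "n - i" arbitrary: i)
    case 0
    then show ?case using labelledD(1)[OF L Suc.prems(1)] pipe_enters.start[OF Suc.prems(1)] by simp
  next
    case (Suc d)
    then have i: "Suc i \<in> {1..n}" "d = n - Suc i" by auto
    have t: "tile_ok (P (Suc i, Suc j)) (H j (Suc i)) (V (Suc j) (Suc i)) (H (Suc j) (Suc i)) (V (Suc j) i)"
      using labelledD(3)[OF L \<open>Suc j \<in> {1..n}\<close> i(1)] by simp
    show ?case
    proof
      assume nz: "V (Suc j) i \<noteq> 0"
      have "\<exists>s. pipe_enters n P (V (Suc j) i) (Suc i, Suc j) s \<and> (s, North) \<in> segments (P (Suc i, Suc j))"
        using Suc.hyps(1)[OF i(2,1)] W[OF i(1)] t nz by (cases "P (Suc i, Suc j)") auto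
      then show "pipe_enters n P (V (Suc j) i) (i, Suc j) South"
        using pipe_enters.north[of n P "V (Suc j) i" "Suc i" "Suc j"] Suc.prems by auto
    qed
  qed
  show ?case using W S Suc.prems by simp
qed

lemma pipe_enters_iff:
  assumes L: "labelled n n P H V"
  shows "pipe_enters n P p (i, j) South \<longleftrightarrow> p \<noteq> 0 \<and> i \<in> {1..n} \<and> j \<in> {1..n} \<and> V j i = p"
    and "pipe_enters n P p (i, j) West \<longleftrightarrow> p \<noteq> 0 \<and> i \<in> {1..n} \<and> j \<in> {1..n} \<and> H (j - 1) i = p"
  using pipe_enters_labels[OF L, of p "(i, j)"] labels_pipe_enters[OF L, of j i] by auto

lemma pipe_exits_iff:
  assumes L: "labelled n n P H V" and i: "i \<in> {1..n}"
  shows "pipe_exits_at_row n P p i \<longleftrightarrow> p \<noteq> 0 \<and> H n i = p"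
proof -
  have n: "n \<in> {1..n}" using i by auto
  have "pipe_exits_at_row n P p i \<longleftrightarrow> (pipe_enters n P p (i, n) South \<and> (South, East) \<in> segments (P (i, n))) \<or>
    (pipe_enters n P p (i, n) West \<and> (West, East) \<in> segments (P (i, n)))"
    unfolding pipe_exits_at_row_def
  proof
    assume "\<exists>s. pipe_enters n P p (i, n) s \<and> (s, East) \<in> segments (P (i, n))"
    then obtain s where "pipe_enters n P p (i, n) s \<and> (s, East) \<in> segments (P (i, n))" by blast
    then show "pipe_enters n P p (i, n) South \<and> (South, East) \<in> segments (P (i, n)) \<or>
      pipe_enters n P p (i, n) West \<and> (West, East) \<in> segments (P (i, n))"
      using pipe_enters_labels[OF L, of p "(i, n)" s] by auto
  qed auto
  then show ?thesis using labelledD(3)[OF L n i] i n by (cases "P (i, n)") (auto simp: pipe_enters_iff[OF L])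
qed

lemma pipes_cross_iff:
  assumes L: "labelled n n P H V"
  shows "pipes_cross_at n P p q (i, j) \<longleftrightarrow> i \<in> {1..n} \<and> j \<in> {1..n} \<and> P (i, j) = Crossing \<and>
    (V j i = p \<and> H (j - 1) i = q \<or> V j i = q \<and> H (j - 1) i = p)"
proof (cases "i \<in> {1..n} \<and> j \<in> {1..n}")
  case True
  then have t: "tile_ok (P (i, j)) (H (j - 1) i) (V j i) (H j i) (V j (i - 1))" using labelledD(3)[OF L] by blast
  show ?thesis using True t by (auto simp: pipes_cross_at_def pipe_enters_iff[OF L])
qed (auto simp: pipes_cross_at_def pipe_enters_iff[OF L])

section \<open>Crossings\<close>

definition above :: "nat \<Rightarrow> (nat \<Rightarrow> nat) \<Rightarrow> nat \<Rightarrow> nat \<Rightarrow> bool" where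
  "above n R p q \<longleftrightarrow> (\<exists>i i'. 1 \<le> i \<and> i < i' \<and> i' \<le> n \<and> R i = p \<and> R i' = q)"

lemma above_asym:
  assumes L: "labelled n m P H V" and j: "j \<le> m" and pq: "p \<noteq> 0" "q \<noteq> 0"
    and a: "above n (H j) p q" "above n (H j) q p"
  shows False
proof -
  obtain i i' where i: "1 \<le> i" "i < i'" "i' \<le> n" "H j i = p" "H j i' = q" using a(1) by (auto simp: above_def)
  obtain k k' where k: "1 \<le> k" "k < k'" "k' \<le> n" "H j k = q" "H j k' = p" using a(2) by (auto simp: above_def)
  have "i = k'" using labelled_inj[OF L j, of i k'] i k pq by auto
  moreover have "i' = k" using labelled_inj[OF L j, of i' k] i k pq by auto
  ultimately show False using i k by simp
qed

lemma label_moves_up: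
  assumes L: "labelled n m P H V" and j: "j \<in> {1..m}" and r: "r \<in> {1..n}" "H (j - 1) r = p" "p \<noteq> 0"
  obtains r' where "1 \<le> r'" "r' \<le> r" "H j r' = p"
    "\<And>i. r' < i \<Longrightarrow> i < r \<Longrightarrow> V j i = p \<and> (P (i, j) = Vertical \<or> P (i, j) = Crossing)"
proof -
  note t = labelledD(3)[OF L j r(1)]
  show ?thesis
  proof (cases "P (r, j) = NW_elbow")
    case False
    then have "H j r = p" using t r by (cases "P (r, j)") auto
    then show ?thesis using that[of r] r by auto
  next
    case True
    then have v: "V j (r - 1) = p" "r - 1 \<le> n" using t r by auto
    obtain q where q: "1 \<le> q" "q \<le> r - 1" "H j q = p" "\<And>i. q \<le> i \<Longrightarrow> i \<le> r - 1 \<Longrightarrow> V j i = p"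
      "\<And>i. q < i \<Longrightarrow> i \<le> r - 1 \<Longrightarrow> P (i, j) = Vertical \<or> P (i, j) = Crossing"
      using labelled_run[OF L j v(2,1) r(3)] by metis
    then show ?thesis using that[of q] by auto
  qed
qed

text \<open>Pipes leave a column no lower than they entered it. If the lower pipe overtakes the
  upper one, it runs vertically through the row in which the upper one leaves, and the tile there is
  a crossing.\<close>

lemma above_change:
  assumes L: "labelled n m P H V" and j: "j \<in> {1..m}" and pq: "p \<noteq> 0" "q \<noteq> 0"
    and a: "above n (H (j - 1)) p q"
  shows "above n (H j) p q \<or> above n (H j) q p \<and>
    (\<exists>i\<in>{1..n}. P (i, j) = Crossing \<and> V j i = q \<and> H (j - 1) i = p)"
proof -
  obtain r s where rs: "1 \<le> r" "r < s" "s \<le> n" "H (j - 1) r = p" "H (j - 1) s = q"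
    using a by (auto simp: above_def)
  have jm: "j - 1 \<le> m" "j \<le> m" using j by auto
  have ne: "p \<noteq> q" using labelled_inj[OF L jm(1), of r s] rs pq by auto
  obtain r' where r': "1 \<le> r'" "r' \<le> r" "H j r' = p"
    using label_moves_up[OF L j _ rs(4) pq(1)] rs by auto
  obtain s' where s': "1 \<le> s'" "s' \<le> s" "H j s' = q"
    "\<And>i. s' < i \<Longrightarrow> i < s \<Longrightarrow> V j i = q \<and> (P (i, j) = Vertical \<or> P (i, j) = Crossing)"
    using label_moves_up[OF L j _ rs(5) pq(2)] rs by auto
  consider "r' < s'" | "s' < r'" using r' s' ne by (metis linorder_neqE_nat)
  then show ?thesis
  proof cases
    case 1
    then have "above n (H j) p q" using r' s' rs unfolding above_def by (intro exI[of _ r'] exI[of _ s']) auto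
    then show ?thesis ..
  next
    case 2
    have i: "r' \<in> {1..n}" using r' rs by auto
    have "V j r' = q \<and> (P (r', j) = Vertical \<or> P (r', j) = Crossing)" using s'(4)[of r'] 2 r' rs by auto
    then have "P (r', j) = Crossing \<and> V j r' = q \<and> H (j - 1) r' = p"
      using labelledD(3)[OF L j i] r' pq by auto
    moreover have "above n (H j) q p" using r' s' rs 2 unfolding above_def by (intro exI[of _ s'] exI[of _ r']) auto
    ultimately show ?thesis using i by blast
  qed
qed

lemma label_previous:
  assumes L: "labelled n m P H V" and j: "j \<in> {1..m}" and i: "i \<in> {1..n}"
    and p: "H j i = p" "p \<noteq> 0" "p \<noteq> j"
  obtains r where "r \<in> {1..n}" "H (j - 1) r = p"
proof (cases "P (i, j) = SE_elbow")
  case False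
  then have "H (j - 1) i = p" using labelledD(3)[OF L j i] p by (cases "P (i, j)") auto
  then show ?thesis using that i by blast
next
  case True
  then have v: "V j i = p" "i \<le> n" using labelledD(3)[OF L j i] p i by auto
  obtain q where "q = n \<and> p = j \<or> q < n \<and> P (Suc q, j) = NW_elbow \<and> H (j - 1) (Suc q) = p"
    using labelled_origin[OF L j v(2,1) p(2)] by metis
  then show ?thesis using that[of "Suc q"] p by auto
qed

text \<open>Pipe \<open>l\<close> starts at the bottom of column \<open>l\<close>, below the pipes
  already present. To get above the pipe \<open>s\<close> it must cross it, either in its own column
  or in a later one where the order of the two changes.\<close>

lemma inverted_crosses:
  assumes L: "labelled n m P H V" and s: "s \<noteq> 0"
  shows "j \<le> m \<Longrightarrow> s < l \<Longrightarrow> l \<le> j \<Longrightarrow> above n (H j) l s \<Longrightarrow>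
    \<exists>j'\<in>{1..j}. \<exists>i\<in>{1..n}. P (i, j') = Crossing \<and>
      (V j' i = l \<and> H (j' - 1) i = s \<or> V j' i = s \<and> H (j' - 1) i = l)"
proof (induction j)
  case 0
  then show ?case by simp
next
  case (Suc j)
  have j: "Suc j \<in> {1..m}" using Suc.prems by simp
  obtain x r where xr: "1 \<le> x" "x < r" "r \<le> n" "H (Suc j) x = l" "H (Suc j) r = s"
    using Suc.prems(4) by (auto simp: above_def)
  have l: "l \<noteq> 0" using Suc.prems by simp
  have rn: "r \<in> {1..n}" "x \<in> {1..n}" using xr by auto
  show ?case
  proof (cases "l = Suc j")
    case True
    have vn: "V (Suc j) n = l" using labelledD(1)[OF L j] True by simp
    obtain p where p: "1 \<le> p" "p \<le> n" "H (Suc j) p = l" "\<And>i. p \<le> i \<Longrightarrow> i \<le> n \<Longrightarrow> V (Suc j) i = l"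
      "\<And>i. p < i \<Longrightarrow> i \<le> n \<Longrightarrow> P (i, Suc j) = Vertical \<or> P (i, Suc j) = Crossing"
      using labelled_run[OF L j order_refl vn l] by metis
    have "p = x" using labelled_inj[OF L Suc.prems(1), of p x] p xr l by auto
    then have "V (Suc j) r = l \<and> (P (r, Suc j) = Vertical \<or> P (r, Suc j) = Crossing)"
      using p(4)[of r] p(5)[of r] xr by auto
    then have "P (r, Suc j) = Crossing \<and> V (Suc j) r = l \<and> H (Suc j - 1) r = s"
      using labelledD(3)[OF L j rn(1)] xr s by auto
    then show ?thesis using rn by (intro bexI[of _ "Suc j"] bexI[of _ r]) auto
  next
    case False
    obtain x' where x': "x' \<in> {1..n}" "H j x' = l"
      using label_previous[OF L j rn(2) xr(4) l False] by auto
    have "s \<noteq> Suc j" using Suc.prems by simp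
    then obtain r' where r': "r' \<in> {1..n}" "H j r' = s"
      using label_previous[OF L j rn(1) xr(5) s] by auto
    have "x' \<noteq> r'" using x' r' Suc.prems by auto
    then consider "above n (H j) l s" | "above n (H j) s l"
      using x' r' unfolding above_def by (metis atLeastAtMost_iff linorder_neqE_nat)
    then show ?thesis
    proof cases
      case 1
      then have "\<exists>j'\<in>{1..j}. \<exists>i\<in>{1..n}. P (i, j') = Crossing \<and>
        (V j' i = l \<and> H (j' - 1) i = s \<or> V j' i = s \<and> H (j' - 1) i = l)"
        using Suc.IH Suc.prems False by auto
      then show ?thesis by (meson atLeastAtMost_iff le_SucI)
    next
      case 2
      then have "\<exists>i\<in>{1..n}. P (i, Suc j) = Crossing \<and> V (Suc j) i = l \<and> H (Suc j - 1) i = s"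
        using above_change[OF L j s l] above_asym[OF L Suc.prems(1) s l _ Suc.prems(4)] by auto
      then obtain i where "i \<in> {1..n}" "P (i, Suc j) = Crossing \<and> V (Suc j) i = l \<and> H (Suc j - 1) i = s" by blast
      then show ?thesis by (intro bexI[of _ "Suc j"] bexI[of _ i]) auto
    qed
  qed
qed

text \<open>A vertical pipe that did not start in this column entered it through an NW elbow further
  down, so to the left of the column it was below the pipe coming from the west.\<close>

lemma crossing_south_label:
  assumes L: "labelled n m P H V" and j: "j \<in> {1..m}" and i: "i \<in> {1..n}"
    and c: "P (i, j) = Crossing" "V j i = q" "q \<noteq> j"
  shows "above n (H (j - 1)) (H (j - 1) i) q"
proof -
  have q: "q \<noteq> 0" "i \<le> n" using labelledD(3)[OF L j i] c i by auto
  obtain r where r: "i \<le> r" "r = n \<and> q = j \<or> r < n \<and> P (Suc r, j) = NW_elbow \<and> H (j - 1) (Suc r) = q"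
    using labelled_origin[OF L j q(2) c(2) q(1)] by metis
  then show ?thesis using c i unfolding above_def by (intro exI[of _ i] exI[of _ "Suc r"]) auto
qed

text \<open>If the horizontal label were not the smaller one, it would belong to a larger label
  above a smaller one to the left of the column. By \<open>inverted_crosses\<close> the two pipes
  would have crossed in an earlier column already.\<close>

lemma good_if_once:
  assumes L: "labelled n n P H V"
    and once: "\<forall>p\<in>{1..n}. \<forall>q\<in>{1..n}. p \<noteq> q \<longrightarrow>
        (\<forall>c d. pipes_cross_at n P p q c \<and> pipes_cross_at n P p q d \<longrightarrow> c = d)"
  shows "good_crossings n n P H V"
  unfolding good_crossings_def
proof (intro ballI impI)
  fix j i assume j: "j \<in> {1..n}" and i: "i \<in> {1..n}" and c: "P (i, j) = Crossing"
  define s where "s = V j i"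
  define l where "l = H (j - 1) i"
  have jm: "j - 1 \<le> n" using j by auto
  have nz: "s \<noteq> 0" "l \<noteq> 0" using labelledD(3)[OF L j i] c by (auto simp: s_def l_def)
  have lj: "l \<le> j - 1" using labelled_bound[OF L jm i] by (simp add: l_def)
  show "H (j - 1) i < V j i"
  proof (rule ccontr)
    assume "\<not> H (j - 1) i < V j i"
    then have sl: "s \<le> l" by (simp add: s_def l_def)
    then have sj: "s \<noteq> j" using lj j by auto
    then have ab: "above n (H (j - 1)) l s" using crossing_south_label[OF L j i c] by (simp add: s_def l_def)
    then have "s \<noteq> l" using above_asym[OF L jm nz(2,1)] by auto
    then have "s < l" using sl by simp
    then obtain j' i' where j': "j' \<in> {1..j - 1}" "i' \<in> {1..n}" "P (i', j') = Crossing"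
       "V j' i' = l \<and> H (j' - 1) i' = s \<or> V j' i' = s \<and> H (j' - 1) i' = l"
      using inverted_crosses[OF L nz(1) jm _ lj ab] by blast
    have "pipes_cross_at n P l s (i', j')" using j' jm by (auto simp: pipes_cross_iff[OF L])
    moreover have "pipes_cross_at n P l s (i, j)"
      using i j c by (auto simp: pipes_cross_iff[OF L] s_def l_def)
    moreover have "l \<in> {1..n}" "s \<in> {1..n}" using nz lj sl jm by auto
    ultimately have "(i', j') = (i, j)" using once[rule_format, of l s "(i', j')" "(i, j)"] \<open>s \<noteq> l\<close> by blast
    then show False using j' by auto
  qed
qed

text \<open>After a crossing the larger label is above the smaller one, and only a crossing with the
  larger label horizontal could undo this. But another crossing in a later column needs the larger
  label to be the lower one.\<close>

lemma once_if_good_less: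
  assumes L: "labelled n n P H V" and good: "good_crossings n n P H V" and pq: "p < q"
    and c: "pipes_cross_at n P p q (i, j)" and d: "pipes_cross_at n P p q (i', j')" and jj: "j \<le> j'"
  shows "(i, j) = (i', j')"
proof -
  have cr: "V j i = q \<and> H (j - 1) i = p \<and> p \<noteq> 0"
    if "pipes_cross_at n P p q (i, j)" for i j
  proof -
    have c: "i \<in> {1..n}" "j \<in> {1..n}" "P (i, j) = Crossing"
      "V j i = p \<and> H (j - 1) i = q \<or> V j i = q \<and> H (j - 1) i = p"
      using that by (auto simp: pipes_cross_iff[OF L])
    moreover have "H (j - 1) i < V j i" using good c by (auto simp: good_crossings_def)
    ultimately show ?thesis using labelledD(3)[OF L c(2,1)] pq by auto
  qed
  have c': "i \<in> {1..n}" "j \<in> {1..n}" "P (i, j) = Crossing" and d': "i' \<in> {1..n}" "j' \<in> {1..n}" "P (i', j') = Crossing"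
    using c d by (auto simp: pipes_cross_iff[OF L])
  have nz: "p \<noteq> 0" "q \<noteq> 0" using cr[OF c] pq by auto
  show ?thesis
  proof (cases "j = j'")
    case True
    have "j - 1 \<le> n" using c' by auto
    then have "i = i'" using labelled_inj[OF L, of "j - 1" i i'] cr[OF c] cr[OF d] True c' d' by auto
    then show ?thesis using True by simp
  next
    case False
    have t: "tile_ok (P (i, j)) (H (j - 1) i) (V j i) (H j i) (V j (i - 1))"
      using labelledD(3)[OF L] c' by blast
    then have hp: "H j i = p" and vq: "V j (i - 1) = q" using cr[OF c] c' by auto
    have "i - 1 \<le> n" using c' by auto
    then obtain r where "1 \<le> r" "r \<le> i - 1" "H j r = q"
      using labelled_run[OF L c'(2) _ vq nz(2)] by metis
    then have ab: "above n (H j) q p" using hp c' unfolding above_def by (intro exI[of _ r] exI[of _ i]) auto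
    have stay: "above n (H (j + k)) q p" if "j + k \<le> n" for k
      using that
    proof (induction k)
      case 0 then show ?case using ab by simp
    next
      case (Suc k)
      have j1: "j + Suc k \<in> {1..n}" using Suc.prems by simp
      have "\<not> (\<exists>i\<in>{1..n}. P (i, j + Suc k) = Crossing \<and> V (j + Suc k) i = p \<and> H (j + Suc k - 1) i = q)"
        using good j1 pq by (force simp: good_crossings_def)
      then show ?case using above_change[OF L j1 nz(2,1)] Suc by auto
    qed
    have "j + (j' - 1 - j) = j' - 1" "j' - 1 \<le> n" using False jj d' by auto
    then have ab': "above n (H (j' - 1)) q p" using stay[of "j' - 1 - j"] by simp
    have "q \<le> j" using labelled_V_bound[OF L c'(2), of i] cr[OF c] c' by auto
    then have "q \<noteq> j'" using False jj by simp
    then have "above n (H (j' - 1)) p q" using crossing_south_label[OF L d'(2,1,3)] cr[OF d] by auto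
    then show ?thesis using above_asym[OF L \<open>j' - 1 \<le> n\<close> nz(2,1) ab'] by simp
  qed
qed

lemma once_if_good:
  assumes L: "labelled n n P H V" and good: "good_crossings n n P H V" and pq: "p \<noteq> q"
    and c: "pipes_cross_at n P p q c" and d: "pipes_cross_at n P p q d"
  shows "c = d"
proof -
  have sym: "pipes_cross_at n P p q c = pipes_cross_at n P q p c" for p q c by (auto simp: pipes_cross_at_def)
  obtain i j i' j' where [simp]: "c = (i, j)" "d = (i', j')" by (cases c; cases d)
  have *: "(i, j) = (i', j')" if "p < q" "pipes_cross_at n P p q (i, j)" "pipes_cross_at n P p q (i', j')" for p q
    using once_if_good_less[OF L good that(1,2,3)] once_if_good_less[OF L good that(1,3,2)]
    by (cases "j \<le> j'") auto
  show ?thesis using *[of p q] *[of q p] c d pq sym by (cases "p < q") auto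
qed

section \<open>Pipedreams as labelled tilings, and the shape of their empty squares\<close>

lemma square_bumpless_pipedream_iff:
  assumes w: "w permutes {1..n}"
  shows "square_bumpless_pipedream n w P \<longleftrightarrow> P \<in> ({1..n} \<times> {1..n}) \<rightarrow>\<^sub>E UNIV \<and>
    (\<exists>H V. labelled n n P H V \<and> good_crossings n n P H V \<and> (\<forall>i\<in>{1..n}. H n i = w i))"
    (is "?l \<longleftrightarrow> ?r")
proof
  assume sq: ?l
  note sq' = sq[unfolded square_bumpless_pipedream_def]
  note pt = sq'[THEN conjunct1] and ex = sq'[THEN conjunct2, THEN conjunct1, rule_format]
  obtain H V where L: "labelled n n P H V" using pipe_tiling_labelled[OF pt] .
  have "H n i = w i" if i: "i \<in> {1..n}" for i
  proof -
    have wi: "w i \<in> {1..n}" "inv w (w i) = i" using permutes_in_image[OF w] i permutes_inverses(2)[OF w] by auto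
    then show ?thesis using ex[OF wi(1)] pipe_exits_iff[OF L i] by auto
  qed
  moreover have "good_crossings n n P H V"
    by (rule good_if_once[OF L sq'[THEN conjunct2, THEN conjunct2]])
  moreover have "P \<in> ({1..n} \<times> {1..n}) \<rightarrow>\<^sub>E UNIV" using pt by (auto simp: pipe_tiling_def)
  ultimately show ?r using L by blast
next
  assume ?r
  then obtain H V where ext: "P \<in> ({1..n} \<times> {1..n}) \<rightarrow>\<^sub>E UNIV" and L: "labelled n n P H V"
    and good: "good_crossings n n P H V" and R: "\<And>i. i \<in> {1..n} \<Longrightarrow> H n i = w i" by blast
  have "w i \<noteq> 0" if "i \<in> {1..n}" for i using permutes_in_image[OF w, of i] that by auto
  then have "pipe_tiling n P" using labelled_pipe_tiling[OF ext L] R by auto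
  moreover have "pipe_exits_at_row n P p (inv w p)" if p: "p \<in> {1..n}" for p
  proof -
    have "inv w p \<in> {1..n}" "w (inv w p) = p"
      using permutes_in_image[OF permutes_inv[OF w]] p permutes_inverses(1)[OF w] by auto
    then show ?thesis using pipe_exits_iff[OF L] R p by auto
  qed
  ultimately show ?l
    unfolding square_bumpless_pipedream_def
    by (intro conjI ballI impI allI) (auto dest: once_if_good[OF L good])
qed

text \<open>Above and in row \<open>i\<close>, column \<open>j + 1\<close> is empty, so no pipe
  leaves column \<open>j\<close> there. Then no pipe goes north or east out of
  \<open>(i, j)\<close>, and a tile without such an end is empty.\<close>

lemma empty_left:
  assumes L: "labelled n m P H V" and top: "top_empty n m P"
    and j: "Suc j \<in> {1..m}" "1 \<le> j" and i: "i \<in> {1..n}" and e: "P (i, Suc j) = Empty"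
  shows "P (i, j) = Empty"
proof -
  have H0: "H j i' = 0" if "i' \<in> {1..i}" for i'
  proof -
    have "P (i', Suc j) = Empty" using top[unfolded top_empty_def, rule_format, OF j(1) i e that] .
    moreover have "i' \<in> {1..n}" using that i by auto
    ultimately show ?thesis using labelledD(3)[OF L j(1), of i'] by simp
  qed
  have jm: "j \<in> {1..m}" using j by auto
  have t: "tile_ok (P (i, j)) (H (j - 1) i) (V j i) (H j i) (V j (i - 1))" using labelledD(3)[OF L jm i] .
  have "V j (i - 1) = 0"
  proof (rule ccontr)
    assume nz: "V j (i - 1) \<noteq> 0"
    have "i - 1 \<le> n" using i by auto
    from labelled_run[OF L jm this refl nz] obtain p where "1 \<le> p" "p \<le> i - 1" "H j p = V j (i - 1)" by metis
    then show False using H0[of p] nz by auto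
  qed
  then show ?thesis using t H0[of i] i by (cases "P (i, j)") auto
qed

lemma eg_tiling_empty_iff:
  assumes P: "P \<in> eg_tilings n m R" and ij: "i \<in> {1..n}" "j \<in> {1..m}"
  shows "P (i, j) = Empty \<longleftrightarrow> i \<le> height n m P j"
proof -
  have top: "top_empty n m P" using P by (auto simp: eg_tilings_def)
  let ?E = "{i \<in> {1..n}. P (i, j) = Empty}"
  have E: "?E = {1..card ?E}"
  proof (cases "?E = {}")
    case False
    define M where "M = Max ?E"
    have M: "M \<in> ?E" unfolding M_def by (rule Max_in) (use False in auto)
    have "?E = {1..M}"
    proof
      show "?E \<subseteq> {1..M}"
      proof
        fix i assume i: "i \<in> ?E"
        then have "i \<le> M" unfolding M_def by (intro Max_ge) auto
        then show "i \<in> {1..M}" using i by auto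
      qed
      show "{1..M} \<subseteq> ?E"
        using top[unfolded top_empty_def, rule_format, OF ij(2), of M] M by auto
    qed
    then show ?thesis by simp
  qed auto
  have "P (i, j) = Empty \<longleftrightarrow> i \<in> ?E" using ij by simp
  also have "\<dots> \<longleftrightarrow> i \<le> card ?E" by (subst E) (use ij in auto)
  finally show ?thesis using ij by (simp add: height_def)
qed

lemma height_antimono:
  assumes P: "P \<in> eg_tilings n m R" and j: "1 \<le> j"
  shows "height n m P (Suc j) \<le> height n m P j"
proof (cases "Suc j \<le> m \<and> height n m P (Suc j) \<noteq> 0")
  case True
  obtain H V where L: "labelled n m P H V" and top: "top_empty n m P"
    using P by (auto simp: eg_tilings_def)
  let ?i = "height n m P (Suc j)"
  have "card {i \<in> {1..n}. P (i, Suc j) = Empty} \<le> card {1..n}" by (intro card_mono) auto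
  then have i: "?i \<in> {1..n}" using True by (auto simp: height_def)
  have "P (?i, Suc j) = Empty" using eg_tiling_empty_iff[OF P i, of "Suc j"] True by simp
  then have "P (?i, j) = Empty" using empty_left[OF L top _ j i] True by simp
  then show ?thesis using eg_tiling_empty_iff[OF P i, of j] True j by simp
next
  case False
  then have "height n m P (Suc j) = 0"
    by (cases "Suc j \<le> m") (simp, simp add: height_def)
  then show ?thesis by simp
qed

section \<open>Expansion of Stanley coefficients\<close>

text \<open>The right border described by \<open>w\<close>: nonpositive labels and labels above
  \<open>j\<close> mean that no pipe leaves the row.\<close>

definition rows :: "nat \<Rightarrow> (int \<Rightarrow> int) \<Rightarrow> nat \<Rightarrow> nat" where
  "rows j w i = (if 1 \<le> w (int i) \<and> w (int i) \<le> int j then nat (w (int i)) else 0)"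

lemma eg_tilings_cong:
  assumes "\<And>i. i \<in> {1..n} \<Longrightarrow> R i = R' i"
  shows "eg_tilings n m R = eg_tilings n m R'"
  unfolding eg_tilings_def using assms by auto

lemma eg_tilings_0:
  assumes "\<And>i. i \<in> {1..n} \<Longrightarrow> R i = 0"
  shows "eg_tilings n 0 R = {\<lambda>_. undefined}"
proof -
  have "(\<lambda>_. undefined) \<in> eg_tilings n 0 R"
    by (rule eg_tilingsI[of _ _ _ "\<lambda>_ _. 0" "\<lambda>_ _. 0"])
      (use assms in \<open>auto simp: labelled_def good_crossings_def top_empty_def\<close>)
  then show ?thesis by (auto simp: eg_tilings_def)
qed

text \<open>The column heights of a shape are indexed from \<open>0\<close>, the columns of a tiling from \<open>1\<close>.\<close>

definition heights_then :: "nat \<Rightarrow> (nat \<Rightarrow> nat) \<Rightarrow> (nat \<Rightarrow> nat) \<Rightarrow> nat \<Rightarrow> nat" where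
  "heights_then j \<mu> ht i = (if i < j then ht (i + 1) else \<mu> (i - j))"

text \<open>Both sides obey the same recursions. The outer induction is on the number
  \<open>j\<close> of columns left, the inner one on the row of label \<open>j\<close>, which every
  transition moves up.\<close>

lemma state_expansion:
  assumes "state n j \<mu> w"
  shows "peel_sym n es w = (\<Sum>P\<in>eg_tilings n j (rows j w). kostka (heights_then j \<mu> (height n j P)) es)"
  using assms
proof (induction j arbitrary: \<mu> w)
  case 0
  have "rows 0 w i = 0" for i by (auto simp: rows_def)
  then show ?case
    using peel_sym_grassmannian[OF 0] by (simp add: eg_tilings_0 heights_then_def)
next
  case (Suc j')
  define j where "j = Suc j'"
  have IHj: "peel_sym n es w = (\<Sum>P\<in>eg_tilings n (j - 1) (rows (j - 1) w). kostka (heights_then (j - 1) \<mu> (height n (j - 1) P)) es)"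
    if "state n (j - 1) \<mu> w" for \<mu> w using Suc.IH that by (simp add: j_def)
  have "peel_sym n es w = (\<Sum>P\<in>eg_tilings n j (rows j w). kostka (heights_then j \<mu> (height n j P)) es)"
    if "state n j \<mu> w" "w x = int j" for x w
    using that
  proof (induction "nat x" arbitrary: x w rule: less_induct)
    case less
    note st = less.prems(1) and wx = less.prems(2)
    have j: "1 \<le> j" by (simp add: j_def)
    have w: "w permutes {- int n..int n}" and jn: "j \<le> n" and am: "antimono \<mu>"
      and pad: "\<And>i. i \<le> n \<Longrightarrow> w (int (\<mu> i) - int i) = - int i"
      and inc: "\<And>x y. x < y \<Longrightarrow> int j < w x \<Longrightarrow> int j < w y \<Longrightarrow> w x < w y"
      and up: "\<And>x. 1 \<le> w x \<Longrightarrow> w x \<le> int j \<Longrightarrow> int (\<mu> 0) < x"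
      using st by (auto simp: state_def)
    have inj: "p = q" if "w p = w q" for p q using permutes_inj[OF w] that by (auto simp: inj_def)
    have rng: "z \<in> {- int n..int n} \<longleftrightarrow> w z \<in> {- int n..int n}" for z
      using permutes_in_image[OF w] by blast
    have low: "z \<le> int (\<mu> 0)" if "w z \<le> 0" "- int n \<le> w z" for z
    proof -
      define i where "i = nat (- w z)"
      have i: "w z = - int i" "i \<le> n" using that by (auto simp: i_def)
      then have "z = int (\<mu> i) - int i" using inj pad by simp
      then show ?thesis using antimonoD[OF am, of 0 i] by simp
    qed
    have pos: "1 \<le> w z" if "int (\<mu> 0) < z" "z \<le> int n" for z
    proof (rule ccontr)
      assume "\<not> 1 \<le> w z"
      moreover have "- int n \<le> w z" using rng[of z] that by auto
      ultimately show False using low[of z] that by auto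
    qed
    have x0: "int (\<mu> 0) < x" using up[of x] wx j by simp
    have xn: "x \<le> int n" using rng[of x] wx jn by auto
    define R where "R = rows j w"
    have Rinj: "i = i'" if "R i = R i'" "R i \<noteq> 0" for i i'
    proof -
      have "w (int i) = w (int i')" using that by (auto simp: R_def rows_def split: if_splits)
      then show ?thesis using inj by fastforce
    qed
    have Rx: "R (nat x) = j" using x0 wx j by (auto simp: R_def rows_def)
    have xnat: "nat x \<in> {1..n}" "int (nat x) = x" using x0 xn by auto
    show ?case
    proof (cases "\<exists>c z. c < x \<and> int j < w c \<and> z < c \<and> 1 \<le> w z \<and> w z \<le> int j")
      case True
      \<comment> \<open>The empty rows above \<open>x\<close> that have a pipe leaving above them;
        the transition is taken at the lowest of these rows, as in \<open>droop\<close>.\<close>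
      define C where "C = {c. c < x \<and> int j < w c \<and> (\<exists>z<c. 1 \<le> w z \<and> w z \<le> int j)}"
      have Csub: "C \<subseteq> {0..x}" using up by (force simp: C_def)
      then have "finite C" using finite_subset by blast
      moreover have "C \<noteq> {}" using True by (auto simp: C_def)
      ultimately have MC: "Max C \<in> C" "\<And>c. c \<in> C \<Longrightarrow> c \<le> Max C" by auto
      define c where "c = Max C"
      obtain z0 where c: "c < x" "int j < w c" and z0: "z0 < c" "1 \<le> w z0" "w z0 \<le> int j"
        using MC(1)[folded c_def] unfolding C_def by blast
      have nh: "w z \<le> int j" if "c < z" "z < x" for z
      proof (rule ccontr)
        assume "\<not> w z \<le> int j"
        then have "z \<in> C" using that z0 by (auto simp: C_def intro!: exI[of _ z0])
        then show False using MC(2)[of z] that by (simp add: c_def)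
      qed
      have z0x: "w z0 < int j" using z0 c inj[of z0 x] wx by (cases "w z0 = int j") auto
      have c0: "int (\<mu> 0) < c" using up[OF z0(2,3)] z0 by simp
      have cnat: "int (nat c) = c" "1 \<le> nat c" "nat c < nat x" using c0 c by auto
      interpret dr: droop n j "nat c" "nat x" R
      proof
        show "R (nat c) = 0" using c c0 by (auto simp: R_def rows_def)
        fix z assume "nat c < z" "z < nat x"
        then have z: "c < int z" "int z < x" using c0 by auto
        then show "R z \<noteq> 0" using nh[OF z] pos[of "int z"] c0 xn by (auto simp: R_def rows_def)
      next
        have "0 < z0" using up[OF z0(2,3)] by simp
        then show "\<exists>z\<in>{1..<nat c}. R z \<noteq> 0"
          using z0 by (intro bexI[of _ "nat z0"]) (auto simp: R_def rows_def)
      qed (use j xnat Rx cnat Rinj in auto)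
      define Y where "Y = {y. - int n - 1 < y \<and> y < c \<and> w y < int j \<and> (\<forall>z. y < z \<and> z < c \<longrightarrow> \<not> (w y < w z \<and> w z < int j))}"
      have ltj: "w z < int j" if "w z \<le> int j" "z < c" for z using that inj[of z x] c wx by (cases "w z = int j") auto
      \<comment> \<open>The terms on the two sides correspond. A row with a nonpositive label gives
        no term, since it lies above \<open>z0\<close>, which blocks it.\<close>
      have Y: "Y = int ` movable R (nat c)"
      proof (intro set_eqI iffI)
        fix y assume "y \<in> Y"
        then have y: "- int n \<le> y" "y < c" "w y < int j" and ymax: "\<And>z. y < z \<Longrightarrow> z < c \<Longrightarrow> \<not> (w y < w z \<and> w z < int j)"
          by (auto simp: Y_def)
        have wy: "1 \<le> w y"
        proof (rule ccontr)
          assume neg: "\<not> 1 \<le> w y"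
          have "- int n \<le> w y" using rng[of y] y c xn by auto
          then have "y \<le> int (\<mu> 0)" using low[of y] neg by simp
          then have "y < z0" using up[OF z0(2,3)] by simp
          then show False using ymax[of z0] z0 z0x neg by simp
        qed
        then have y0: "0 < y" using up[of y] y by simp
        have "nat y \<in> movable R (nat c)"
          unfolding movable_def
        proof (intro CollectI conjI allI impI)
          show "nat y \<in> {1..<nat c}" using y0 y by auto
          show "R (nat y) \<noteq> 0" using y0 wy y by (auto simp: R_def rows_def)
          fix z assume z: "nat y < z \<and> z < nat c"
          then have z': "y < int z" "int z < c" using y0 by auto
          have "w (int z) \<noteq> w y" using inj[of "int z" y] z' by auto
          then show "R z < R (nat y)" using ymax[OF z'] ltj[of "int z"] z' y0 wy y by (auto simp: R_def rows_def)
        qed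
        then show "y \<in> int ` movable R (nat c)" using y0 by (intro image_eqI[of _ _ "nat y"]) auto
      next
        fix y assume "y \<in> int ` movable R (nat c)"
        then obtain y' where y': "y = int y'" "y' \<in> movable R (nat c)" by auto
        then have yc: "1 \<le> y'" "int y' < c" "R y' \<noteq> 0" "\<And>z. y' < z \<Longrightarrow> z < nat c \<Longrightarrow> R z < R y'"
          by (auto simp: movable_def)
        have wy: "1 \<le> w y" "w y \<le> int j" using yc(3) y' by (auto simp: R_def rows_def split: if_splits)
        have "\<not> (w y < w z \<and> w z < int j)" if z: "y < z" "z < c" for z
        proof
          assume a: "w y < w z \<and> w z < int j"
          have "R (nat z) < R y'" using yc(4)[of "nat z"] z y' by auto
          then show False using a wy y' z by (auto simp: R_def rows_def split: if_splits)
        qed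
        then show "y \<in> Y" using yc wy y' ltj[of y] by (auto simp: Y_def)
      qed
      have "peel_sym n es w = (\<Sum>y\<in>Y. peel_sym n es (cyc w c x y))"
        unfolding Y_def
      proof (rule transition_step)
        show "w permutes {- int n - 1 + 1..int n}" using w by simp
        show "\<exists>z>- int n - 1. z < c \<and> - int n - 1 < w z \<and> w z < int j"
          using up[OF z0(2,3)] z0 z0x by (intro exI[of _ z0]) auto
      qed (use wx jn j inc c c0 nh in auto)
      also have "\<dots> = (\<Sum>y\<in>movable R (nat c). peel_sym n es (cyc w c x (int y)))"
        unfolding Y by (subst sum.reindex) (auto simp: inj_on_def)
      also have "\<dots> = (\<Sum>y\<in>movable R (nat c). \<Sum>P\<in>eg_tilings n j (rot j (nat c) (nat x) y R).
         kostka (heights_then j \<mu> (height n j P)) es)"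
      proof (rule sum.cong[OF refl])
        fix y assume y: "y \<in> movable R (nat c)"
        then have yc: "1 \<le> y" "int y < c" "R y \<noteq> 0" by (auto simp: movable_def)
        have wy: "1 \<le> w (int y)" "w (int y) < int j"
          using yc ltj[of "int y"] by (auto simp: R_def rows_def split: if_splits)
        have ca: "cyc w c x (int y) z = (if z = c then w (int y) else if z = int y then w x else if z = x then w c else w z)" for z
          by (rule cyc_apply) (use c yc in auto)
        have "peel_sym n es (cyc w c x (int y)) =
          (\<Sum>P\<in>eg_tilings n j (rows j (cyc w c x (int y))). kostka (heights_then j \<mu> (height n j P)) es)"
        proof (rule less.hyps)
          show "nat (int y) < nat x" using yc c by auto
          show "state n j \<mu> (cyc w c x (int y))"
            by (rule state_cyc[OF st wx c yc(2) wy c0 nh])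
          show "cyc w c x (int y) (int y) = int j" using yc c wx by (auto simp: ca)
        qed
        also have "eg_tilings n j (rows j (cyc w c x (int y))) = eg_tilings n j (rot j (nat c) (nat x) y R)"
        proof (rule eg_tilings_cong)
          fix i
          have ii: "int i = c \<longleftrightarrow> i = nat c" "int i = x \<longleftrightarrow> i = nat x" using cnat xnat by auto
          have ne: "nat c \<noteq> nat x" "y \<noteq> nat c" "y \<noteq> nat x" using cnat yc by auto
          show "rows j (cyc w c x (int y)) i = rot j (nat c) (nat x) y R i"
            using wy wx c j ne unfolding rows_def ca ii rot_def by (auto simp: R_def rows_def)
        qed
        finally show "peel_sym n es (cyc w c x (int y)) = (\<Sum>P\<in>eg_tilings n j (rot j (nat c) (nat x) y R).
         kostka (heights_then j \<mu> (height n j P)) es)" .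
      qed
      also have "\<dots> = (\<Sum>P\<in>eg_tilings n j R. kostka (heights_then j \<mu> (height n j P)) es)"
        by (rule dr.sum_eg_tilings_droop[symmetric])
      finally show ?thesis unfolding R_def .
    next
      case False
      \<comment> \<open>All empty rows above \<open>x\<close> are above the topmost pipe, which
        leaves in row \<open>Min S\<close>. So \<open>h = Min S - 1\<close> is the height of column
        \<open>j\<close>, and the column is removed from the tilings and absorbed in the
        permutation.\<close>
      define S where "S = {z. 1 \<le> w z \<and> w z \<le> int j}"
      have Ssub: "S \<subseteq> {1..int n}"
      proof
        fix z assume "z \<in> S"
        then have z: "1 \<le> w z" "w z \<le> int j" by (auto simp: S_def)
        then show "z \<in> {1..int n}" using up[OF z] rng[of z] jn by auto
      qed
      then have "finite S" using finite_subset by blast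
      moreover have xS: "x \<in> S" using wx j by (simp add: S_def)
      ultimately have MS: "Min S \<in> S" "\<And>z. z \<in> S \<Longrightarrow> Min S \<le> z"
        using Min_in[of S] Min_le[of S] by blast+
      define h where "h = nat (Min S - 1)"
      have h1: "int h = Min S - 1" using MS(1) Ssub by (auto simp: h_def)
      have hx: "int h < x" using MS(2)[OF xS] h1 by simp
      have uph: "int h < z" if "1 \<le> w z" "w z \<le> int j" for z
        using MS(2)[of z] that h1 by (simp add: S_def)
      have nh: "w z \<le> int j" if "int h < z" "z < x" for z
      proof (cases "z = Min S")
        case True
        then show ?thesis using MS(1) by (simp add: S_def)
      next
        case ne: False
        then have "Min S < z" using that h1 by simp
        then show ?thesis using False that MS(1) unfolding S_def by (metis (mono_tags, lifting) mem_Collect_eq not_less)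
      qed
      have muh: "\<mu> 0 \<le> h" using up[of "Min S"] MS(1) h1 by (auto simp: S_def)
      obtain w' where st': "state n (j - 1) (case_nat h \<mu>) w'" and F: "peel_sym n es w' = peel_sym n es w"
        and same: "\<And>z. 1 \<le> w z \<Longrightarrow> w z < int j \<Longrightarrow> w' z = w z"
        using absorb_column[OF st j wx hx muh uph nh] by metis
      have w': "w' permutes {- int n..int n}" using st' by (simp add: state_def)
      have same': "w z = w' z" if "1 \<le> w' z" "w' z < int j" for z
      proof -
        obtain z' where z': "w z' = w' z" using permutes_surj[OF w] by (metis surjD)
        then have "w' z' = w' z" using same[of z'] that by simp
        then have "z' = z" using permutes_inj[OF w'] by (simp add: inj_eq)
        then show ?thesis using z' by simp
      qed
      interpret dc: drop_column n j h "nat x" R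
      proof
        fix z assume z: "z \<in> {1..h}"
        have "\<not> int h < int z" using z by simp
        then have "\<not> (1 \<le> w (int z) \<and> w (int z) \<le> int j)" using uph[of "int z"] by blast
        then show "R z = 0" by (auto simp: R_def rows_def)
      next
        fix z assume "h < z" "z < nat x"
        then have z: "int h < int z" "int z < x" by auto
        then have "1 \<le> w (int z)" using pos[of "int z"] muh xn by auto
        then show "R z \<noteq> 0" using nh[OF z] by (auto simp: R_def rows_def)
      qed (use j xnat Rx hx Rinj in auto)
      have eg: "eg_tilings n (j - 1) (rows (j - 1) w') = eg_tilings n (j - 1) (R(nat x := 0))"
      proof (rule eg_tilings_cong)
        fix i :: nat assume "i \<in> {1..n}"
        show "rows (j - 1) w' i = (R(nat x := 0)) i"
        proof (cases "1 \<le> w (int i) \<and> w (int i) < int j")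
          case True
          then have "i \<noteq> nat x" using wx xnat(2) by auto
          then show ?thesis using True same[of "int i"] by (auto simp: R_def rows_def)
        next
          case False
          then have "\<not> (1 \<le> w' (int i) \<and> w' (int i) < int j)" using same'[of "int i"] by auto
          then have "rows (j - 1) w' i = 0" by (auto simp: rows_def)
          moreover have "R i = 0 \<or> i = nat x"
            using False inj[of "int i" x] wx by (cases "w (int i) = int j") (auto simp: R_def rows_def)
          ultimately show ?thesis by auto
        qed
      qed
      \<comment> \<open>The last column of the tiling becomes the first of the stored
        columns.\<close>
      have ht: "heights_then j \<mu> (ht(j := h)) = heights_then (j - 1) (case_nat h \<mu>) ht" for ht
      proof
        fix i
        show "heights_then j \<mu> (ht(j := h)) i = heights_then (j - 1) (case_nat h \<mu>) ht i"
        proof (cases "i < j - 1 \<or> i = j - 1")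
          case True
          then show ?thesis using j by (auto simp: heights_then_def)
        next
          case False
          then have "i - (j - 1) = Suc (i - j)" "\<not> i < j" "\<not> i < j - 1" using j by auto
          then show ?thesis by (simp add: heights_then_def)
        qed
      qed
      have "(\<Sum>P\<in>eg_tilings n j R. kostka (heights_then j \<mu> (height n j P)) es) =
        (\<Sum>P\<in>eg_tilings n (j - 1) (R(nat x := 0)). kostka (heights_then j \<mu> ((height n (j - 1) P)(j := h))) es)"
        by (rule dc.sum_eg_tilings_drop)
      also have "\<dots> = peel_sym n es w" unfolding ht F[symmetric] IHj[OF st'] eg ..
      finally show ?thesis by (simp add: R_def)
    qed
  qed
  moreover obtain x where "w x = int j"
    using Suc.prems permutes_surj unfolding state_def by (metis surjD)
  ultimately show ?case using Suc.prems unfolding j_def by blast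
qed

section \<open>Reduced words\<close>

definition inversions :: "nat \<Rightarrow> (nat \<Rightarrow> nat) \<Rightarrow> nat" where
  "inversions n w = card {(x, y). x \<in> {1..n} \<and> y \<in> {1..n} \<and> x < y \<and> w y < w x}"

abbreviation nsw :: "nat \<Rightarrow> nat \<Rightarrow> nat" where
  "nsw a \<equiv> transpose a (a + 1)"

text \<open>Applying \<open>nsw a\<close> to both rows matches the inversions of the two
  permutations, apart from the pair \<open>(a, a + 1)\<close>.\<close>

lemma inversions_descent:
  assumes a: "a \<in> {1..<n}" and d: "w (a + 1) < w a"
  shows "inversions n w = Suc (inversions n (w \<circ> nsw a))"
proof -
  let ?I = "\<lambda>w. {(x, y). x \<in> {1..n} \<and> y \<in> {1..n} \<and> x < y \<and> w y < (w x :: nat)}"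
  let ?f = "map_prod (nsw a) (nsw a)"
  have fin: "finite (?I v)" for v by (rule finite_subset[of _ "{1..n} \<times> {1..n}"]) auto
  have inv: "?f (?f p) = p" for p by (cases p) simp
  have mem: "?f (x, y) \<in> ?I w \<and> ?f (x, y) \<noteq> (a, a + 1)" if "(x, y) \<in> ?I (w \<circ> nsw a)" for x y
  proof -
    have xy: "x \<in> {1..n}" "y \<in> {1..n}" "x < y" "w (nsw a y) < w (nsw a x)" using that by auto
    have "(x, y) \<noteq> (a, a + 1)" using xy d by auto
    then have "nsw a x < nsw a y" using xy(3) by (auto simp: transpose_def)
    moreover have "nsw a x \<in> {1..n}" "nsw a y \<in> {1..n}" using xy a by (auto simp: transpose_def)
    moreover have "(nsw a x, nsw a y) \<noteq> (a, a + 1)" using xy(3) by (auto simp: transpose_def split: if_splits)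
    ultimately show ?thesis using xy by auto
  qed
  have mem': "?f (x, y) \<in> ?I (w \<circ> nsw a)" if "(x, y) \<in> ?I w" "(x, y) \<noteq> (a, a + 1)" for x y
  proof -
    have xy: "x \<in> {1..n}" "y \<in> {1..n}" "x < y" "w y < w x" using that by auto
    have "nsw a x < nsw a y" using xy(3) that(2) by (auto simp: transpose_def)
    moreover have "nsw a x \<in> {1..n}" "nsw a y \<in> {1..n}" using xy a by (auto simp: transpose_def)
    ultimately show ?thesis using xy by simp
  qed
  have img: "?f ` ?I (w \<circ> nsw a) = ?I w - {(a, a + 1)}"
  proof
    show "?f ` ?I (w \<circ> nsw a) \<subseteq> ?I w - {(a, a + 1)}"
    proof (rule image_subsetI)
      fix p assume p: "p \<in> ?I (w \<circ> nsw a)"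
      obtain x y where xy: "p = (x, y)" by (cases p)
      show "?f p \<in> ?I w - {(a, a + 1)}" using mem[OF p[unfolded xy]] unfolding xy by (simp only: Diff_iff singleton_iff simp_thms)
    qed
    show "?I w - {(a, a + 1)} \<subseteq> ?f ` ?I (w \<circ> nsw a)"
    proof
      fix p assume p: "p \<in> ?I w - {(a, a + 1)}"
      obtain x y where xy: "p = (x, y)" by (cases p)
      have "?f p \<in> ?I (w \<circ> nsw a)" unfolding xy by (rule mem') (use p xy in auto)
      then have "?f (?f p) \<in> ?f ` ?I (w \<circ> nsw a)" by (rule imageI)
      then show "p \<in> ?f ` ?I (w \<circ> nsw a)" unfolding inv .
    qed
  qed
  have "inj_on ?f (?I (w \<circ> nsw a))" by (rule inj_on_inverseI[of _ ?f]) (rule inv)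
  from card_image[OF this] have cc: "card (?I (w \<circ> nsw a)) = card (?I w - {(a, a + 1)})"
    unfolding img ..
  have mem1: "(a, a + 1) \<in> ?I w" using a d by auto
  show ?thesis
    unfolding inversions_def cc by (rule card_Suc_Diff1[OF fin mem1, symmetric])
qed

lemma inversions_ascent:
  assumes a: "a \<in> {1..<n}" and d: "w a < w (a + 1)"
  shows "inversions n (w \<circ> nsw a) = Suc (inversions n w)"
  using inversions_descent[of a n "w \<circ> nsw a"] assms by (simp add: comp_assoc)

lemma permutes_nsw:
  "w permutes {1..n} \<Longrightarrow> a \<in> {1..<n} \<Longrightarrow> w \<circ> nsw a permutes {1..n}"
  by (rule permutes_compose[OF permutes_swap_id]) auto

lemma inversions_id [simp]: "inversions n id = 0"
  unfolding inversions_def by (intro card_eq_0_iff[THEN iffD2] disjI1) auto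

lemma word_perm_snoc: "word_perm (as @ [a]) = word_perm as \<circ> nsw a"
  unfolding word_perm_def by (induction as) (auto simp: comp_assoc)

lemma word_perm_bound:
  "set as \<subseteq> {1..<n} \<Longrightarrow> word_perm as permutes {1..n} \<and> inversions n (word_perm as) \<le> length as"
proof (induction as rule: rev_induct)
  case Nil
  show ?case by (simp add: word_perm_def id_def[symmetric] permutes_id)
next
  case (snoc a as)
  then have a: "a \<in> {1..<n}" and p: "word_perm as permutes {1..n}"
    and l: "inversions n (word_perm as) \<le> length as" by auto
  have "word_perm as a \<noteq> word_perm as (a + 1)" using permutes_inj[OF p] by (simp add: inj_eq)
  then consider "word_perm as (a + 1) < word_perm as a" | "word_perm as a < word_perm as (a + 1)" by linarith
  then have "inversions n (word_perm as \<circ> nsw a) \<le> length (as @ [a])"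
    by cases (use inversions_descent[OF a] inversions_ascent[OF a] l in auto)
  then show ?case using permutes_nsw[OF p a] unfolding word_perm_snoc by blast
qed

section \<open>Reduced words and permutations of the integers\<close>

definition ext_int :: "(nat \<Rightarrow> nat) \<Rightarrow> int \<Rightarrow> int" where
  "ext_int w x = (if 0 < x then int (w (nat x)) else x)"

lemma ext_int_permutes:
  assumes w: "w permutes {1..n}"
  shows "ext_int w permutes {0 + 1..int n}"
proof (rule bij_imp_permutes)
  have r: "ext_int w x \<in> {0 + 1..int n}" if "x \<in> {0 + 1..int n}" for x
    using permutes_in_image[OF w, of "nat x"] that by (auto simp: ext_int_def)
  have inj: "inj_on (ext_int w) {0 + 1..int n}"
  proof (rule inj_onI)
    fix x y assume xy: "x \<in> {0 + 1..int n}" "y \<in> {0 + 1..int n}" and e: "ext_int w x = ext_int w y"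
    have "w (nat x) = w (nat y)" using e xy by (simp add: ext_int_def)
    then have "nat x = nat y" by (rule injD[OF permutes_inj[OF w]])
    then show "x = y" using xy by auto
  qed
  show "bij_betw (ext_int w) {0 + 1..int n} {0 + 1..int n}"
    using r inj by (simp add: bij_betw_def endo_inj_surj image_subset_iff)
  fix x assume "x \<notin> {0 + 1..int n}"
  then have "nat x \<notin> {1..n}" "0 < x \<longrightarrow> int (nat x) = x" by auto
  then show "ext_int w x = x" using permutes_not_in[OF w, of "nat x"] by (simp add: ext_int_def)
qed

lemma ext_int_permutes':
  assumes w: "w permutes {1..n}"
  shows "ext_int w permutes {- int n..int n}"
  using permutes_subset[OF ext_int_permutes[OF w]] by simp

lemma ext_int_nsw:
  assumes "1 \<le> a"
  shows "ext_int (w \<circ> nsw a) = ext_int w \<circ> sw (int a)"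
proof
  fix x
  have "nat x = a \<longleftrightarrow> x = int a" "nat x = a + 1 \<longleftrightarrow> x = int a + 1" if "0 < x" using that by auto
  then show "ext_int (w \<circ> nsw a) x = (ext_int w \<circ> sw (int a)) x"
    using assms by (auto simp: ext_int_def transpose_def nat_add_distrib)
qed

lemma ext_int_id: "w permutes {1..n} \<Longrightarrow> ext_int w = id \<longleftrightarrow> w = id"
proof
  assume w: "w permutes {1..n}" and e: "ext_int w = id"
  have "w i = i" for i
    using fun_cong[OF e, of "int i"] w by (cases "i = 0") (auto simp: ext_int_def permutes_def)
  then show "w = id" by auto
qed (auto simp: ext_int_def)

lemma no_descent_id:
  fixes w :: "nat \<Rightarrow> nat"
  assumes w: "w permutes {1..n}" and nd: "\<And>a. a \<in> {1..<n} \<Longrightarrow> \<not> w (a + 1) < w a"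
  shows "w = id"
proof -
  have step: "w a < w (a + 1)" if "1 \<le> a" for a
  proof -
    consider "a < n" | "a = n" | "n < a" by linarith
    then show ?thesis
    proof cases
      case 1
      then show ?thesis using nd[of a] that permutes_inj[OF w] by (metis atLeastLessThan_iff inj_eq less_add_one less_irrefl linorder_neqE_nat)
    next
      case 2
      then have "w a \<le> n" using permutes_in_image[OF w, of a] that by auto
      then show ?thesis using 2 w by (auto simp: permutes_def)
    next
      case 3
      then show ?thesis using w by (auto simp: permutes_def)
    qed
  qed
  have mono: "w x < w y" if "1 \<le> x" "x < y" for x y
    using that(2)
  proof (induction y)
    case (Suc y)
    then show ?case using step[of y] that(1) by (cases "x = y") auto
  qed simp
  have "ext_int w = id"
  proof (rule increasing_permutes_id[OF ext_int_permutes'[OF w]])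
    fix x y :: int assume "x < y" "0 < ext_int w x" "0 < ext_int w y"
    then show "ext_int w x < ext_int w y" using mono[of "nat x" "nat y"] by (auto simp: ext_int_def split: if_splits)
  qed (auto simp: ext_int_def)
  then show ?thesis using ext_int_id[OF w] by simp
qed

lemma word_of_length_inversions:
  "w permutes {1..n} \<Longrightarrow> \<exists>bs. set bs \<subseteq> {1..<n} \<and> word_perm bs = w \<and> length bs = inversions n w"
proof (induction "inversions n w" arbitrary: w rule: less_induct)
  case less
  show ?case
  proof (cases "w = id")
    case True
    then show ?thesis by (intro exI[of _ "[]"]) (simp add: word_perm_def)
  next
    case False
    then obtain a where a: "a \<in> {1..<n}" "w (a + 1) < w a" using no_descent_id[OF less.prems] by blast
    note i = inversions_descent[OF a]
    obtain bs where bs: "set bs \<subseteq> {1..<n}" "word_perm bs = w \<circ> nsw a" "length bs = inversions n (w \<circ> nsw a)"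
      using less.hyps[OF _ permutes_nsw[OF less.prems a(1)]] i by auto
    have "word_perm (bs @ [a]) = w" unfolding word_perm_snoc bs(2) by (simp add: comp_assoc)
    then show ?thesis using bs i a by (intro exI[of _ "bs @ [a]"]) auto
  qed
qed

text \<open>These are the reversed reduced words: each letter removes one inversion until none is
  left.\<close>

fun peels :: "(int \<Rightarrow> int) \<Rightarrow> int list \<Rightarrow> bool" where
  "peels w [] \<longleftrightarrow> w = id"
| "peels w (a # as) \<longleftrightarrow> w (a + 1) < w a \<and> peels (w \<circ> sw a) as"

lemma ext_int_descent:
  "1 \<le> a \<Longrightarrow> ext_int w (int a + 1) < ext_int w (int a) \<longleftrightarrow> w (a + 1) < w a"
  by (simp add: ext_int_def nat_add_distrib)

text \<open>If the last letter is not a descent, dropping it leaves a permutation with one more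
  inversion, for which the shortened word is too short by \<open>word_perm_bound\<close>.\<close>

lemma peels_word:
  "set as \<subseteq> {1..<n} \<Longrightarrow> w permutes {1..n} \<Longrightarrow> peels (ext_int w) (map int (rev as)) \<longleftrightarrow>
    word_perm as = w \<and> length as = inversions n w"
proof (induction as arbitrary: w rule: rev_induct)
  case Nil
  have "inversions n w = 0 \<Longrightarrow> id = w \<Longrightarrow> w = id" by simp
  then show ?case using ext_int_id[OF Nil(2)] by (auto simp: word_perm_def)
next
  case (snoc a as)
  then have a: "a \<in> {1..<n}" and s: "set as \<subseteq> {1..<n}" by auto
  note p = permutes_nsw[OF snoc.prems(2) a]
  have eq: "word_perm (as @ [a]) = w \<longleftrightarrow> word_perm as = w \<circ> nsw a"
    unfolding word_perm_snoc by (metis comp_assoc comp_id transpose_comp_involutory)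
  have "peels (ext_int w) (map int (rev (as @ [a]))) \<longleftrightarrow> w (a + 1) < w a \<and>
     word_perm as = w \<circ> nsw a \<and> length as = inversions n (w \<circ> nsw a)"
  proof -
    have a1: "1 \<le> a" using a by simp
    have "peels (ext_int w) (map int (rev (as @ [a]))) \<longleftrightarrow>
      ext_int w (int a + 1) < ext_int w (int a) \<and> peels (ext_int w \<circ> sw (int a)) (map int (rev as))"
      by simp
    then show ?thesis
      unfolding ext_int_descent[OF a1] ext_int_nsw[OF a1, symmetric] snoc.IH[OF s p] .
  qed
  also have "\<dots> \<longleftrightarrow> word_perm (as @ [a]) = w \<and> length (as @ [a]) = inversions n w"
  proof (cases "w (a + 1) < w a")
    case True
    then show ?thesis using inversions_descent[OF a True] eq by auto
  next
    case False
    moreover have "w (a + 1) \<noteq> w a" using permutes_inj[OF snoc.prems(2)] by (simp add: inj_eq)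
    ultimately have "inversions n (w \<circ> nsw a) = Suc (inversions n w)" using inversions_ascent[OF a] by simp
    then show ?thesis using word_perm_bound[OF s] eq False by auto
  qed
  finally show ?case .
qed

lemma reduced_words_iff:
  assumes w: "w permutes {1..n}"
  shows "as \<in> reduced_words n w \<longleftrightarrow> set as \<subseteq> {1..<n} \<and> peels (ext_int w) (map int (rev as))"
proof
  assume "as \<in> reduced_words n w"
  then have as: "set as \<subseteq> {1..<n}" "word_perm as = w"
    and min: "\<And>bs. set bs \<subseteq> {1..<n} \<Longrightarrow> word_perm bs = w \<Longrightarrow> length as \<le> length bs"
    by (auto simp: reduced_words_def)
  obtain bs where "set bs \<subseteq> {1..<n}" "word_perm bs = w" "length bs = inversions n w"
    using word_of_length_inversions[OF w] by blast
  then have "length as = inversions n w" using min[of bs] word_perm_bound[OF as(1)] as(2) by simp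
  then show "set as \<subseteq> {1..<n} \<and> peels (ext_int w) (map int (rev as))" using peels_word[OF as(1) w] as by simp
next
  assume as: "set as \<subseteq> {1..<n} \<and> peels (ext_int w) (map int (rev as))"
  then have "word_perm as = w \<and> length as = inversions n w" using peels_word[OF _ w] by blast
  then show "as \<in> reduced_words n w"
    using as word_perm_bound unfolding reduced_words_def by fastforce
qed

lemma peels_letters:
  "w permutes {0 + 1..int n} \<Longrightarrow> peels w as \<Longrightarrow> set as \<subseteq> {1..<int n}"
proof (induction as arbitrary: w)
  case (Cons a as)
  then have d: "w (a + 1) < w a" by simp
  note s = permutes_swap[OF Cons.prems(1) d]
  have "peels (w \<circ> sw a) as" using Cons.prems(2) by simp
  then have "set as \<subseteq> {1..<int n}" by (rule Cons.IH[OF s(3)])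
  then show ?case using s(1,2) by simp
qed simp

text \<open>Once a descent at \<open>a\<close> is removed, \<open>a\<close> is an ascent and cannot
  be the next letter. With distinct neighbours, not being an ascent of the word means being a strict
  descent, as \<open>slot_less\<close> requires.\<close>

lemma peels_distinct_adj: "peels w as \<Longrightarrow> distinct_adj as"
proof (induction as arbitrary: w)
  case (Cons a as)
  have p: "w (a + 1) < w a" "peels (w \<circ> sw a) as" using Cons.prems by simp_all
  have da: "distinct_adj as" by (rule Cons.IH[OF p(2)])
  show ?case
  proof (cases as)
    case (Cons c cs)
    have "c \<noteq> a" using p unfolding Cons by auto
    then show ?thesis using da unfolding Cons by simp
  qed simp
qed simp

section \<open>Compatible pairs as subsequences of a list of slots\<close>

fun peel_count :: "(int \<times> int) list \<Rightarrow> (int \<Rightarrow> int) \<Rightarrow> int multiset \<Rightarrow> int" where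
  "peel_count [] w m = (if w = id \<and> m = {#} then 1 else 0)"
| "peel_count ((b, a) # sl) w m = peel_count sl w m +
    (if w (a + 1) < w a \<and> b \<in># m then peel_count sl (w \<circ> sw a) (m - {#b#}) else 0)"

text \<open>A slot \<open>(b, a)\<close> offers the letter \<open>a\<close> together with the
  variable \<open>b\<close>. The recursion decides slot by slot whether the offer is taken; as no
  slot is repeated, every subsequence is counted once.\<close>

lemma peel_count_card:
  "distinct sl \<Longrightarrow> peel_count sl w m =
    int (card {xs \<in> set (subseqs sl). peels w (map snd xs) \<and> mset (map fst xs) = m})"
proof (induction sl arbitrary: w m)
  case Nil
  have "{xs \<in> set (subseqs []). peels w (map snd xs) \<and> mset (map fst xs) = m} =
    (if w = id \<and> m = {#} then {[]} else {})" by auto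
  then show ?case by simp
next
  case (Cons p sl)
  obtain b a where p: "p = (b, a)" by (cases p)
  let ?A = "\<lambda>w m. {xs \<in> set (subseqs sl). peels w (map snd xs) \<and> mset (map fst xs) = m}"
  let ?B = "Cons p ` {xs \<in> set (subseqs sl). w (a + 1) < w a \<and> peels (w \<circ> sw a) (map snd xs) \<and> add_mset b (mset (map fst xs)) = m}"
  have "{xs \<in> set (subseqs (p # sl)). peels w (map snd xs) \<and> mset (map fst xs) = m} = ?A w m \<union> ?B"
    by (auto simp: Let_def p)
  moreover have "?A w m \<inter> ?B = {}"
  proof -
    have pn: "p \<notin> set xs" if "xs \<in> set (subseqs sl)" for xs
    proof -
      have "set xs \<in> set ` set (subseqs sl)" using that by (rule imageI)
      then show ?thesis using Cons.prems unfolding subseqs_powset by auto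
    qed
    show ?thesis by (auto dest!: pn)
  qed
  moreover have "finite (?A w m)" "finite ?B" by auto
  moreover have "card ?B = (if w (a + 1) < w a \<and> b \<in># m then card (?A (w \<circ> sw a) (m - {#b#})) else 0)"
  proof -
    let ?S = "{xs \<in> set (subseqs sl). w (a + 1) < w a \<and> peels (w \<circ> sw a) (map snd xs) \<and> add_mset b (mset (map fst xs)) = m}"
    have c1: "card ?B = card ?S" by (intro card_image) auto
    have c2: "card ?S = (if w (a + 1) < w a \<and> b \<in># m then card (?A (w \<circ> sw a) (m - {#b#})) else 0)"
    proof (cases "w (a + 1) < w a \<and> b \<in># m")
      case True
      then have "add_mset b X = m \<longleftrightarrow> X = m - {#b#}" for X
        by (metis add_mset_remove_trivial insert_DiffM)
      then show ?thesis using True by simp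
    next
      case False
      then have "\<not> (w (a + 1) < w a \<and> add_mset b X = m)" for X by auto
      then have "?S = {}" by blast
      then show ?thesis using False by (simp only: card.empty if_False)
    qed
    show ?thesis by (rule trans[OF c1 c2])
  qed
  ultimately show ?case using Cons.IH Cons.prems by (simp add: p card_Un_disjoint)
qed

text \<open>The order of a reversed compatible pair: the variables decrease, and the letters of one
  variable increase.\<close>

definition slot_less :: "int \<times> int \<Rightarrow> int \<times> int \<Rightarrow> bool" where
  "slot_less p q \<longleftrightarrow> fst q < fst p \<or> fst p = fst q \<and> snd p < snd q"

lemma transp_slot_less: "transp slot_less" and irrefl_slot_less: "\<not> slot_less p p"
  by (auto simp: transp_def slot_less_def)

text \<open>In a strictly sorted list the order of chosen elements is forced, so a subsequence is
  just a sorted list of elements.\<close>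

lemma subseqs_sorted_iff:
  assumes "sorted_wrt slot_less sl"
  shows "xs \<in> set (subseqs sl) \<longleftrightarrow> set xs \<subseteq> set sl \<and> sorted_wrt slot_less xs"
  using assms
proof (induction sl arbitrary: xs)
  case Nil
  then show ?case by auto
next
  case (Cons p sl)
  have IH: "xs \<in> set (subseqs sl) \<longleftrightarrow> set xs \<subseteq> set sl \<and> sorted_wrt slot_less xs" for xs
    using Cons by simp
  have p: "\<And>q. q \<in> set sl \<Longrightarrow> slot_less p q" using Cons.prems by simp
  then have pn: "p \<notin> set sl" using irrefl_slot_less by blast
  have asym: "\<not> slot_less q p" if "slot_less p q" for q using that by (auto simp: slot_less_def)
  have "xs \<in> set (subseqs (p # sl)) \<longleftrightarrow> xs \<in> set (subseqs sl) \<or> (\<exists>ys. xs = p # ys \<and> ys \<in> set (subseqs sl))"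
    by (auto simp: Let_def)
  also have "\<dots> \<longleftrightarrow> set xs \<subseteq> set (p # sl) \<and> sorted_wrt slot_less xs"
  proof (cases xs)
    case (Cons q ys)
    show ?thesis
    proof (cases "q = p")
      case True
      have "p \<notin> set ys" if "\<forall>y\<in>set ys. slot_less p y" using that irrefl_slot_less by blast
      then show ?thesis using Cons True p pn by (auto simp: IH)
    next
      case False
      have "p \<notin> set ys" if "q \<in> set sl" "\<forall>y\<in>set ys. slot_less q y" using that p asym by blast
      then show ?thesis using Cons False pn by (auto simp: IH)
    qed
  qed (simp add: IH)
  finally show ?case .
qed

definition slots :: "int \<Rightarrow> int \<Rightarrow> nat \<Rightarrow> nat \<Rightarrow> (int \<times> int) list" where
  "slots lo hi i k = concat (map (\<lambda>i. map (Pair (- int i)) [lo..hi]) [i..<i + k])"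

lemma slots_Suc: "slots lo hi i (Suc k) = map (Pair (- int i)) [lo..hi] @ slots lo hi (Suc i) k"
  unfolding slots_def by (subst upt_conv_Cons) auto

lemma set_slots: "set (slots lo hi i k) = {(- int l, a) | l a. i \<le> l \<and> l < i + k \<and> lo \<le> a \<and> a \<le> hi}"
  by (auto simp: slots_def)

lemma sorted_slots: "sorted_wrt slot_less (slots lo hi i k)"
proof (induction k arbitrary: i)
  case 0
  then show ?case by (simp add: slots_def)
next
  case (Suc k)
  have "sorted_wrt slot_less (map (Pair (- int i)) [lo..hi])"
    unfolding sorted_wrt_map slot_less_def
    by (rule sorted_wrt_mono_rel[OF _ sorted_wrt_upto]) auto
  moreover have "\<forall>p\<in>set (map (Pair (- int i)) [lo..hi]). \<forall>q\<in>set (slots lo hi (Suc i) k). slot_less p q"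
    by (auto simp: set_slots slot_less_def)
  ultimately show ?case
    using Suc.IH[of "Suc i"] unfolding slots_Suc sorted_wrt_append by blast
qed

lemma peel_count_zero:
  "b \<in># m \<Longrightarrow> b \<notin> fst ` set sl \<Longrightarrow> peel_count sl w m = 0"
  by (induction sl w m rule: peel_count.induct) (auto simp: in_diff_count)

text \<open>The slots of one variable act like a product of operators. Beyond the block
  \<open>b\<close> is no longer offered, so all its copies in \<open>m\<close> must be used inside
  the block, and this fixes the exponent.\<close>

lemma peel_count_block:
  "b \<notin> fst ` set sl \<Longrightarrow> peel_count (map (Pair b) as @ sl) w m =
    peel as (int (count m b)) (\<lambda>v. peel_count sl v (filter_mset (\<lambda>x. x \<noteq> b) m)) w"
proof (induction as arbitrary: w m)
  case Nil
  show ?case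
  proof (cases "b \<in># m")
    case False
    then have "filter_mset (\<lambda>x. x \<noteq> b) m = m" by (auto simp: filter_mset_eq_conv)
    then show ?thesis using False by (simp add: not_in_iff)
  next
    case True
    then show ?thesis using peel_count_zero[OF True Nil] by (simp add: count_eq_zero_iff)
  qed
next
  case (Cons a as)
  show ?case
  proof (cases "b \<in># m")
    case False
    then have c0: "count m b = 0" by (simp add: not_in_iff)
    show ?thesis using Cons False by (simp add: descent_op_def peel_neg c0)
  next
    case True
    have "filter_mset (\<lambda>x. x \<noteq> b) (m - {#b#}) = filter_mset (\<lambda>x. x \<noteq> b) m"
      by (rule multiset_eqI) auto
    moreover have "int (count (m - {#b#}) b) = int (count m b) - 1" using True by (simp add: of_nat_diff Suc_le_eq)
    ultimately show ?thesis using Cons True by (simp add: descent_op_def)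
  qed
qed

definition counts :: "int multiset \<Rightarrow> nat \<Rightarrow> nat \<Rightarrow> int list" where
  "counts m i k = map (\<lambda>l. int (count m (- int l))) [i..<i + k]"

lemma counts_Suc: "counts m i (Suc k) = int (count m (- int i)) # counts m (Suc i) k"
  unfolding counts_def by (subst upt_conv_Cons) auto

lemma counts_filter:
  "counts (filter_mset (\<lambda>x. x \<noteq> - int i) m) (Suc i) k = counts m (Suc i) k"
  by (auto simp: counts_def)

lemma peel_count_slots:
  "\<forall>b\<in>#m. - int (i + k) < b \<and> b \<le> - int i \<Longrightarrow> peel_count (slots lo hi i k) w m = peel_all lo hi (counts m i k) w"
proof (induction k arbitrary: i w m)
  case 0
  then have "m = {#}" by (cases m) auto
  then show ?case by (simp add: slots_def counts_def)
next
  case (Suc k)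
  have "- int i \<notin> fst ` set (slots lo hi (Suc i) k)" by (auto simp: set_slots)
  note B = peel_count_block[OF this]
  have "\<forall>b\<in>#filter_mset (\<lambda>x. x \<noteq> - int i) m. - int (Suc i + k) < b \<and> b \<le> - int (Suc i)"
    using Suc.prems by force
  from Suc.IH[OF this] show ?case
    unfolding slots_Suc B counts_Suc peel_all.simps by (simp add: counts_filter)
qed

text \<open>Zipping a reduced word with compatible subscripts and reversing the result gives a
  subsequence of the slots that peels \<open>w\<close>, and conversely. Slots exist for all letters
  from \<open>- n - 1\<close> to \<open>n\<close>, but only those from \<open>1\<close> to
  \<open>n - 1\<close> can be used, by \<open>peels_letters\<close>.\<close>

theorem stanley_eq_peel_sym:
  assumes w: "w permutes {1..n}" and m: "\<forall>b\<in>#m. - int k < b \<and> b \<le> 0"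
  shows "stanley n w m = peel_sym n (counts m 0 k) (ext_int w)"
proof -
  let ?sl = "slots (- int n - 1) (int n) 0 k"
  let ?X = "{xs \<in> set (subseqs ?sl). peels (ext_int w) (map snd xs) \<and> mset (map fst xs) = m}"
  let ?Y = "{(as, bs). as \<in> reduced_words n w \<and> compatible as bs \<and> mset bs = m}"
  have sorted: "sorted_wrt slot_less ?sl" by (rule sorted_slots)
  have "distinct sl" if "sorted_wrt slot_less sl" for sl
    using that by (induction sl) (auto simp: irrefl_slot_less)
  from this[OF sorted] have dist: "distinct ?sl" .
  have X: "xs \<in> ?X \<longleftrightarrow> set xs \<subseteq> set ?sl \<and> sorted_wrt slot_less xs \<and> peels (ext_int w) (map snd xs) \<and> mset (map fst xs) = m" for xs
    using subseqs_sorted_iff[OF sorted, of xs] by simp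
  \<comment> \<open>By transitivity only neighbours matter, and neighbouring letters differ; so the
    slot order says that subscripts grow weakly, and strictly at ascents.\<close>
  have compat: "sorted_wrt slot_less (rev (zip bs (map int as))) \<longleftrightarrow> sorted bs \<and>
      (\<forall>i. i + 1 < length as \<longrightarrow> as ! i < as ! (i + 1) \<longrightarrow> bs ! i < bs ! (i + 1))"
    if len: "length bs = length as" and da: "distinct_adj (rev as)" for as bs
  proof -
    have tr: "transp (\<lambda>x y. slot_less y x)" using transp_slot_less by (auto simp: transp_def)
    have ne: "as ! i \<noteq> as ! Suc i" if "Suc i < length as" for i
      using da that unfolding distinct_adj_rev by (simp add: distinct_adj_conv_nth)
    have "sorted_wrt slot_less (rev (zip bs (map int as))) \<longleftrightarrow>
      (\<forall>i. Suc i < length as \<longrightarrow> bs ! i < bs ! Suc i \<or> bs ! Suc i = bs ! i \<and> as ! Suc i < as ! i)"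
      unfolding sorted_wrt_rev sorted_wrt_iff_nth_Suc_transp[OF tr] using len by (simp add: slot_less_def)
    also have "\<dots> \<longleftrightarrow> (\<forall>i. Suc i < length as \<longrightarrow> bs ! i \<le> bs ! Suc i \<and> (as ! i < as ! Suc i \<longrightarrow> bs ! i < bs ! Suc i))"
    proof (intro all_cong)
      fix i assume "Suc i < length as"
      from ne[OF this] show "(bs ! i < bs ! Suc i \<or> bs ! Suc i = bs ! i \<and> as ! Suc i < as ! i) \<longleftrightarrow>
        (bs ! i \<le> bs ! Suc i \<and> (as ! i < as ! Suc i \<longrightarrow> bs ! i < bs ! Suc i))" by auto
    qed
    finally show ?thesis using len by (auto simp: sorted_iff_nth_Suc)
  qed
  have "bij_betw (\<lambda>xs. (map (nat \<circ> snd) (rev xs), map fst (rev xs))) ?X ?Y"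
  proof (rule bij_betw_byWitness[where f' = "\<lambda>(as, bs). rev (zip bs (map int as))"])
    have letters: "set (map snd xs) \<subseteq> {1..<int n}" if "xs \<in> ?X" for xs
      using peels_letters[OF ext_int_permutes[OF w]] that X by blast
    have bk: "rev (zip (map fst (rev xs)) (map int (map (nat \<circ> snd) (rev xs)))) = xs" if "xs \<in> ?X" for xs
    proof -
      have e: "map int (map (nat \<circ> snd) (rev xs)) = map snd (rev xs)"
        using letters[OF that] by (auto simp: subset_iff)
      show ?thesis unfolding e zip_map_fst_snd by simp
    qed
    show "\<forall>xs\<in>?X. (\<lambda>(as, bs). rev (zip bs (map int as))) (map (nat \<circ> snd) (rev xs), map fst (rev xs)) = xs"
      using bk by simp
    show "\<forall>p\<in>?Y. (map (nat \<circ> snd) (rev ((\<lambda>(as, bs). rev (zip bs (map int as))) p)), map fst (rev ((\<lambda>(as, bs). rev (zip bs (map int as))) p))) = p"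
      by (auto simp: compatible_def simp flip: map_map) (simp add: comp_def)
    show "(\<lambda>xs. (map (nat \<circ> snd) (rev xs), map fst (rev xs))) ` ?X \<subseteq> ?Y"
    proof
      fix p assume "p \<in> (\<lambda>xs. (map (nat \<circ> snd) (rev xs), map fst (rev xs))) ` ?X"
      then obtain xs where xs: "xs \<in> ?X" and p: "p = (map (nat \<circ> snd) (rev xs), map fst (rev xs))" by blast
      define as where "as = map (nat \<circ> snd) (rev xs)"
      define bs where "bs = map fst (rev xs)"
      have px: "map int (rev as) = map snd xs" using letters[OF xs] by (auto simp: as_def rev_map subset_iff)
      have pe: "peels (ext_int w) (map int (rev as))" using xs X px by simp
      have "set as \<subseteq> {1..<n}" using letters[OF xs] by (force simp: as_def)
      then have "as \<in> reduced_words n w" using pe reduced_words_iff[OF w] by blast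
      moreover have "compatible as bs"
      proof -
        have "distinct_adj (map int (rev as))" by (rule peels_distinct_adj[OF pe])
        then have "distinct_adj (rev as)" by (rule distinct_adj_mapD)
        moreover have "rev (zip bs (map int as)) = xs" using bk[OF xs] by (simp add: as_def bs_def)
        moreover have "set bs \<subseteq> {..0}" using xs X[of xs] m by (auto simp: bs_def simp flip: set_mset_mset)
        ultimately show ?thesis using compat[of bs as] xs X by (simp add: compatible_def as_def bs_def)
      qed
      moreover have "mset bs = m" using xs by (simp add: bs_def)
      ultimately show "p \<in> ?Y" by (simp add: p as_def bs_def)
    qed
    show "(\<lambda>(as, bs). rev (zip bs (map int as))) ` ?Y \<subseteq> ?X"
    proof
      fix xs assume "xs \<in> (\<lambda>(as, bs). rev (zip bs (map int as))) ` ?Y"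
      then obtain as bs where xs: "xs = rev (zip bs (map int as))" and r: "as \<in> reduced_words n w"
        and c: "compatible as bs" and mb: "mset bs = m" by auto
      have pe: "set as \<subseteq> {1..<n}" "peels (ext_int w) (map int (rev as))" using r reduced_words_iff[OF w] by auto
      have len: "length bs = length as" using c by (simp add: compatible_def)
      have "distinct_adj (map int (rev as))" by (rule peels_distinct_adj[OF pe(2)])
      then have "distinct_adj (rev as)" by (rule distinct_adj_mapD)
      then have "sorted_wrt slot_less xs" using compat[OF len] c by (simp add: compatible_def xs)
      moreover have ms: "map snd xs = map int (rev as)" "map fst xs = rev bs"
        using len by (simp_all add: xs rev_map[symmetric] map_snd_zip)
      moreover have "set xs \<subseteq> set ?sl"
      proof
        fix q assume "q \<in> set xs"
        then have "fst q \<in> set bs" "snd q \<in> int ` set as"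
          using ms by (metis image_eqI set_map set_rev)+
        then have "fst q \<in># m" "1 \<le> snd q" "snd q < int n" using mb pe(1) by (auto simp flip: set_mset_mset)
        then have "- int k < fst q" "fst q \<le> 0" using m by auto
        then show "q \<in> set ?sl" using \<open>1 \<le> snd q\<close> \<open>snd q < int n\<close>
          unfolding set_slots by (intro CollectI exI[of _ "nat (- fst q)"] exI[of _ "snd q"]) auto
      qed
      moreover have "mset (map fst xs) = m" using ms mb by simp
      ultimately show "xs \<in> ?X" using X[of xs] pe(2) by simp
    qed
  qed
  then have "card ?Y = card ?X" by (simp add: bij_betw_same_card)
  then show ?thesis
    using peel_count_card[OF dist, of "ext_int w" m] peel_count_slots[of m 0 k] m
    by (simp add: stanley_def)
qed

lemma stanley_zero:
  assumes "b \<in># m" "0 < b"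
  shows "stanley n w m = 0"
proof -
  have e: "{(as, bs). as \<in> reduced_words n w \<and> compatible as bs \<and> mset bs = m} = {}"
    using assms by (fastforce simp: compatible_def)
  show ?thesis unfolding stanley_def e by simp
qed

section \<open>Schur functions\<close>

definition diag :: "(nat \<Rightarrow> nat) \<Rightarrow> (nat \<times> nat) set" where
  "diag \<mu> = {(i, j). 1 \<le> i \<and> 1 \<le> j \<and> i \<le> \<mu> (j - 1)}"

text \<open>The bound on the entries is a parameter, so that the recursion can lower it variable by
  variable.\<close>

definition tableaux :: "int \<Rightarrow> (nat \<Rightarrow> nat) \<Rightarrow> (nat \<times> nat \<Rightarrow> int) set" where
  "tableaux b \<mu> = {T \<in> diag \<mu> \<rightarrow>\<^sub>E {..b}.
     (\<forall>i j k. (i, j) \<in> diag \<mu> \<and> (i, k) \<in> diag \<mu> \<and> j < k \<longrightarrow> T (i, j) \<le> T (i, k)) \<and>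
     (\<forall>i j k. (i, k) \<in> diag \<mu> \<and> (j, k) \<in> diag \<mu> \<and> i < j \<longrightarrow> T (i, k) < T (j, k))}"

definition content :: "(nat \<Rightarrow> nat) \<Rightarrow> (nat \<times> nat \<Rightarrow> int) \<Rightarrow> int multiset" where
  "content \<mu> T = image_mset T (mset_set (diag \<mu>))"

lemma tableaux_PiE: "T \<in> tableaux b \<mu> \<Longrightarrow> T \<in> diag \<mu> \<rightarrow>\<^sub>E {..b}"
  by (simp add: tableaux_def)

lemma finite_diag:
  assumes "antimono \<mu>" "\<forall>i\<ge>N. \<mu> i = 0"
  shows "finite (diag \<mu>)"
proof (rule finite_subset)
  show "diag \<mu> \<subseteq> {1..\<mu> 0} \<times> {1..N}"
  proof
    fix p assume "p \<in> diag \<mu>"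
    then obtain i j where p: "p = (i, j)" "1 \<le> i" "1 \<le> j" "i \<le> \<mu> (j - 1)" by (auto simp: diag_def)
    have "\<mu> (j - 1) \<le> \<mu> 0" using antimonoD[OF assms(1), of 0 "j - 1"] by simp
    moreover have "j - 1 < N" using assms(2) p by (metis le_zero_eq not_less not_one_le_zero)
    ultimately show "p \<in> {1..\<mu> 0} \<times> {1..N}" using p by auto
  qed
qed simp

lemma diag_strip:
  assumes "\<nu> \<in> strips \<mu>"
  shows "diag \<nu> \<subseteq> diag \<mu>" "diag \<mu> - diag \<nu> = (\<lambda>j. (\<mu> j, Suc j)) ` {j. \<nu> j \<noteq> \<mu> j}"
proof -
  have c: "\<nu> i = \<mu> i \<or> \<nu> i + 1 = \<mu> i" for i using assms by (auto simp: strips_def)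
  show "diag \<nu> \<subseteq> diag \<mu>"
  proof
    fix p assume "p \<in> diag \<nu>"
    then show "p \<in> diag \<mu>" using c[of "snd p - 1"] by (auto simp: diag_def)
  qed
  show "diag \<mu> - diag \<nu> = (\<lambda>j. (\<mu> j, Suc j)) ` {j. \<nu> j \<noteq> \<mu> j}"
  proof (intro set_eqI iffI)
    fix p assume "p \<in> diag \<mu> - diag \<nu>"
    then obtain i j where p: "p = (i, j)" "1 \<le> i" "1 \<le> j" "i \<le> \<mu> (j - 1)" "\<not> i \<le> \<nu> (j - 1)"
      by (auto simp: diag_def)
    then have "i = \<mu> (j - 1)" "\<nu> (j - 1) \<noteq> \<mu> (j - 1)" using c[of "j - 1"] by auto
    then show "p \<in> (\<lambda>j. (\<mu> j, Suc j)) ` {j. \<nu> j \<noteq> \<mu> j}"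
      using p by (intro image_eqI[of _ _ "j - 1"]) auto
  next
    fix p assume "p \<in> (\<lambda>j. (\<mu> j, Suc j)) ` {j. \<nu> j \<noteq> \<mu> j}"
    then obtain j where p: "p = (\<mu> j, Suc j)" "\<nu> j \<noteq> \<mu> j" by auto
    then show "p \<in> diag \<mu> - diag \<nu>" using c[of j] by (auto simp: diag_def)
  qed
qed

lemma content_strip:
  assumes \<nu>: "\<nu> \<in> strips \<mu>" and fin: "finite (diag \<mu>)"
    and T: "\<And>p. p \<in> diag \<mu> - diag \<nu> \<Longrightarrow> T p = b"
  shows "content \<mu> T = content \<nu> T + replicate_mset (card {j. \<nu> j \<noteq> \<mu> j}) b"
proof -
  have "mset_set (diag \<mu>) = mset_set (diag \<nu>) + mset_set (diag \<mu> - diag \<nu>)"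
    using mset_set_Union[of "diag \<nu>" "diag \<mu> - diag \<nu>"] diag_strip(1)[OF \<nu>] fin
    by (simp add: Un_absorb1 finite_subset Int_Diff)
  moreover have "image_mset T (mset_set (diag \<mu> - diag \<nu>)) = image_mset (\<lambda>_. b) (mset_set (diag \<mu> - diag \<nu>))"
    using T fin by (intro image_mset_cong) auto
  moreover have "card (diag \<mu> - diag \<nu>) = card {j. \<nu> j \<noteq> \<mu> j}"
    unfolding diag_strip(2)[OF \<nu>] by (intro card_image) (auto simp: inj_on_def)
  ultimately show ?thesis by (simp add: content_def image_mset_const_eq)
qed

section \<open>Removing the largest entries of a tableau\<close>

definition remove_max :: "int \<Rightarrow> (nat \<Rightarrow> nat) \<Rightarrow> (nat \<times> nat \<Rightarrow> int) \<Rightarrow> nat \<Rightarrow> nat" where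
  "remove_max b \<mu> T j = (if 0 < \<mu> j \<and> T (\<mu> j, Suc j) = b then \<mu> j - 1 else \<mu> j)"

definition add_max :: "int \<Rightarrow> (nat \<Rightarrow> nat) \<Rightarrow> (nat \<Rightarrow> nat) \<Rightarrow> (nat \<times> nat \<Rightarrow> int) \<Rightarrow> nat \<times> nat \<Rightarrow> int" where
  "add_max b \<mu> \<nu> T p = (if p \<in> diag \<nu> then T p else if p \<in> diag \<mu> then b else undefined)"

text \<open>Columns increase strictly, so \<open>b\<close> occurs only at the bottom of a column.
  Rows increase weakly, so it then also ends every column of the same height to the right; hence the
  remaining heights are antimonotone.\<close>

lemma remove_max_strip:
  assumes T: "T \<in> tableaux b \<mu>" and am: "antimono \<mu>"
  shows "remove_max b \<mu> T \<in> strips \<mu>"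
    and "\<And>p. p \<in> diag \<mu> \<Longrightarrow> p \<in> diag (remove_max b \<mu> T) \<longleftrightarrow> T p < b"
proof -
  have le: "T p \<le> b" if "p \<in> diag \<mu>" for p using T that by (auto simp: tableaux_def)
  have row: "T (i, j) \<le> T (i, k)" if "(i, j) \<in> diag \<mu>" "(i, k) \<in> diag \<mu>" "j < k" for i j k
    using T that unfolding tableaux_def by blast
  have col: "T (i, k) < T (j, k)" if "(i, k) \<in> diag \<mu>" "(j, k) \<in> diag \<mu>" "i < j" for i j k
    using T that unfolding tableaux_def by blast
  have "antimono (remove_max b \<mu> T)"
  proof (rule antimonoI)
    fix j k :: nat assume jk: "j \<le> k"
    have mm: "\<mu> k \<le> \<mu> j" using antimonoD[OF am jk] .
    show "remove_max b \<mu> T k \<le> remove_max b \<mu> T j"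
    proof (cases "0 < \<mu> j \<and> T (\<mu> j, Suc j) = b \<and> \<mu> k = \<mu> j \<and> j < k")
      case True
      then have d: "(\<mu> j, Suc j) \<in> diag \<mu>" "(\<mu> j, Suc k) \<in> diag \<mu>" by (auto simp: diag_def)
      then have "T (\<mu> j, Suc k) = b" using row[OF d] le[OF d(2)] True by auto
      then show ?thesis using True by (simp add: remove_max_def)
    next
      case False
      then show ?thesis using mm jk by (cases "j = k") (auto simp: remove_max_def)
    qed
  qed
  then show "remove_max b \<mu> T \<in> strips \<mu>" by (auto simp: strips_def remove_max_def)
  fix p assume p: "p \<in> diag \<mu>"
  then obtain i j where ij: "p = (i, Suc j)" "1 \<le> i" "i \<le> \<mu> j"
    by (cases p; cases "snd p") (auto simp: diag_def)
  have top: "(\<mu> j, Suc j) \<in> diag \<mu>" using ij by (auto simp: diag_def)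
  show "p \<in> diag (remove_max b \<mu> T) \<longleftrightarrow> T p < b"
  proof (cases "i = \<mu> j")
    case True
    then show ?thesis using ij le[OF p] by (auto simp: diag_def remove_max_def)
  next
    case False
    then have "T p < T (\<mu> j, Suc j)" using col[of i "Suc j" "\<mu> j"] p top ij by simp
    then have "T p < b" using le[OF top] by simp
    then show ?thesis using ij False by (auto simp: diag_def remove_max_def)
  qed
qed

lemma restrict_tableau:
  assumes T: "T \<in> tableaux b \<mu>" and sub: "diag \<nu> \<subseteq> diag \<mu>" and lt: "\<And>p. p \<in> diag \<nu> \<Longrightarrow> T p < b"
  shows "restrict T (diag \<nu>) \<in> tableaux (b - 1) \<nu>"
proof -
  have row: "T (i, j) \<le> T (i, k)" if "(i, j) \<in> diag \<mu>" "(i, k) \<in> diag \<mu>" "j < k" for i j k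
    using T that unfolding tableaux_def by blast
  have col: "T (i, k) < T (j, k)" if "(i, k) \<in> diag \<mu>" "(j, k) \<in> diag \<mu>" "i < j" for i j k
    using T that unfolding tableaux_def by blast
  show ?thesis
    unfolding tableaux_def
  proof (intro CollectI conjI allI impI)
    show "restrict T (diag \<nu>) \<in> diag \<nu> \<rightarrow>\<^sub>E {..b - 1}" using lt by fastforce
    fix i j k
    show "restrict T (diag \<nu>) (i, j) \<le> restrict T (diag \<nu>) (i, k)"
      if "(i, j) \<in> diag \<nu> \<and> (i, k) \<in> diag \<nu> \<and> j < k"
      using row[of i j k] sub that by auto
    show "restrict T (diag \<nu>) (i, k) < restrict T (diag \<nu>) (j, k)"
      if "(i, k) \<in> diag \<nu> \<and> (j, k) \<in> diag \<nu> \<and> i < j"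
      using col[of i k j] sub that by auto
  qed
qed

text \<open>A column gains at most one box, at its bottom, where \<open>b\<close> exceeds the old
  entries; within a row the new boxes are to the right of the old ones.\<close>

lemma add_max_tableau:
  assumes T: "T \<in> tableaux (b - 1) \<nu>" and \<nu>: "\<nu> \<in> strips \<mu>"
  shows "add_max b \<mu> \<nu> T \<in> tableaux b \<mu>"
proof -
  have sub: "diag \<nu> \<subseteq> diag \<mu>" by (rule diag_strip(1)[OF \<nu>])
  have am: "antimono \<nu>" and c: "\<And>i. \<nu> i = \<mu> i \<or> \<nu> i + 1 = \<mu> i" using \<nu> by (auto simp: strips_def)
  have le: "T p \<le> b - 1" if "p \<in> diag \<nu>" for p using T that by (auto simp: tableaux_def)
  have row: "T (i, j) \<le> T (i, k)" if "(i, j) \<in> diag \<nu>" "(i, k) \<in> diag \<nu>" "j < k" for i j k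
    using T that unfolding tableaux_def by blast
  have col: "T (i, k) < T (j, k)" if "(i, k) \<in> diag \<nu>" "(j, k) \<in> diag \<nu>" "i < j" for i j k
    using T that unfolding tableaux_def by blast
  let ?S = "add_max b \<mu> \<nu> T"
  have leS: "?S p \<le> b" if "p \<in> diag \<mu>" for p using le[of p] that by (auto simp: add_max_def)
  show ?thesis
    unfolding tableaux_def
  proof (intro CollectI conjI allI impI)
    show "?S \<in> diag \<mu> \<rightarrow>\<^sub>E {..b}" using leS sub by (auto simp: PiE_iff extensional_def add_max_def)
    fix i j k
    show "?S (i, j) \<le> ?S (i, k)" if "(i, j) \<in> diag \<mu> \<and> (i, k) \<in> diag \<mu> \<and> j < k"
    proof (cases "(i, k) \<in> diag \<nu>")
      case True
      have "\<nu> (k - 1) \<le> \<nu> (j - 1)" by (rule antimonoD[OF am]) (use that in auto)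
      then have "(i, j) \<in> diag \<nu>" using True that by (auto simp: diag_def)
      then show ?thesis using row[of i j k] True that by (simp add: add_max_def)
    next
      case False
      then show ?thesis using leS[of "(i, j)"] that by (simp add: add_max_def)
    qed
    show "?S (i, k) < ?S (j, k)" if "(i, k) \<in> diag \<mu> \<and> (j, k) \<in> diag \<mu> \<and> i < j"
    proof -
      have ik: "(i, k) \<in> diag \<nu>" using that c[of "k - 1"] by (auto simp: diag_def)
      show ?thesis
      proof (cases "(j, k) \<in> diag \<nu>")
        case True
        then show ?thesis using col[OF ik True] that by (simp add: add_max_def ik)
      next
        case False
        then show ?thesis using le[OF ik] that by (simp add: add_max_def ik)
      qed
    qed
  qed
qed

lemma finite_tableaux:
  assumes "finite (diag \<mu>)"
  shows "finite {T \<in> tableaux b \<mu>. content \<mu> T = m}"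
proof (rule finite_subset)
  show "{T \<in> tableaux b \<mu>. content \<mu> T = m} \<subseteq> diag \<mu> \<rightarrow>\<^sub>E set_mset m"
    using assms by (auto simp: tableaux_def content_def PiE_iff extensional_def)
  show "finite (diag \<mu> \<rightarrow>\<^sub>E set_mset m)" using assms by (intro finite_PiE) auto
qed

lemma add_replicate_eq_iff:
  assumes "b \<notin># X"
  shows "X + replicate_mset c b = m \<longleftrightarrow> X = filter_mset (\<lambda>x. x \<noteq> b) m \<and> c = count m b"
proof
  assume m: "X + replicate_mset c b = m"
  have "filter_mset (\<lambda>x. x \<noteq> b) X = X" using assms by (auto simp: filter_mset_eq_conv)
  moreover have "filter_mset (\<lambda>x. x \<noteq> b) (replicate_mset c b) = {#}" by (auto intro!: multiset_eqI)
  ultimately show "X = filter_mset (\<lambda>x. x \<noteq> b) m \<and> c = count m b"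
    using assms by (auto simp: m[symmetric] not_in_iff)
next
  assume "X = filter_mset (\<lambda>x. x \<noteq> b) m \<and> c = count m b"
  then show "X + replicate_mset c b = m" by (auto intro!: multiset_eqI)
qed

text \<open>A tableau is determined by the horizontal strip of its entries \<open>b\<close> and by
  the tableau that remains without them.\<close>

lemma tableaux_recursion:
  assumes am: "antimono \<mu>" and N: "\<forall>i\<ge>N. \<mu> i = 0"
  shows "card {T \<in> tableaux b \<mu>. content \<mu> T = m} =
    (\<Sum>\<nu> | \<nu> \<in> strips \<mu> \<and> card {j. \<nu> j \<noteq> \<mu> j} = count m b.
      card {T \<in> tableaux (b - 1) \<nu>. content \<nu> T = filter_mset (\<lambda>x. x \<noteq> b) m})"
proof -
  let ?S = "{\<nu>. \<nu> \<in> strips \<mu> \<and> card {j. \<nu> j \<noteq> \<mu> j} = count m b}"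
  let ?B = "\<lambda>\<nu>. {T \<in> tableaux (b - 1) \<nu>. content \<nu> T = filter_mset (\<lambda>x. x \<noteq> b) m}"
  have fin: "finite (diag \<mu>)" by (rule finite_diag[OF am N])
  have fin\<nu>: "finite (diag \<nu>)" if "\<nu> \<in> strips \<mu>" for \<nu> using finite_subset[OF diag_strip(1)[OF that] fin] .
  have key: "content \<mu> T = m \<longleftrightarrow> content \<nu> T = filter_mset (\<lambda>x. x \<noteq> b) m \<and> card {j. \<nu> j \<noteq> \<mu> j} = count m b"
    if "\<nu> \<in> strips \<mu>" "\<And>p. p \<in> diag \<mu> - diag \<nu> \<Longrightarrow> T p = b" "\<And>p. p \<in> diag \<nu> \<Longrightarrow> T p < b" for T \<nu>
  proof -
    have "b \<notin># content \<nu> T" using that(3) fin\<nu>[OF that(1)] by (fastforce simp: content_def)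
    from add_replicate_eq_iff[OF this] show ?thesis using content_strip[OF that(1) fin that(2)] by simp
  qed
  have "bij_betw (\<lambda>T. (remove_max b \<mu> T, restrict T (diag (remove_max b \<mu> T))))
     {T \<in> tableaux b \<mu>. content \<mu> T = m} (Sigma ?S ?B)"
  proof (rule bij_betw_byWitness[where f' = "\<lambda>(\<nu>, T). add_max b \<mu> \<nu> T"])
    show "\<forall>T\<in>{T \<in> tableaux b \<mu>. content \<mu> T = m}.
      (\<lambda>(\<nu>, T). add_max b \<mu> \<nu> T) (remove_max b \<mu> T, restrict T (diag (remove_max b \<mu> T))) = T"
    proof
      fix T assume "T \<in> {T \<in> tableaux b \<mu>. content \<mu> T = m}"
      then have T: "T \<in> tableaux b \<mu>" by simp
      note r = remove_max_strip[OF T am]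
      have "add_max b \<mu> (remove_max b \<mu> T) (restrict T (diag (remove_max b \<mu> T))) p = T p" for p
      proof (cases "p \<in> diag \<mu>")
        case True
        then have "T p \<le> b" using T by (auto simp: tableaux_def)
        then show ?thesis using r(2)[OF True] True by (auto simp: add_max_def)
      next
        case False
        then have "T p = undefined" using PiE_arb[OF tableaux_PiE[OF T]] by blast
        then show ?thesis using False diag_strip(1)[OF r(1)] by (auto simp: add_max_def)
      qed
      then show "(\<lambda>(\<nu>, T). add_max b \<mu> \<nu> T) (remove_max b \<mu> T, restrict T (diag (remove_max b \<mu> T))) = T"
        by (simp add: fun_eq_iff)
    qed
    show "(\<lambda>T. (remove_max b \<mu> T, restrict T (diag (remove_max b \<mu> T)))) ` {T \<in> tableaux b \<mu>. content \<mu> T = m} \<subseteq> Sigma ?S ?B"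
    proof (rule image_subsetI)
      fix T assume "T \<in> {T \<in> tableaux b \<mu>. content \<mu> T = m}"
      then have T: "T \<in> tableaux b \<mu>" and m: "content \<mu> T = m" by auto
      note r = remove_max_strip[OF T am]
      define \<nu> where "\<nu> = remove_max b \<mu> T"
      have sub: "diag \<nu> \<subseteq> diag \<mu>" using diag_strip(1)[OF r(1)] by (simp add: \<nu>_def)
      have lt: "T p < b" if "p \<in> diag \<nu>" for p using r(2)[of p] that sub by (auto simp: \<nu>_def)
      have eq: "T p = b" if "p \<in> diag \<mu> - diag \<nu>" for p
        using r(2)[of p] that T by (force simp: \<nu>_def tableaux_def PiE_iff)
      have "content \<nu> (restrict T (diag \<nu>)) = content \<nu> T"
        unfolding content_def using fin\<nu>[OF r(1)] by (intro image_mset_cong) (auto simp: \<nu>_def)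
      then show "(remove_max b \<mu> T, restrict T (diag (remove_max b \<mu> T))) \<in> Sigma ?S ?B"
        using key[OF r(1)[folded \<nu>_def] eq lt] m r(1) restrict_tableau[OF T sub lt] by (simp add: \<nu>_def)
    qed
    have inv: "remove_max b \<mu> (add_max b \<mu> \<nu> T) = \<nu>" "restrict (add_max b \<mu> \<nu> T) (diag \<nu>) = T"
      if \<nu>: "\<nu> \<in> strips \<mu>" and T: "T \<in> tableaux (b - 1) \<nu>" for \<nu> T
    proof -
      have c: "\<nu> i = \<mu> i \<or> \<nu> i + 1 = \<mu> i" for i using \<nu> by (auto simp: strips_def)
      have le: "T p < b" if "p \<in> diag \<nu>" for p using T that by (force simp: tableaux_def)
      show "remove_max b \<mu> (add_max b \<mu> \<nu> T) = \<nu>"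
      proof
        fix j
        show "remove_max b \<mu> (add_max b \<mu> \<nu> T) j = \<nu> j"
        proof (cases "\<nu> j = \<mu> j")
          case True
          have "add_max b \<mu> \<nu> T (\<mu> j, Suc j) < b" if "0 < \<mu> j"
          proof -
            have "(\<mu> j, Suc j) \<in> diag \<nu>" using True that by (auto simp: diag_def)
            then show ?thesis using le by (simp add: add_max_def)
          qed
          then show ?thesis using True by (auto simp: remove_max_def)
        next
          case False
          then have n: "\<nu> j + 1 = \<mu> j" using c[of j] by auto
          then have "(\<mu> j, Suc j) \<in> diag \<mu>" "(\<mu> j, Suc j) \<notin> diag \<nu>" by (auto simp: diag_def)
          then show ?thesis using n by (auto simp: remove_max_def add_max_def)
        qed
      qed
      show "restrict (add_max b \<mu> \<nu> T) (diag \<nu>) = T"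
        using PiE_arb[OF tableaux_PiE[OF T]] by (auto simp: fun_eq_iff restrict_def add_max_def)
    qed
    show "\<forall>p\<in>Sigma ?S ?B. (\<lambda>T. (remove_max b \<mu> T, restrict T (diag (remove_max b \<mu> T)))) ((\<lambda>(\<nu>, T). add_max b \<mu> \<nu> T) p) = p"
      using inv by auto
    show "(\<lambda>(\<nu>, T). add_max b \<mu> \<nu> T) ` Sigma ?S ?B \<subseteq> {T \<in> tableaux b \<mu>. content \<mu> T = m}"
    proof (rule image_subsetI)
      fix p assume "p \<in> Sigma ?S ?B"
      then obtain \<nu> T where p: "p = (\<nu>, T)" and \<nu>: "\<nu> \<in> strips \<mu>" and cd: "card {j. \<nu> j \<noteq> \<mu> j} = count m b"
        and T: "T \<in> tableaux (b - 1) \<nu>" and ct: "content \<nu> T = filter_mset (\<lambda>x. x \<noteq> b) m" by auto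
      let ?A = "add_max b \<mu> \<nu> T"
      have "content \<nu> ?A = content \<nu> T"
        unfolding content_def using fin\<nu>[OF \<nu>] by (intro image_mset_cong) (auto simp: add_max_def)
      moreover have "?A p = b" if "p \<in> diag \<mu> - diag \<nu>" for p using that by (simp add: add_max_def)
      moreover have "?A p < b" if "p \<in> diag \<nu>" for p
        using T that by (force simp: add_max_def tableaux_def)
      ultimately have "content \<mu> ?A = m" using key[OF \<nu>, of ?A] cd ct by simp
      then show "(\<lambda>(\<nu>, T). add_max b \<mu> \<nu> T) p \<in> {T \<in> tableaux b \<mu>. content \<mu> T = m}"
        using add_max_tableau[OF T \<nu>] by (simp add: p)
    qed
  qed
  then have "card {T \<in> tableaux b \<mu>. content \<mu> T = m} = card (Sigma ?S ?B)" by (rule bij_betw_same_card)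
  also have "\<dots> = (\<Sum>\<nu>\<in>?S. card (?B \<nu>))"
  proof (rule card_SigmaI)
    show "finite ?S" using finite_strips[OF N] by simp
    show "\<forall>\<nu>\<in>?S. finite (?B \<nu>)" using finite_tableaux fin\<nu> by blast
  qed
  finally show ?thesis .
qed

lemma tableaux_kostka:
  assumes "antimono \<mu>" "\<forall>i\<ge>N. \<mu> i = 0" "\<forall>b\<in>#m. - int (i + k) < b \<and> b \<le> - int i"
  shows "int (card {T \<in> tableaux (- int i) \<mu>. content \<mu> T = m}) = kostka \<mu> (counts m i k)"
  using assms
proof (induction k arbitrary: i \<mu> m)
  case 0
  then have m: "m = {#}" by (cases m) auto
  have "finite (diag \<mu>)" using finite_diag 0 by blast
  then have c: "content \<mu> T = m \<longleftrightarrow> diag \<mu> = {}" for T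
    by (auto simp: content_def m mset_set_empty_iff)
  have "diag \<mu> = {} \<longleftrightarrow> \<mu> = (\<lambda>_. 0)"
  proof
    assume e: "diag \<mu> = {}"
    have "\<mu> j = 0" for j
    proof (rule ccontr)
      assume "\<mu> j \<noteq> 0"
      then have "(1, Suc j) \<in> diag \<mu>" by (simp add: diag_def)
      then show False using e by simp
    qed
    then show "\<mu> = (\<lambda>_. 0)" by auto
  qed (auto simp: diag_def)
  moreover have "tableaux b \<mu> = {\<lambda>_. undefined}" if "diag \<mu> = {}" for b
    using that by (auto simp: tableaux_def)
  ultimately show ?case unfolding c by (cases "diag \<mu> = {}") (simp_all add: counts_def)
next
  case (Suc k)
  let ?m = "filter_mset (\<lambda>x. x \<noteq> - int i) m"
  have IH: "int (card {T \<in> tableaux (- int i - 1) \<nu>. content \<nu> T = ?m}) = kostka \<nu> (counts m (Suc i) k)"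
    if "\<nu> \<in> strips \<mu>" for \<nu>
  proof -
    have c: "\<nu> l = \<mu> l \<or> \<nu> l + 1 = \<mu> l" for l using that by (auto simp: strips_def)
    have "antimono \<nu>" using that by (simp add: strips_def)
    moreover have "\<forall>l\<ge>N. \<nu> l = 0" using c Suc.prems(2) by (metis add_is_0 one_neq_zero)
    moreover have "\<forall>b\<in>#?m. - int (Suc i + k) < b \<and> b \<le> - int (Suc i)" using Suc.prems(3) by force
    ultimately have "int (card {T \<in> tableaux (- int (Suc i)) \<nu>. content \<nu> T = ?m}) = kostka \<nu> (counts ?m (Suc i) k)"
      by (rule Suc.IH)
    moreover have "- int (Suc i) = - int i - 1" by simp
    ultimately show ?thesis unfolding counts_filter by (simp only:)
  qed
  show ?case
    unfolding tableaux_recursion[OF Suc.prems(1,2)] counts_Suc kostka.simps of_nat_sum of_nat_eq_iff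
    by (rule sum.cong[OF refl]) (use IH in simp)
qed

section \<open>Partitions and their column heights\<close>

definition columns :: "nat list \<Rightarrow> nat \<Rightarrow> nat" where
  "columns la j = length (filter (\<lambda>p. j < p) la)"

lemma columns_Nil: "columns [] = (\<lambda>_. 0)"
  by (simp add: columns_def fun_eq_iff)

lemma columns_Cons: "columns (a # la) j = (if j < a then 1 else 0) + columns la j"
  by (simp add: columns_def)

lemma antimono_columns: "antimono (columns la)"
proof (rule antimonoI)
  fix i j :: nat assume "i \<le> j"
  then show "columns la j \<le> columns la i" by (induction la) (auto simp: columns_Cons columns_Nil)
qed

lemma columns_eq_0: "\<forall>p\<in>set la. p \<le> j \<Longrightarrow> columns la j = 0"
  by (simp add: columns_def not_less)

lemma columns_support: "\<forall>j\<ge>sum_list la. columns la j = 0"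
proof (intro allI impI columns_eq_0 ballI)
  fix j p assume "sum_list la \<le> j" "p \<in> set la"
  then show "p \<le> j" using member_le_sum_list[of p la] by simp
qed

lemma is_partition_Cons:
  "is_partition (a # la) \<longleftrightarrow> 0 < a \<and> (\<forall>p\<in>set la. p \<le> a) \<and> is_partition la"
  by (auto simp: is_partition_def)

lemma less_columns_iff:
  "is_partition la \<Longrightarrow> k < columns la j \<longleftrightarrow> k < length la \<and> j < la ! k"
proof (induction la arbitrary: k)
  case Nil
  then show ?case by (simp add: columns_Nil)
next
  case (Cons a la)
  then have la: "is_partition la" "\<forall>p\<in>set la. p \<le> a" by (auto simp: is_partition_Cons)
  show ?case
  proof (cases "j < a")
    case True
    then show ?thesis using Cons.IH[OF la(1)] by (cases k) (auto simp: columns_Cons)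
  next
    case False
    then have "columns la j = 0" using la(2) by (intro columns_eq_0) auto
    moreover have "\<not> j < (a # la) ! k" if "k < length (a # la)"
      using la(2) False that by (cases k) (auto simp: not_less intro: order.trans)
    ultimately show ?thesis using False by (auto simp: columns_Cons)
  qed
qed

lemma diagram_eq_diag: "is_partition la \<Longrightarrow> diagram la = diag (columns la)"
proof -
  assume la: "is_partition la"
  have "(i, j) \<in> diagram la \<longleftrightarrow> (i, j) \<in> diag (columns la)" for i j
    using less_columns_iff[OF la, of "i - 1" "j - 1"] by (cases i; cases j) (auto simp: diagram_def diag_def)
  then show ?thesis by auto
qed

text \<open>Conjugation: row \<open>i\<close> consists of the columns higher than \<open>i\<close>,
  an initial segment because the heights are antimonotone.\<close>

lemma partition_of_columns:
  assumes am: "antimono \<mu>" and N: "\<forall>i\<ge>N. \<mu> i = 0"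
  obtains la where "is_partition la" "columns la = \<mu>"
proof -
  define f where "f i = card {j. i < \<mu> j}" for i
  have seg: "{j. i < \<mu> j} = {..<f i}" for i
  proof -
    define L where "L = (LEAST j. \<not> i < \<mu> j)"
    have "\<not> i < \<mu> N" using N by simp
    then have L: "\<not> i < \<mu> L" "\<And>j. j < L \<Longrightarrow> i < \<mu> j"
      unfolding L_def by (rule LeastI, blast dest: not_less_Least)
    have "{j. i < \<mu> j} = {..<L}"
    proof (intro set_eqI iffI)
      fix j assume "j \<in> {j. i < \<mu> j}"
      then have "\<not> L \<le> j" using L(1) antimonoD[OF am, of L j] by auto
      then show "j \<in> {..<L}" by simp
    qed (use L(2) in auto)
    then show ?thesis by (simp add: f_def)
  qed
  have seg': "i < \<mu> j \<longleftrightarrow> j < f i" for i j using seg[of i] by auto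
  define la where "la = map f [0..<\<mu> 0]"
  have anti: "f j \<le> f i" if "i \<le> j" for i j
  proof -
    have "{..<f j} \<subseteq> {..<f i}" unfolding seg[symmetric] using that by auto
    then show ?thesis by simp
  qed
  have "is_partition la"
    unfolding is_partition_def la_def
  proof
    show "sorted_wrt (\<ge>) (map f [0..<\<mu> 0])"
      unfolding sorted_wrt_map by (rule sorted_wrt_mono_rel[OF _ sorted_wrt_upt]) (use anti in auto)
    have "f i \<noteq> 0" if "i < \<mu> 0" for i using that seg'[of i 0] by simp
    then show "0 \<notin> set (map f [0..<\<mu> 0])" by force
  qed
  moreover have "columns la = \<mu>"
  proof
    fix j
    have "columns la j = card {i. i < \<mu> 0 \<and> j < f i}"
      unfolding columns_def la_def length_filter_conv_card by (rule arg_cong[where f = card]) auto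
    also have "{i. i < \<mu> 0 \<and> j < f i} = {..<\<mu> j}"
      using antimonoD[OF am, of 0 j] by (auto simp flip: seg')
    finally show "columns la j = \<mu> j" by simp
  qed
  ultimately show ?thesis using that by blast
qed

section \<open>Unitriangularity of the Kostka numbers\<close>

lemma strips_columns_Cons:
  assumes la: "is_partition (a # la)"
  shows "\<nu> \<in> strips (columns (a # la)) \<Longrightarrow> card {i. \<nu> i \<noteq> columns (a # la) i} \<le> a"
    and "{\<nu>. \<nu> \<in> strips (columns (a # la)) \<and> card {i. \<nu> i \<noteq> columns (a # la) i} = a} = {columns la}"
proof -
  let ?\<mu> = "columns (a # la)"
  have z: "?\<mu> i = 0" if "a \<le> i" for i
    using la that by (intro columns_eq_0) (auto simp: is_partition_Cons)
  \<comment> \<open>A strip touches only nonempty columns, and these are the first \<open>a\<close>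
    columns. A strip of size \<open>a\<close> therefore takes a box from each of them, which amounts
    to deleting the first row.\<close>
  have sub: "{i. \<nu> i \<noteq> ?\<mu> i} \<subseteq> {..<a}" if "\<nu> \<in> strips ?\<mu>" for \<nu>
  proof
    fix i assume "i \<in> {i. \<nu> i \<noteq> ?\<mu> i}"
    moreover have "\<nu> i = ?\<mu> i \<or> \<nu> i + 1 = ?\<mu> i" using that by (simp add: strips_def)
    ultimately have "?\<mu> i \<noteq> 0" by auto
    then show "i \<in> {..<a}" using z[of i] by (cases "a \<le> i") auto
  qed
  show "\<nu> \<in> strips ?\<mu> \<Longrightarrow> card {i. \<nu> i \<noteq> ?\<mu> i} \<le> a"
    using card_mono[OF _ sub] by force
  show "{\<nu>. \<nu> \<in> strips ?\<mu> \<and> card {i. \<nu> i \<noteq> ?\<mu> i} = a} = {columns la}"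
  proof (intro set_eqI iffI)
    fix \<nu> assume "\<nu> \<in> {\<nu>. \<nu> \<in> strips ?\<mu> \<and> card {i. \<nu> i \<noteq> ?\<mu> i} = a}"
    then have \<nu>: "\<nu> \<in> strips ?\<mu>" "card {i. \<nu> i \<noteq> ?\<mu> i} = a" by auto
    have "{i. \<nu> i \<noteq> ?\<mu> i} = {..<a}" using sub[OF \<nu>(1)] \<nu>(2) by (intro card_subset_eq) auto
    moreover have "\<nu> i = ?\<mu> i \<or> \<nu> i + 1 = ?\<mu> i" for i using \<nu>(1) by (simp add: strips_def)
    ultimately have "\<nu> i = columns la i" for i
      unfolding columns_Cons by (cases "i < a") (force simp: set_eq_iff)+
    then show "\<nu> \<in> {columns la}" by auto
  next
    fix \<nu> assume "\<nu> \<in> {columns la}"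
    then have \<nu>: "\<nu> = columns la" by simp
    have "{i. \<nu> i \<noteq> ?\<mu> i} = {..<a}" by (auto simp: \<nu> columns_Cons)
    moreover have "\<nu> \<in> strips ?\<mu>" using antimono_columns[of la] by (auto simp: \<nu> strips_def columns_Cons)
    ultimately show "\<nu> \<in> {\<nu>. \<nu> \<in> strips ?\<mu> \<and> card {i. \<nu> i \<noteq> ?\<mu> i} = a}" by simp
  qed
qed

lemma kostka_diagonal: "is_partition la \<Longrightarrow> kostka (columns la) (map int la) = 1"
proof (induction la)
  case (Cons a la)
  then show ?case using strips_columns_Cons(2)[OF Cons.prems] by (simp add: is_partition_Cons)
qed (simp add: columns_Nil)

text \<open>The order on lists is lexicographic. The first strip has as many boxes as the first part
  of \<open>la\<close>, and no strip is larger than the first part of \<open>la'\<close>. If the two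
  parts are equal, the strip is unique and the tails are compared.\<close>

lemma kostka_triangular:
  "is_partition la \<Longrightarrow> is_partition la' \<Longrightarrow> kostka (columns la') (map int la) \<noteq> 0 \<Longrightarrow> la \<le> la'"
proof (induction la arbitrary: la')
  case (Cons a la)
  have "{\<nu>. \<nu> \<in> strips (columns la') \<and> int (card {i. \<nu> i \<noteq> columns la' i}) = int a} \<noteq> {}"
  proof
    assume "{\<nu>. \<nu> \<in> strips (columns la') \<and> int (card {i. \<nu> i \<noteq> columns la' i}) = int a} = {}"
    then have "kostka (columns la') (map int (a # la)) = 0" by (simp only: list.map kostka.simps sum.empty)
    then show False using Cons.prems(3) by contradiction
  qed
  then obtain \<nu> where \<nu>: "\<nu> \<in> strips (columns la')" "card {i. \<nu> i \<noteq> columns la' i} = a" by auto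
  show ?case
  proof (cases la')
    case Nil
    have "\<nu> i = columns la' i" for i using \<nu>(1) by (auto simp: Nil columns_Nil strips_def)
    then have "a = 0" using \<nu>(2) by simp
    then show ?thesis using Cons.prems by (simp add: is_partition_Cons)
  next
    case (Cons a' l')
    have l': "is_partition (a' # l')" using Cons.prems Cons by simp
    have le: "a \<le> a'" using strips_columns_Cons(1)[OF l'] \<nu> Cons by auto
    show ?thesis
    proof (cases "a = a'")
      case True
      then have "kostka (columns l') (map int la) \<noteq> 0"
        using Cons.prems(3) strips_columns_Cons(2)[OF l'] unfolding Cons by simp
      then have "la \<le> l'" using Cons.IH[of l'] Cons.prems(1) l' by (simp add: is_partition_Cons)
      then show ?thesis using True Cons by simp
    next
      case False
      then show ?thesis using le Cons by simp
    qed
  qed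
qed simp

text \<open>Equal column heights give equal Kostka numbers, so the diagonal entries \<open>1\<close>
  make triangularity apply in both directions.\<close>

lemma columns_inj: "is_partition la \<Longrightarrow> is_partition la' \<Longrightarrow> columns la = columns la' \<Longrightarrow> la = la'"
  using kostka_triangular[of la la'] kostka_triangular[of la' la] kostka_diagonal[of la] kostka_diagonal[of la']
  by (intro order.antisym) auto

lemma schur_eq_kostka:
  assumes la: "is_partition la" and m: "\<forall>b\<in>#m. - int k < b \<and> b \<le> 0"
  shows "schur la m = kostka (columns la) (counts m 0 k)"
proof -
  have "semistandard_tableaux la = tableaux 0 (columns la)"
    by (simp add: semistandard_tableaux_def tableaux_def diagram_eq_diag[OF la])
  then show ?thesis
    using tableaux_kostka[OF antimono_columns columns_support, of m 0 k la] m
    by (simp add: schur_def content_def diagram_eq_diag[OF la])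
qed

lemma schur_zero:
  assumes la: "is_partition la" and b: "b \<in># m" "0 < b"
  shows "schur la m = 0"
proof -
  have fin: "finite (diagram la)"
    unfolding diagram_eq_diag[OF la] by (rule finite_diag[OF antimono_columns columns_support])
  have e: "{T \<in> semistandard_tableaux la. image_mset T (mset_set (diagram la)) = m} = {}"
  proof (intro equals0I)
    fix T assume "T \<in> {T \<in> semistandard_tableaux la. image_mset T (mset_set (diagram la)) = m}"
    then have "T \<in> diagram la \<rightarrow>\<^sub>E {..0}" "b \<in># image_mset T (mset_set (diagram la))"
      using b by (auto simp: semistandard_tableaux_def)
    then show False using fin b by (fastforce simp: PiE_iff)
  qed
  show ?thesis unfolding schur_def e by simp
qed

lemma multiset_with_counts:
  obtains m where "\<forall>b\<in>#m. - int (length la) < b \<and> b \<le> 0" "counts m 0 (length la) = map int la"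
proof -
  define m where "m = (\<Sum>i<length la. replicate_mset (la ! i) (- int i))"
  have c: "count m (- int l) = la ! l" if "l < length la" for l
    using that by (simp add: m_def count_sum if_distrib cong: if_cong)
  have "\<forall>b\<in>#m. - int (length la) < b \<and> b \<le> 0"
    by (auto simp: m_def set_mset_sum split: if_splits)
  moreover have "counts m 0 (length la) = map int la"
    by (rule nth_equalityI) (auto simp: counts_def c)
  ultimately show ?thesis using that by blast
qed

text \<open>Let \<open>la\<close> be the lexicographically largest partition with different
  coefficients. On a monomial with exponents \<open>la\<close>, all other Schur functions in the
  difference vanish by triangularity, and that of \<open>la\<close> has the coefficient
  \<open>1\<close>.\<close>

lemma schur_expansion_unique:
  assumes c: "schur_expansion F c" and c': "schur_expansion F c'"
  shows "c = c'"
proof (rule ccontr)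
  assume "c \<noteq> c'"
  define Z where "Z = {la. c la \<noteq> 0} \<union> {la. c' la \<noteq> 0}"
  define X where "X = {la. c la \<noteq> c' la}"
  have Z: "finite Z" and part: "\<And>la. la \<in> Z \<Longrightarrow> is_partition la"
    using c c' by (auto simp: Z_def schur_expansion_def)
  have XZ: "X \<subseteq> Z" by (auto simp: X_def Z_def)
  then have "finite X" using Z finite_subset by blast
  moreover have "X \<noteq> {}" using \<open>c \<noteq> c'\<close> by (auto simp: X_def fun_eq_iff)
  ultimately have Max: "Max X \<in> X" "\<And>la. la \<in> X \<Longrightarrow> la \<le> Max X" by auto
  define la where "la = Max X"
  obtain m where m: "\<forall>b\<in>#m. - int (length la) < b \<and> b \<le> 0" "counts m 0 (length la) = map int la"
    using multiset_with_counts .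
  have F: "F m = (\<Sum>la\<in>Z. d la * schur la m)" if "schur_expansion F d" "{la. d la \<noteq> 0} \<subseteq> Z" for d
    using that Z unfolding schur_expansion_def by (auto intro!: sum.mono_neutral_left)
  have "(\<Sum>l\<in>Z. (c l - c' l) * schur l m) = 0"
    using F[OF c] F[OF c'] by (simp add: Z_def left_diff_distrib sum_subtractf)
  also have "(\<Sum>l\<in>Z. (c l - c' l) * schur l m) = (\<Sum>l\<in>{la}. (c l - c' l) * schur l m)"
  proof (rule sum.mono_neutral_right)
    show "\<forall>l\<in>Z - {la}. (c l - c' l) * schur l m = 0"
    proof
      fix l assume l: "l \<in> Z - {la}"
      show "(c l - c' l) * schur l m = 0"
      proof (cases "l \<in> X")
        case True
        have "schur l m = kostka (columns l) (map int la)" using schur_eq_kostka[OF part m(1)] l m(2) by simp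
        moreover have "\<not> la \<le> l" using Max(2)[OF True] l by (auto simp: la_def)
        ultimately have "schur l m = 0" using kostka_triangular[of la l] part l Max(1) XZ la_def by auto
        then show ?thesis by simp
      qed (simp add: X_def)
    qed
  qed (use Z Max(1) XZ in \<open>auto simp: la_def\<close>)
  also have "\<dots> = c la - c' la"
    using schur_eq_kostka[OF part m(1), of la] kostka_diagonal[of la] part Max(1) XZ m(2) by (auto simp: la_def)
  finally show False using Max(1) by (simp add: X_def la_def)
qed

section \<open>Counting EG pipedreams by shape\<close>

definition eg_columns :: "nat \<Rightarrow> tiling \<Rightarrow> nat \<Rightarrow> nat" where
  "eg_columns n P = heights_then n (\<lambda>_. 0) (height n n P)"

lemma eg_columns_shape:
  assumes P: "P \<in> eg_tilings n n w"
  obtains la where "is_partition la" "columns la = eg_columns n P" "empty_squares n P = diagram la"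
proof -
  have "antimono (eg_columns n P)"
    unfolding antimono_iff_le_Suc using height_antimono[OF P] by (auto simp: eg_columns_def heights_then_def)
  moreover have "\<forall>i\<ge>n. eg_columns n P i = 0" by (simp add: eg_columns_def heights_then_def)
  ultimately obtain la where la: "is_partition la" "columns la = eg_columns n P"
    using partition_of_columns by blast
  have hn: "height n n P j \<le> n" for j
  proof -
    have "card {i \<in> {1..n}. P (i, j) = Empty} \<le> card {1..n}" by (intro card_mono) auto
    then show ?thesis by (simp add: height_def)
  qed
  have "(i, j) \<in> empty_squares n P \<longleftrightarrow> (i, j) \<in> diagram la" for i j
  proof (cases "i \<in> {1..n} \<and> j \<in> {1..n}")
    case True
    then show ?thesis using eg_tiling_empty_iff[OF P, of i j]
      by (auto simp: empty_squares_def diagram_eq_diag[OF la(1)] la(2) diag_def eg_columns_def heights_then_def)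
  next
    case False
    then show ?thesis using hn[of j]
      by (auto simp: empty_squares_def diagram_eq_diag[OF la(1)] la(2) diag_def eg_columns_def heights_then_def split: if_splits)
  qed
  then have "empty_squares n P = diagram la" by auto
  then show ?thesis using that la by blast
qed

lemma EG_shape_eq:
  assumes la: "is_partition la" "empty_squares n P = diagram la"
  shows "EG_shape n P = la"
  unfolding EG_shape_def
proof (rule the_equality)
  fix la' assume la': "is_partition la' \<and> empty_squares n P = diagram la'"
  then have d: "diag (columns la') = diag (columns la)" using la diagram_eq_diag by metis
  have "k < columns la' j \<longleftrightarrow> k < columns la j" for k j
  proof -
    have "(Suc k, Suc j) \<in> diag (columns la') \<longleftrightarrow> (Suc k, Suc j) \<in> diag (columns la)" using d by simp
    then show ?thesis by (simp add: diag_def Suc_le_eq)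
  qed
  then have "columns la' = columns la" by (metis ext less_irrefl linorder_neqE_nat)
  then show "la' = la" using columns_inj la la' by blast
qed (use la in simp)

text \<open>A partition shape has top-justified columns. Conversely, top-justified columns of a
  labelled tiling have weakly decreasing heights, so they form a partition shape by
  \<open>eg_columns_shape\<close>.\<close>

lemma EG_pipedream_iff:
  assumes w: "w permutes {1..n}"
  shows "EG_pipedream n w P \<longleftrightarrow> P \<in> eg_tilings n n w"
proof
  assume eg: "EG_pipedream n w P"
  then obtain la where sq: "square_bumpless_pipedream n w P" and la: "is_partition la" "empty_squares n P = diagram la"
    by (auto simp: EG_pipedream_def)
  have "top_empty n n P"
    unfolding top_empty_def
  proof (intro ballI impI)
    fix j i i' assume ij: "j \<in> {1..n}" "i \<in> {1..n}" "P (i, j) = Empty" "i' \<in> {1..i}"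
    then have "(i, j) \<in> diagram la" unfolding la(2)[symmetric] by (simp add: empty_squares_def)
    then have "(i', j) \<in> diagram la" using ij by (auto simp: diagram_eq_diag[OF la(1)] diag_def)
    then show "P (i', j) = Empty" unfolding la(2)[symmetric] by (simp add: empty_squares_def)
  qed
  then show "P \<in> eg_tilings n n w"
    using sq unfolding square_bumpless_pipedream_iff[OF w] eg_tilings_def by blast
next
  assume P: "P \<in> eg_tilings n n w"
  then have "square_bumpless_pipedream n w P"
    unfolding square_bumpless_pipedream_iff[OF w] eg_tilings_def by blast
  moreover obtain la where "is_partition la" "empty_squares n P = diagram la"
    using eg_columns_shape[OF P] by blast
  ultimately show "EG_pipedream n w P" unfolding EG_pipedream_def by blast
qed

text \<open>The starting point: all \<open>n\<close> columns of tiles are present and none is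
  stored. The identity part of \<open>ext_int\<close> supplies the rows and labels
  \<open>- n, \<dots>, 0\<close>, which encode heights \<open>0\<close>.\<close>

lemma state_ext_int:
  assumes w: "w permutes {1..n}"
  shows "state n n (\<lambda>_. 0) (ext_int w)"
  unfolding state_def
proof (intro conjI allI impI)
  show "ext_int w permutes {- int n..int n}" by (rule ext_int_permutes'[OF w])
  fix x y :: int assume xy: "x < y \<and> int n < ext_int w x \<and> int n < ext_int w y"
  have "ext_int w z = z" if "int n < ext_int w z" for z
    using permutes_not_in[OF ext_int_permutes[OF w], of z] permutes_in_image[OF ext_int_permutes[OF w], of z] that by force
  then show "ext_int w x < ext_int w y" using xy by metis
qed (auto simp: ext_int_def antimono_def split: if_splits)

text \<open>Every tiling contributes the Kostka number of its own shape, which is a coefficient of a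
  Schur function; grouping the tilings by shape gives the expansion. On monomials with a positive
  subscript both sides are \<open>0\<close>.\<close>

lemma stanley_expansion:
  assumes w: "w permutes {1..n}"
  shows "schur_expansion (stanley n w)
    (\<lambda>la. if is_partition la then int (card {P. EG_pipedream n w P \<and> EG_shape n P = la}) else 0)"
    (is "schur_expansion _ ?c")
proof -
  let ?G = "eg_tilings n n w"
  have G: "{P. EG_pipedream n w P \<and> EG_shape n P = la} = {P \<in> ?G. EG_shape n P = la}" for la
    using EG_pipedream_iff[OF w] by auto
  have shape: "is_partition (EG_shape n P) \<and> columns (EG_shape n P) = eg_columns n P" if P: "P \<in> ?G" for P
  proof -
    obtain la where "is_partition la" "columns la = eg_columns n P" "empty_squares n P = diagram la"
      using eg_columns_shape[OF P] .
    then show ?thesis using EG_shape_eq by simp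
  qed
  have supp: "{la. ?c la \<noteq> 0} = EG_shape n ` ?G"
    using shape finite_eg_tilings[of n n w] unfolding G by (auto simp: card_eq_0_iff)
  have "stanley n w m = (\<Sum>la | ?c la \<noteq> 0. ?c la * schur la m)" for m
  proof (cases "\<exists>b\<in>#m. 0 < b")
    case True
    then obtain b where b: "b \<in># m" "0 < b" by blast
    have "schur la m = 0" if "?c la \<noteq> 0" for la using schur_zero[OF _ b, of la] that by (auto split: if_splits)
    then have "(\<Sum>la | ?c la \<noteq> 0. ?c la * schur la m) = 0" by (intro sum.neutral) auto
    then show ?thesis using stanley_zero[OF b] by simp
  next
    case False
    have "\<exists>k. \<forall>b\<in>#m. - int k < b"
    proof (cases "m = {#}")
      case False
      have "- int (nat (1 - Min (set_mset m))) < b" if "b \<in># m" for b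
        using Min_le[OF _ that] by simp
      then show ?thesis by blast
    qed simp
    then obtain k where k: "\<forall>b\<in>#m. - int k < b \<and> b \<le> 0" using False by (meson not_less)
    have "rows n (ext_int w) i = w i" if "i \<in> {1..n}" for i
      using permutes_in_image[OF w, of i] that by (auto simp: rows_def ext_int_def)
    then have e: "eg_tilings n n (rows n (ext_int w)) = ?G" by (rule eg_tilings_cong)
    have "stanley n w m = peel_sym n (counts m 0 k) (ext_int w)" by (rule stanley_eq_peel_sym[OF w k])
    also have "\<dots> = (\<Sum>P\<in>?G. kostka (eg_columns n P) (counts m 0 k))"
      unfolding state_expansion[OF state_ext_int[OF w]] e eg_columns_def ..
    also have "\<dots> = (\<Sum>P\<in>?G. schur (EG_shape n P) m)"
      using shape schur_eq_kostka[OF _ k] by (intro sum.cong) auto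
    also have "\<dots> = (\<Sum>la\<in>EG_shape n ` ?G. \<Sum>P | P \<in> ?G \<and> EG_shape n P = la. schur (EG_shape n P) m)"
      by (rule sum.image_gen[OF finite_eg_tilings])
    also have "\<dots> = (\<Sum>la\<in>EG_shape n ` ?G. ?c la * schur la m)"
      using shape unfolding G by (intro sum.cong) auto
    finally show ?thesis unfolding supp .
  qed
  then show ?thesis
    unfolding schur_expansion_def using supp finite_eg_tilings by (auto split: if_splits)
qed

theorem theorem5p14:
  fixes n :: nat and w :: "nat \<Rightarrow> nat" and la :: "nat list"
  assumes "w permutes {1..n}" and "is_partition la"
  shows "EG_coeff n w la = int (card {P. EG_pipedream n w P \<and> EG_shape n P = la})"
proof -
  have "EG_coeff n w = (\<lambda>la. if is_partition la then int (card {P. EG_pipedream n w P \<and> EG_shape n P = la}) else 0)"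
    unfolding EG_coeff_def
  proof (rule the_equality)
    show "schur_expansion (stanley n w)
      (\<lambda>la. if is_partition la then int (card {P. EG_pipedream n w P \<and> EG_shape n P = la}) else 0)"
      by (rule stanley_expansion[OF assms(1)])
    then show "c = (\<lambda>la. if is_partition la then int (card {P. EG_pipedream n w P \<and> EG_shape n P = la}) else 0)"
      if "schur_expansion (stanley n w) c" for c
      using that schur_expansion_unique by blast
  qed
  then show ?thesis using assms(2) by simp
qed

end
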